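(* Let $\mathfrak{A}=\{\mathfrak{A}_k\}_k$ be a holomorphy type and let $E$ be a complex Banach space with separable dual such that finite type polynomials are dense in $\mathfrak{A}_k(E)$ for every $k$. Suppose that $\mathfrak{A}$ is weakly differentiable at $E$ with constants $c_{k,l}$ satisfying $$c_{k,l}\le\frac{(k+l)^{k+l}}{(k+l)!}\,\frac{k!}{k^k}\,\frac{l!}{l^l}\quad\text{for every } k,l.$$ Let $z_0\in E$ be a non-zero vector and let $\tau_{z_0}:\mathcal{H}_{b\mathfrak{A}}(E)\to\mathcal{H}_{b\mathfrak{A}}(E)$ be the translation operator $\tau_{z_0}(f)(z)=f(z+z_0)$. Then: (a) Given $\varepsilon>0$, there exist $C>0$ and an entire function $f\in\mathcal{H}_{b\mathfrak{A}}(E)$ which is frequently hypercyclic for $\tau_{z_0}$ and satisfies $|f(z)|\le Ce^{\varepsilon\|z\|}$ for all $z\in E$. (b) Let $\varepsilon:\mathbb{R}_+\to\mathbb{R}_+$ be a function such that $\liminf_{r\to\infty}\varepsilon(r)=0$ and let $C$ be any positive number. Then there is no frequently hypercyclic entire function $f\in\mathcal{H}_{b\mathfrak{A}}(E)$ for $\tau_{z_0}$ satisfying $|f(z)|\le Ce^{\varepsilon(\|z\|)\|z\|}$ for all $z\in E$.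
   Context: All Banach spaces are complex. For a Banach space $E$, $\mathcal{P}(^kE)$ is the Banach space of continuous $k$-homogeneous polynomials $P:E\to\mathbb{C}$ with norm $\sup_{\|z\|=1}|P(z)|$ (and $\mathcal{P}(^0E)=\mathbb{C}$); $\overset{\vee}{P}$ is the symmetric $k$-linear form associated to $P$. The finite type polynomials of degree $k$ are the elements of the linear span of $\{\gamma(\cdot)^k:\gamma\in E'\}$, where $E'$ is the dual of $E$. $\mathcal{H}(E)$ is the space of holomorphic functions $E\to\mathbb{C}$; for $f\in\mathcal{H}(E)$, $\frac{d^kf(0)}{k!}$ is the $k$-homogeneous polynomial that is the $k$-th term of the Taylor series of $f$ at $0$. For $P\in\mathcal{P}(^kE)$, $a\in E$, $0\le j\le k$, let $P_{a^j}\in\mathcal{P}(^{k-j}E)$ be $P_{a^j}(x)=\overset{\vee}{P}(a,\dots,a,x,\dots,x)$ with $a$ repeated $j$ times and $x$ repeated $k-j$ times. A Banach ideal of scalar-valued continuous $k$-homogeneous polynomials ($k\ge 0$) is a pair $(\mathfrak{A}_k,\|\cdot\|_{\mathfrak{A}_k})$ such that: (i) for every Banach space $E$, $\mathfrak{A}_k(E)=\mathfrak{A}_k\cap\mathcal{P}(^kE)$ is a linear subspace of $\mathcal{P}(^kE)$ and $\|\cdot\|_{\mathfrak{A}_k(E)}$ is a norm making it a Banach space; (ii) if $R:E_1\to E$ is bounded and linear and $P\in\mathfrak{A}_k(E)$ then $P\circ R\in\mathfrak{A}_k(E_1)$ and $\|P\circ R\|_{\mathfrak{A}_k(E_1)}\le\|P\|_{\mathfrak{A}_k(E)}\|R\|^k$;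 (iii) $z\mapsto z^k$ belongs to $\mathfrak{A}_k(\mathbb{C})$ and has norm $1$. A holomorphy type is a sequence $\mathfrak{A}=\{\mathfrak{A}_k\}_{k=0}^\infty$, where each $\mathfrak{A}_k$ is a Banach ideal of $k$-homogeneous polynomials, for which there exist constants $c$ and $C_{k,l}$ with $C_{k,l}\le c^k$ for all $0\le l\le k$ such that for every Banach space $E$, $P\in\mathfrak{A}_k(E)$ and $a\in E$: $P_{a^l}\in\mathfrak{A}_{k-l}(E)$ and $\|P_{a^l}\|_{\mathfrak{A}_{k-l}(E)}\le C_{k,l}\|P\|_{\mathfrak{A}_k(E)}\|a\|^l$. $\mathfrak{A}$ is weakly differentiable at $E$ with constants $c_{k,l}>0$ if for $0\le l\le k$, $P\in\mathfrak{A}_k(E)$ and $\varphi\in\mathfrak{A}_{k-l}(E)'$, the mapping $x\mapsto\varphi(P_{x^l})$ belongs to $\mathfrak{A}_l(E)$ and $\|x\mapsto\varphi(P_{x^l})\|_{\mathfrak{A}_l(E)}\le c_{k,l}\|\varphi\|_{\mathfrak{A}_{k-l}(E)'}\|P\|_{\mathfrak{A}_k(E)}$. (Convention $0^0=1$.) $\mathcal{H}_{b\mathfrak{A}}(E)$ is the set of $f\in\mathcal{H}(E)$ such that $d^kf(0)\in\mathfrak{A}_k(E)$ for every $k$ and $\lim_{k\to\infty}\left\|\frac{d^kf(0)}{k!}\right\|_{\mathfrak{A}_k}^{1/k}=0$; it is a Fréchet space with the seminorms $p_s(f)=\sum_{k=0}^\infty s^k\left\|\frac{d^kf(0)}{k!}\right\|_{\mathfrak{A}_k}$,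 $s>0$. Translations are continuous linear operators on it. A vector $f\in X$ is frequently hypercyclic for a continuous linear operator $T:X\to X$ if for every non-empty open set $U\subset X$ the set $\{n\ge0:T^nf\in U\}$ has positive lower density; here $X=\mathcal{H}_{b\mathfrak{A}}(E)$. $\mathbb{R}_+=[0,\infty)$. *)

theory Defs
  imports "HOL-Analysis.Analysis"
begin

section \<open>Complex Banach spaces with explicit carrier\<close>

text \<open>
  Polynomial ideals quantify over all Banach spaces, so Banach spaces have to be values rather
  than types. A Banach space is a record whose carrier is a subset of an arbitrary type 'a, which
  plays the role of a universe. Off the carrier the operations are arbitrary.
\<close>

record 'a cnspace =
  carr :: "'a set"
  vadd :: "'a \<Rightarrow> 'a \<Rightarrow> 'a"
  vzero :: 'a
  vscale :: "complex \<Rightarrow> 'a \<Rightarrow> 'a"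
  vnorm :: "'a \<Rightarrow> real"

definition vsub :: "'a cnspace \<Rightarrow> 'a \<Rightarrow> 'a \<Rightarrow> 'a" where
  "vsub E x y = vadd E x (vscale E (-1) y)"

text \<open>The value 0 off the carrier is there because the library's metric-space locale asks for
  nonnegativity and symmetry on the whole type.\<close>

definition vdist :: "'a cnspace \<Rightarrow> 'a \<Rightarrow> 'a \<Rightarrow> real" where
  "vdist E x y = (if x \<in> carr E \<and> y \<in> carr E then vnorm E (vsub E x y) else 0)"

definition vtopology :: "'a cnspace \<Rightarrow> 'a topology" where
  "vtopology E = Metric_space.mtopology (carr E) (vdist E)"

locale complex_normed =
  fixes E :: "'a cnspace"
  assumes zero_closed: "vzero E \<in> carr E"
    and add_closed: "\<lbrakk>x \<in> carr E; y \<in> carr E\<rbrakk> \<Longrightarrow> vadd E x y \<in> carr E"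
    and scale_closed: "x \<in> carr E \<Longrightarrow> vscale E a x \<in> carr E"
    and add_assoc: "\<lbrakk>x \<in> carr E; y \<in> carr E; z \<in> carr E\<rbrakk>
          \<Longrightarrow> vadd E (vadd E x y) z = vadd E x (vadd E y z)"
    and add_commute: "\<lbrakk>x \<in> carr E; y \<in> carr E\<rbrakk> \<Longrightarrow> vadd E x y = vadd E y x"
    and add_zero: "x \<in> carr E \<Longrightarrow> vadd E (vzero E) x = x"
    and add_neg: "x \<in> carr E \<Longrightarrow> vadd E x (vscale E (-1) x) = vzero E"
    and scale_add_right: "\<lbrakk>x \<in> carr E; y \<in> carr E\<rbrakk>
          \<Longrightarrow> vscale E a (vadd E x y) = vadd E (vscale E a x) (vscale E a y)"
    and scale_add_left: "x \<in> carr E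
          \<Longrightarrow> vscale E (a + b) x = vadd E (vscale E a x) (vscale E b x)"
    and scale_scale: "x \<in> carr E \<Longrightarrow> vscale E a (vscale E b x) = vscale E (a * b) x"
    and scale_one: "x \<in> carr E \<Longrightarrow> vscale E 1 x = x"
    and norm_eq_zero: "x \<in> carr E \<Longrightarrow> vnorm E x = 0 \<longleftrightarrow> x = vzero E"
    and norm_triangle: "\<lbrakk>x \<in> carr E; y \<in> carr E\<rbrakk>
          \<Longrightarrow> vnorm E (vadd E x y) \<le> vnorm E x + vnorm E y"
    and norm_scale: "x \<in> carr E \<Longrightarrow> vnorm E (vscale E a x) = cmod a * vnorm E x"

locale complex_banach = complex_normed +
  assumes complete: "Metric_space.mcomplete (carr E) (vdist E)"

definition complex_space :: "complex cnspace" where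
  "complex_space = \<lparr>carr = UNIV, vadd = (+), vzero = 0, vscale = (*), vnorm = cmod\<rparr>"

text \<open>
  Scalar functions on a space E are represented by functions on the whole type that vanish off
  the carrier of E, so that the pointwise operations are those of the function space.
\<close>

definition on_carr :: "'a cnspace \<Rightarrow> ('a \<Rightarrow> complex) \<Rightarrow> 'a \<Rightarrow> complex" where
  "on_carr E f = (\<lambda>x. if x \<in> carr E then f x else 0)"

definition fun_space :: "('a \<Rightarrow> complex) set \<Rightarrow> (('a \<Rightarrow> complex) \<Rightarrow> real) \<Rightarrow> ('a \<Rightarrow> complex) cnspace" where
  "fun_space S N =
     \<lparr>carr = S, vadd = (\<lambda>f g x. f x + g x), vzero = (\<lambda>x. 0), vscale = (\<lambda>a f x. a * f x), vnorm = N\<rparr>"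

definition bounded_lin :: "'a cnspace \<Rightarrow> 'b cnspace \<Rightarrow> ('a \<Rightarrow> 'b) \<Rightarrow> bool" where
  "bounded_lin E F R \<longleftrightarrow>
     (\<forall>x\<in>carr E. R x \<in> carr F) \<and>
     (\<forall>x\<in>carr E. \<forall>y\<in>carr E. R (vadd E x y) = vadd F (R x) (R y)) \<and>
     (\<forall>x\<in>carr E. \<forall>a. R (vscale E a x) = vscale F a (R x)) \<and>
     (\<exists>K. \<forall>x\<in>carr E. vnorm F (R x) \<le> K * vnorm E x)"

definition opnorm :: "'a cnspace \<Rightarrow> 'b cnspace \<Rightarrow> ('a \<Rightarrow> 'b) \<Rightarrow> real" where
  "opnorm E F R = (SUP x\<in>{x\<in>carr E. vnorm E x \<le> 1}. vnorm F (R x))"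

definition dual_space :: "'a cnspace \<Rightarrow> ('a \<Rightarrow> complex) cnspace" where
  "dual_space E =
     fun_space {\<phi>. bounded_lin E complex_space \<phi> \<and> (\<forall>x. x \<notin> carr E \<longrightarrow> \<phi> x = 0)}
       (opnorm E complex_space)"

definition isometric_iso :: "'a cnspace \<Rightarrow> 'b cnspace \<Rightarrow> ('a \<Rightarrow> 'b) \<Rightarrow> bool" where
  "isometric_iso E F J \<longleftrightarrow>
     bounded_lin E F J \<and> J ` carr E = carr F \<and> (\<forall>x\<in>carr E. vnorm F (J x) = vnorm E x)"


section \<open>Homogeneous polynomials\<close>

definition vlists :: "'a cnspace \<Rightarrow> nat \<Rightarrow> 'a list set" where
  "vlists E k = {xs. length xs = k \<and> set xs \<subseteq> carr E}"

text \<open>A k-linear form takes the list of its k arguments; it is 0 on all other lists, which makes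
  it determined by its values on k-tuples of vectors.\<close>

definition multilinear_form :: "'a cnspace \<Rightarrow> nat \<Rightarrow> ('a list \<Rightarrow> complex) \<Rightarrow> bool" where
  "multilinear_form E k M \<longleftrightarrow>
     (\<forall>xs\<in>vlists E k. \<forall>i<k. \<forall>u\<in>carr E. \<forall>v\<in>carr E.
        M (xs[i := vadd E u v]) = M (xs[i := u]) + M (xs[i := v])) \<and>
     (\<forall>xs\<in>vlists E k. \<forall>i<k. \<forall>u\<in>carr E. \<forall>a.
        M (xs[i := vscale E a u]) = a * M (xs[i := u])) \<and>
     (\<forall>xs. xs \<notin> vlists E k \<longrightarrow> M xs = 0)"

definition symmetric_form :: "('a list \<Rightarrow> complex) \<Rightarrow> bool" where
  "symmetric_form M \<longleftrightarrow> (\<forall>xs ys. mset xs = mset ys \<longrightarrow> M xs = M ys)"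

definition hom_polys :: "'a cnspace \<Rightarrow> nat \<Rightarrow> ('a \<Rightarrow> complex) set" where
  "hom_polys E k =
     {P. (\<exists>M. multilinear_form E k M \<and> (\<forall>x\<in>carr E. P x = M (replicate k x))) \<and>
         continuous_map (vtopology E) euclidean P \<and>
         (\<forall>x. x \<notin> carr E \<longrightarrow> P x = 0)}"

definition polar_form :: "'a cnspace \<Rightarrow> nat \<Rightarrow> ('a \<Rightarrow> complex) \<Rightarrow> 'a list \<Rightarrow> complex" where
  "polar_form E k P =
     (THE M. multilinear_form E k M \<and> symmetric_form M \<and> (\<forall>x\<in>carr E. M (replicate k x) = P x))"

text \<open>The polynomial written P with index a to the j, for P homogeneous of degree k.\<close>

definition poly_insert :: "'a cnspace \<Rightarrow> nat \<Rightarrow> ('a \<Rightarrow> complex) \<Rightarrow> 'a \<Rightarrow> nat \<Rightarrow> 'a \<Rightarrow> complex" where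
  "poly_insert E k P a j = on_carr E (\<lambda>x. polar_form E k P (replicate j a @ replicate (k - j) x))"

definition finite_type_polys :: "'a cnspace \<Rightarrow> nat \<Rightarrow> ('a \<Rightarrow> complex) set" where
  "finite_type_polys E k =
     {on_carr E (\<lambda>x. \<Sum>\<gamma>\<in>G. b \<gamma> * \<gamma> x ^ k) | G b. finite G \<and> G \<subseteq> carr (dual_space E)}"


section \<open>Banach ideals of polynomials and holomorphy types\<close>

text \<open>An ideal assigns to each space the set of polynomials in the ideal and their ideal norm.\<close>

type_synonym 'a poly_ideal =
  "('a cnspace \<Rightarrow> ('a \<Rightarrow> complex) set) \<times> ('a cnspace \<Rightarrow> ('a \<Rightarrow> complex) \<Rightarrow> real)"

definition ideal_space :: "'a poly_ideal \<Rightarrow> 'a cnspace \<Rightarrow> ('a \<Rightarrow> complex) cnspace" where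
  "ideal_space \<AA> E = fun_space (fst \<AA> E) (snd \<AA> E)"

text \<open>The universe 'a need not literally contain the complex numbers, so the normalisation of the
  k-th power of the coordinate is imposed on every isometric copy of the complex plane in 'a
  (by the ideal property, it holds for all copies as soon as it holds for one). Such copies exist
  as soon as 'a carries a nonzero Banach space, e.g. as the line spanned by a nonzero vector.\<close>

definition banach_ideal :: "nat \<Rightarrow> 'a poly_ideal \<Rightarrow> bool" where
  "banach_ideal k \<AA> \<longleftrightarrow>
     (\<forall>E. complex_banach E \<longrightarrow>
        carr (ideal_space \<AA> E) \<subseteq> hom_polys E k \<and> complex_banach (ideal_space \<AA> E)) \<and>
     (\<forall>E E1 R P. complex_banach E \<longrightarrow> complex_banach E1 \<longrightarrow> bounded_lin E1 E R \<longrightarrow>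
        P \<in> carr (ideal_space \<AA> E) \<longrightarrow>
        on_carr E1 (P \<circ> R) \<in> carr (ideal_space \<AA> E1) \<and>
        vnorm (ideal_space \<AA> E1) (on_carr E1 (P \<circ> R))
          \<le> vnorm (ideal_space \<AA> E) P * opnorm E1 E R ^ k) \<and>
     (\<forall>F J. complex_banach F \<longrightarrow> isometric_iso F complex_space J \<longrightarrow>
        on_carr F (\<lambda>z. J z ^ k) \<in> carr (ideal_space \<AA> F) \<and>
        vnorm (ideal_space \<AA> F) (on_carr F (\<lambda>z. J z ^ k)) = 1)"

definition holomorphy_type :: "(nat \<Rightarrow> 'a poly_ideal) \<Rightarrow> bool" where
  "holomorphy_type \<AA> \<longleftrightarrow>
     (\<forall>k. banach_ideal k (\<AA> k)) \<and>
     (\<exists>(c::real) (C :: nat \<Rightarrow> nat \<Rightarrow> real).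
        (\<forall>k l. l \<le> k \<longrightarrow> C k l \<le> c ^ k) \<and>
        (\<forall>E k l P a. complex_banach E \<longrightarrow> l \<le> k \<longrightarrow> P \<in> carr (ideal_space (\<AA> k) E) \<longrightarrow> a \<in> carr E \<longrightarrow>
           poly_insert E k P a l \<in> carr (ideal_space (\<AA> (k - l)) E) \<and>
           vnorm (ideal_space (\<AA> (k - l)) E) (poly_insert E k P a l)
             \<le> C k l * vnorm (ideal_space (\<AA> k) E) P * vnorm E a ^ l))"

definition weakly_differentiable ::
  "(nat \<Rightarrow> 'a poly_ideal) \<Rightarrow> 'a cnspace \<Rightarrow> (nat \<Rightarrow> nat \<Rightarrow> real) \<Rightarrow> bool" where
  "weakly_differentiable \<AA> E c \<longleftrightarrow>
     (\<forall>k l. l \<le> k \<longrightarrow> c k l > 0 \<and>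
        (\<forall>P \<in> carr (ideal_space (\<AA> k) E). \<forall>\<phi> \<in> carr (dual_space (ideal_space (\<AA> (k - l)) E)).
           on_carr E (\<lambda>x. \<phi> (poly_insert E k P x l)) \<in> carr (ideal_space (\<AA> l) E) \<and>
           vnorm (ideal_space (\<AA> l) E) (on_carr E (\<lambda>x. \<phi> (poly_insert E k P x l)))
             \<le> c k l * vnorm (dual_space (ideal_space (\<AA> (k - l)) E)) \<phi>
                * vnorm (ideal_space (\<AA> k) E) P))"


section \<open>Entire functions associated with a holomorphy type\<close>

definition power_series_at ::
  "'a cnspace \<Rightarrow> ('a \<Rightarrow> complex) \<Rightarrow> 'a \<Rightarrow> (nat \<Rightarrow> 'a \<Rightarrow> complex) \<Rightarrow> bool" where
  "power_series_at E f a P \<longleftrightarrow>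
     (\<forall>k. P k \<in> hom_polys E k) \<and>
     (\<exists>r>0. uniform_limit {x\<in>carr E. vnorm E (vsub E x a) < r}
        (\<lambda>n x. \<Sum>k<n. P k (vsub E x a)) f sequentially)"

definition entire_funs :: "'a cnspace \<Rightarrow> ('a \<Rightarrow> complex) set" where
  "entire_funs E =
     {f. (\<forall>a\<in>carr E. \<exists>P. power_series_at E f a P) \<and> (\<forall>x. x \<notin> carr E \<longrightarrow> f x = 0)}"

text \<open>The k-th term of the Taylor series at 0, i.e. the k-th differential divided by k!.\<close>

definition taylor_term :: "'a cnspace \<Rightarrow> ('a \<Rightarrow> complex) \<Rightarrow> nat \<Rightarrow> 'a \<Rightarrow> complex" where
  "taylor_term E f = (THE P. power_series_at E f (vzero E) P)"

definition diff_at_zero :: "'a cnspace \<Rightarrow> ('a \<Rightarrow> complex) \<Rightarrow> nat \<Rightarrow> 'a \<Rightarrow> complex" where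
  "diff_at_zero E f k = (\<lambda>x. fact k * taylor_term E f k x)"

definition HbA :: "(nat \<Rightarrow> 'a poly_ideal) \<Rightarrow> 'a cnspace \<Rightarrow> ('a \<Rightarrow> complex) set" where
  "HbA \<AA> E =
     {f \<in> entire_funs E.
        (\<forall>k. diff_at_zero E f k \<in> carr (ideal_space (\<AA> k) E)) \<and>
        (\<lambda>k. root k (vnorm (ideal_space (\<AA> k) E) (taylor_term E f k))) \<longlonglongrightarrow> 0}"

definition HbA_seminorm ::
  "(nat \<Rightarrow> 'a poly_ideal) \<Rightarrow> 'a cnspace \<Rightarrow> real \<Rightarrow> ('a \<Rightarrow> complex) \<Rightarrow> real" where
  "HbA_seminorm \<AA> E s f = (\<Sum>k. s ^ k * vnorm (ideal_space (\<AA> k) E) (taylor_term E f k))"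

definition HbA_topology :: "(nat \<Rightarrow> 'a poly_ideal) \<Rightarrow> 'a cnspace \<Rightarrow> ('a \<Rightarrow> complex) topology" where
  "HbA_topology \<AA> E = topology_generated_by
     {{g \<in> HbA \<AA> E. HbA_seminorm \<AA> E s (\<lambda>x. g x - f x) < e} | f s e. f \<in> HbA \<AA> E \<and> s > 0 \<and> e > 0}"

definition translation :: "'a cnspace \<Rightarrow> 'a \<Rightarrow> ('a \<Rightarrow> complex) \<Rightarrow> 'a \<Rightarrow> complex" where
  "translation E z0 f = on_carr E (\<lambda>z. f (vadd E z z0))"


section \<open>Frequent hypercyclicity\<close>

definition lower_density :: "nat set \<Rightarrow> ereal" where
  "lower_density A = liminf (\<lambda>N. ereal (real (card (A \<inter> {..N})) / real (N + 1)))"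

definition frequently_hypercyclic :: "'b topology \<Rightarrow> ('b \<Rightarrow> 'b) \<Rightarrow> 'b \<Rightarrow> bool" where
  "frequently_hypercyclic X T f \<longleftrightarrow>
     f \<in> topspace X \<and>
     (\<forall>U. openin X U \<and> U \<noteq> {} \<longrightarrow> lower_density {n. (T ^^ n) f \<in> U} > 0)"

end

theory Submission
  imports Defs "HOL-Complex_Analysis.Complex_Analysis"
begin

text \<open>
  (a) Choose a functional $\eta$ with $\eta(z_0) = 1$. The products $\gamma^m \varphi(\eta)$, where
  $\gamma(z_0) = 0$ and $\varphi(w) = w^k (\sin(\delta w)/(\delta w))^{k+4}$, have arbitrarily
  small exponential type, their translates by $n z_0$ decay like $n^{-4}$ in every seminorm as
  $n \to \pm\infty$, and for $\delta \to 0$ they tend to $\gamma^m \eta^k$. As the latter span the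
  finite type polynomials, finite sums of such products are dense, and a countable family $x_l$ of
  them is dense because the dual is separable. The sum of the translates of the $x_l$ by $-n z_0$ over
  the $n$ in pairwise separated sets $A_l$ of positive lower density is frequently hypercyclic; here
  the $A_l$ come from the ruler sequence.

  (b) The orbit of $f$ visits frequently a neighbourhood of $\eta$ whose elements have a zero on
  the line through $z_0$ close to the origin. So $w \mapsto f(w z_0)$ has at least $d r$ zeros in the
  disc of radius $r$, which forces its maximum modulus on circles of radius $r$ to grow
  exponentially in $r$.
\<close>

section \<open>Normed spaces with carrier\<close>

text \<open>Ideal norms are accessible only through composition and the normalisation of the k-th
  power of the coordinate, so all estimates rest on monomials in two functionals: as averages of
  k-th powers over roots of unity they cost a factor 2 per degree. Translation by n
  \<open>z0\<close> fixes a functional vanishing at \<open>z0\<close> and moves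
  \<open>\<eta>\<close> by n, so decay along the orbit is decay of one function on the real axis.
  There k of the sine quotients merely compensate the growth of w^k, and the other four produce the
  rate. Two obstacles shape (a). The function space asks for a power series at every point, so
  estimates are proved for translates by all vectors of a ball. And the approximants come with
  uncontrolled constants, different for each seminorm; they are listed so sparsely that the constant
  at index l is at most l + 1, up to a summand depending on the seminorm only, while a visit of
  index l keeps a distance greater than l + 1 from all others. In (b), distinct visits give distinct
  zeros; dividing them out shrinks the maximum modulus bound geometrically, which a small
  \<epsilon>(r) along a sequence of radii cannot offset.\<close>

context complex_normed
begin

abbreviation vneg :: "'a \<Rightarrow> 'a" where "vneg x \<equiv> vscale E (-1) x"

lemma scale_zero_left: "x \<in> carr E \<Longrightarrow> vscale E 0 x = vzero E"
  using scale_add_left[of x 1 "-1"] by (simp add: scale_one add_neg)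

lemma scale_zero_right: "vscale E a (vzero E) = vzero E"
  using scale_scale[OF zero_closed, of a 0] scale_zero_left[OF zero_closed] by simp

lemma add_zero_right: "x \<in> carr E \<Longrightarrow> vadd E x (vzero E) = x"
  using add_zero add_commute zero_closed by metis

lemma vnorm_zero: "vnorm E (vzero E) = 0"
  using norm_eq_zero zero_closed by simp

lemma vsub_closed: "x \<in> carr E \<Longrightarrow> y \<in> carr E \<Longrightarrow> vsub E x y \<in> carr E"
  by (simp add: vsub_def add_closed scale_closed)

lemma vsub_self: "x \<in> carr E \<Longrightarrow> vsub E x x = vzero E"
  by (simp add: vsub_def add_neg)

lemma vsub_zero: "x \<in> carr E \<Longrightarrow> vsub E x (vzero E) = x"
  by (simp add: vsub_def scale_zero_right add_zero_right)

lemma vsub_scale: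
  assumes "x \<in> carr E"
  shows "vsub E (vscale E a x) (vscale E b x) = vscale E (a - b) x"
  using scale_add_left[OF assms, of a "- b"] by (simp add: vsub_def scale_scale assms)

lemma vsub_add:
  assumes "x \<in> carr E" "y \<in> carr E"
  shows "vadd E (vsub E x y) y = x"
proof -
  have "vadd E (vneg y) y = vzero E"
    using assms add_neg[of y] add_commute[of y "vneg y"] by (simp add: scale_closed)
  then show ?thesis
    using assms by (simp add: vsub_def add_assoc scale_closed add_zero_right)
qed

lemma vsub_commute:
  assumes "x \<in> carr E" "y \<in> carr E"
  shows "vsub E y x = vneg (vsub E x y)"
proof -
  have "vneg (vsub E x y) = vadd E (vneg x) y"
    using assms by (simp add: vsub_def scale_add_right scale_closed scale_scale scale_one)
  then show ?thesis using assms by (simp add: vsub_def add_commute scale_closed)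
qed

lemma vsub_trans:
  assumes "x \<in> carr E" "y \<in> carr E" "z \<in> carr E"
  shows "vadd E (vsub E x y) (vsub E y z) = vsub E x z"
proof -
  have "vadd E (vsub E x y) (vsub E y z) = vadd E (vadd E (vsub E x y) y) (vneg z)"
    using assms by (simp add: vsub_def[of E y z] add_assoc vsub_closed scale_closed)
  then show ?thesis using assms by (simp add: vsub_add vsub_def[of E x z])
qed

lemma vnorm_nonneg:
  assumes "x \<in> carr E"
  shows "0 \<le> vnorm E x"
  using norm_triangle[OF assms scale_closed[OF assms, of "-1"]] norm_scale[OF assms, of "-1"]
  by (simp add: add_neg assms vnorm_zero)

lemma vnorm_vsub_commute:
  assumes "x \<in> carr E" "y \<in> carr E"
  shows "vnorm E (vsub E x y) = vnorm E (vsub E y x)"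
  using assms by (simp add: vsub_commute[of x y] norm_scale vsub_closed)

lemma metric_space_vdist: "Metric_space (carr E) (vdist E)"
proof
  show "0 \<le> vdist E x y" for x y
    by (simp add: vdist_def vnorm_nonneg vsub_closed)
  show "vdist E x y = vdist E y x" for x y
    by (simp add: vdist_def vnorm_vsub_commute)
  show "vdist E x y = 0 \<longleftrightarrow> x = y" if "x \<in> carr E" "y \<in> carr E" for x y
  proof -
    have "vsub E x y = vzero E \<longleftrightarrow> x = y"
      using vsub_add[OF that] vsub_self[of x] that add_zero by metis
    then show ?thesis using that by (simp add: vdist_def norm_eq_zero vsub_closed)
  qed
  show "vdist E x z \<le> vdist E x y + vdist E y z"
    if "x \<in> carr E" "y \<in> carr E" "z \<in> carr E" for x y z
    using norm_triangle[OF vsub_closed vsub_closed, of x y y z] that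
    by (simp add: vdist_def vsub_trans)
qed

lemma in_vclosureD:
  assumes "x \<in> vtopology E closure_of S" "0 < e"
  obtains y where "y \<in> S" "y \<in> carr E" "vnorm E (vsub E x y) < e"
proof -
  interpret Metric_space "carr E" "vdist E" by (rule metric_space_vdist)
  show ?thesis
    using assms that unfolding vtopology_def metric_closure_of
    by (force simp: vdist_def)
qed

end

text \<open>Differences of the \<open>\<sigma> n\<close> are dominated by blocks of a convergent
  series, so they form a Cauchy sequence. The explicit tail in the conclusion is what later controls
  the remainders of infinite sums.\<close>

lemma (in complex_banach) abs_summable_limit:
  assumes cl: "\<And>n. \<sigma> n \<in> carr E"
    and le: "\<And>m n. m \<le> n \<Longrightarrow> vnorm E (vsub E (\<sigma> n) (\<sigma> m)) \<le> (\<Sum>j=m..<n. b j)"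
    and b: "summable b" "\<And>j. 0 \<le> (b j :: real)"
  obtains T where "T \<in> carr E" "\<And>m. vnorm E (vsub E T (\<sigma> m)) \<le> (\<Sum>j. b (j + m))"
proof -
  interpret Metric_space "carr E" "vdist E" by (rule metric_space_vdist)
  have tail: "vdist E (\<sigma> n) (\<sigma> m) \<le> (\<Sum>j. b (j + m))" if "m \<le> n" for m n
  proof -
    have "vdist E (\<sigma> n) (\<sigma> m) \<le> (\<Sum>j=m..<n. b j)"
      using le[OF that] cl by (simp add: vdist_def)
    also have "\<dots> = (\<Sum>j<n-m. b (j + m))"
      using that sum.shift_bounds_nat_ivl[of b 0 m "n - m"] by (simp add: atLeast0LessThan)
    also have "\<dots> \<le> (\<Sum>j. b (j + m))"
      using b by (intro sum_le_suminf) (auto simp: summable_iff_shift)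
    finally show ?thesis .
  qed
  have lim0: "(\<lambda>m. \<Sum>j. b (j + m)) \<longlonglongrightarrow> 0"
    using suminf_exist_split2[OF b(1)] .
  have "MCauchy \<sigma>"
    unfolding MCauchy_def
  proof (intro conjI allI impI)
    show "range \<sigma> \<subseteq> carr E" using cl by auto
    fix e :: real assume "0 < e"
    then obtain N where N: "\<And>m. m \<ge> N \<Longrightarrow> (\<Sum>j. b (j + m)) < e"
      using order_tendstoD(2)[OF lim0] by (auto simp: eventually_sequentially)
    have "vdist E (\<sigma> n) (\<sigma> m) < e" if "N \<le> n" "N \<le> m" for m n
    proof (cases "m \<le> n")
      case True
      then show ?thesis using tail[OF True] N[OF that(2)] by linarith
    next
      case False
      then show ?thesis using tail[of n m] N[OF that(1)] commute[of "\<sigma> n"] by simp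
    qed
    then show "\<exists>N. \<forall>n n'. N \<le> n \<longrightarrow> N \<le> n' \<longrightarrow> vdist E (\<sigma> n) (\<sigma> n') < e"
      by blast
  qed
  then obtain T where "limitin mtopology \<sigma> T sequentially"
    using complete unfolding mcomplete_def by blast
  then have T: "T \<in> carr E" and conv: "\<And>e. 0 < e \<Longrightarrow> \<exists>N. \<forall>n\<ge>N. vdist E (\<sigma> n) T < e"
    unfolding limit_metric_sequentially by blast+
  show ?thesis
  proof
    fix m
    show "vnorm E (vsub E T (\<sigma> m)) \<le> (\<Sum>j. b (j + m))"
    proof (rule field_le_epsilon)
      fix e :: real assume "0 < e"
      then obtain N where "\<forall>n\<ge>N. vdist E (\<sigma> n) T < e" using conv by blast
      \<comment> \<open>The index \<open>max N m\<close> is late enough for the limit and still at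
        least m, so that \<open>tail\<close> applies.\<close>
      then have "vdist E (\<sigma> (max N m)) T < e" by simp
      moreover have "vdist E T (\<sigma> m) \<le> vdist E T (\<sigma> (max N m)) + vdist E (\<sigma> (max N m)) (\<sigma> m)"
        using T cl by (intro triangle) auto
      ultimately show "vnorm E (vsub E T (\<sigma> m)) \<le> (\<Sum>j. b (j + m)) + e"
        using tail[of m "max N m"] T cl commute[of T "\<sigma> (max N m)"] by (simp add: vdist_def)
    qed
  qed (rule T)
qed

section \<open>Spaces of scalar functions with pointwise operations\<close>

locale fun_normed = complex_normed "fun_space S N" for S :: "('a \<Rightarrow> complex) set" and N
begin

lemma mem_zero: "(\<lambda>x. 0) \<in> S"
  using zero_closed by (simp add: fun_space_def)

lemma mem_add: "f \<in> S \<Longrightarrow> g \<in> S \<Longrightarrow> (\<lambda>x. f x + g x) \<in> S"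
  using add_closed[of f g] by (simp add: fun_space_def)

lemma mem_cmult: "f \<in> S \<Longrightarrow> (\<lambda>x. a * f x) \<in> S"
  using scale_closed[of f a] by (simp add: fun_space_def)

lemma mem_diff: "f \<in> S \<Longrightarrow> g \<in> S \<Longrightarrow> (\<lambda>x. f x - g x) \<in> S"
  using mem_add[OF _ mem_cmult[of g "-1"], of f] by simp

lemma mem_sum: "(\<And>i. i \<in> I \<Longrightarrow> f i \<in> S) \<Longrightarrow> (\<lambda>x. \<Sum>i\<in>I. f i x) \<in> S"
  by (induction I rule: infinite_finite_induct) (auto simp: mem_zero mem_add)

lemma N_zero: "N (\<lambda>x. 0) = 0"
  using vnorm_zero by (simp add: fun_space_def)

lemma N_nonneg: "f \<in> S \<Longrightarrow> 0 \<le> N f"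
  using vnorm_nonneg[of f] by (simp add: fun_space_def)

lemma N_add: "f \<in> S \<Longrightarrow> g \<in> S \<Longrightarrow> N (\<lambda>x. f x + g x) \<le> N f + N g"
  using norm_triangle[of f g] by (simp add: fun_space_def)

lemma N_cmult: "f \<in> S \<Longrightarrow> N (\<lambda>x. a * f x) = cmod a * N f"
  using norm_scale[of f a] by (simp add: fun_space_def)

lemma N_sum: "(\<And>i. i \<in> I \<Longrightarrow> f i \<in> S) \<Longrightarrow> N (\<lambda>x. \<Sum>i\<in>I. f i x) \<le> (\<Sum>i\<in>I. N (f i))"
proof (induction I rule: infinite_finite_induct)
  case (insert i I)
  then show ?case
    using N_add[of "f i" "\<lambda>x. \<Sum>i\<in>I. f i x"] mem_sum[of I f] by force
qed (auto simp: N_zero)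

lemma fun_vsub: "vsub (fun_space S N) f g = (\<lambda>x. f x - g x)"
  by (simp add: vsub_def fun_space_def)

lemma N_closure:
  assumes "f \<in> vtopology (fun_space S N) closure_of D" "0 < e"
  obtains g where "g \<in> D" "g \<in> S" "N (\<lambda>x. f x - g x) < e"
proof -
  obtain g where "g \<in> D" "g \<in> carr (fun_space S N)"
      "vnorm (fun_space S N) (vsub (fun_space S N) f g) < e"
    using assms by (rule in_vclosureD)
  then show ?thesis by (intro that) (simp_all only: fun_vsub, simp_all add: fun_space_def)
qed

end

locale fun_banach = complex_banach "fun_space S N" for S :: "('a \<Rightarrow> complex) set" and N

sublocale fun_banach \<subseteq> fun_normed ..

lemma (in fun_banach) abs_summable_series:
  assumes R: "\<And>j. R j \<in> S" and sm: "summable (\<lambda>j. N (R j))"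
  obtains T where "T \<in> S"
    "\<And>m. N (\<lambda>x. T x - (\<Sum>j<m. R j x)) \<le> (\<Sum>j. N (R (j + m)))"
proof -
  let ?F = "fun_space S N"
  define \<sigma> where "\<sigma> n = (\<lambda>x. \<Sum>j<n. R j x)" for n
  have cl: "\<sigma> n \<in> carr ?F" for n
    using mem_sum[of "{..<n}" R] R by (simp add: \<sigma>_def fun_space_def)
  have "vnorm ?F (vsub ?F (\<sigma> n) (\<sigma> m)) \<le> (\<Sum>j=m..<n. N (R j))"
    if "m \<le> n" for m n
  proof -
    have "vsub ?F (\<sigma> n) (\<sigma> m) = (\<lambda>x. \<Sum>j=m..<n. R j x)"
      using that unfolding fun_vsub \<sigma>_def
      by (simp add: sum_diff_nat_ivl lessThan_atLeast0)
    then show ?thesis using N_sum[of "{m..<n}" R] R by (simp add: fun_space_def)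
  qed
  then obtain T where "T \<in> carr ?F"
    "\<And>m. vnorm ?F (vsub ?F T (\<sigma> m)) \<le> (\<Sum>j. N (R (j + m)))"
    using abs_summable_limit[where \<sigma>=\<sigma> and b="\<lambda>j. N (R j)", OF cl _ sm]
      N_nonneg[OF R] by blast
  then show ?thesis
    by (intro that) (simp_all only: fun_vsub, simp_all add: fun_space_def \<sigma>_def)
qed

section \<open>Bounded linear functionals and lines\<close>

context complex_normed
begin

text \<open>The bound is a parameter and may be any upper bound, so that sums and rescalings need no
  computation of operator norms; existence of some bound is membership in the dual
  (\<open>carr_dual\<close>).\<close>

definition functional :: "('a \<Rightarrow> complex) \<Rightarrow> real \<Rightarrow> bool" where
  "functional \<gamma> G \<longleftrightarrow>
     (\<forall>x\<in>carr E. \<forall>y\<in>carr E. \<gamma> (vadd E x y) = \<gamma> x + \<gamma> y) \<and>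
     (\<forall>x\<in>carr E. \<forall>a. \<gamma> (vscale E a x) = a * \<gamma> x) \<and>
     (\<forall>x\<in>carr E. cmod (\<gamma> x) \<le> G * vnorm E x) \<and>
     (\<forall>x. x \<notin> carr E \<longrightarrow> \<gamma> x = 0)"

lemma
  assumes "functional \<gamma> G"
  shows functional_add: "x \<in> carr E \<Longrightarrow> y \<in> carr E \<Longrightarrow> \<gamma> (vadd E x y) = \<gamma> x + \<gamma> y"
    and functional_scale: "x \<in> carr E \<Longrightarrow> \<gamma> (vscale E a x) = a * \<gamma> x"
    and functional_le: "x \<in> carr E \<Longrightarrow> cmod (\<gamma> x) \<le> G * vnorm E x"
    and functional_off: "x \<notin> carr E \<Longrightarrow> \<gamma> x = 0"
  using assms by (simp_all add: functional_def)

lemma functional_mono: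
  assumes "functional \<gamma> G" "G \<le> H"
  shows "functional \<gamma> H"
  using assms unfolding functional_def
  by (meson mult_right_mono order_trans vnorm_nonneg)

lemma functional_lincomb:
  assumes "functional \<gamma> G" "functional \<eta> H"
  shows "functional (\<lambda>x. \<gamma> x + a * \<eta> x) (G + cmod a * H)"
  unfolding functional_def
proof (intro conjI ballI allI impI)
  fix x assume x: "x \<in> carr E"
  have "cmod (\<gamma> x + a * \<eta> x) \<le> cmod (\<gamma> x) + cmod a * cmod (\<eta> x)"
    by (metis norm_mult norm_triangle_ineq)
  also have "\<dots> \<le> G * vnorm E x + cmod a * (H * vnorm E x)"
    using assms x by (intro add_mono mult_left_mono) (auto simp: functional_le)
  finally show "cmod (\<gamma> x + a * \<eta> x) \<le> (G + cmod a * H) * vnorm E x"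
    by (simp add: algebra_simps)
qed (use assms in \<open>auto simp: functional_add functional_scale functional_off algebra_simps\<close>)

lemma functional_zero: "functional (\<lambda>x. 0) 0"
  by (simp add: functional_def)

lemma functional_cmult: "functional \<eta> H \<Longrightarrow> functional (\<lambda>x. a * \<eta> x) (cmod a * H)"
  using functional_lincomb[OF functional_zero] by simp

section \<open>The dual space and operator norms\<close>

lemma carr_dual: "carr (dual_space E) = {\<gamma>. \<exists>G. functional \<gamma> G}"
  by (auto simp: dual_space_def fun_space_def bounded_lin_def functional_def complex_space_def)

lemma opnorm_bound:
  assumes R: "\<And>x. x \<in> carr E \<Longrightarrow> vnorm F (R x) \<le> K * vnorm E x" and K: "0 \<le> K"
    and nn: "vnorm F (R (vzero E)) = 0"
  shows "0 \<le> opnorm E F R" "opnorm E F R \<le> K"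
proof -
  have le: "vnorm F (R x) \<le> K" if "x \<in> carr E" "vnorm E x \<le> 1" for x
    using R[OF that(1)] mult_left_le[OF that(2) K] by linarith
  then show "opnorm E F R \<le> K"
    unfolding opnorm_def using zero_closed vnorm_zero by (intro cSUP_least) auto
  show "0 \<le> opnorm E F R"
    unfolding opnorm_def using zero_closed vnorm_zero le nn
    by (intro cSUP_upper2[where x = "vzero E"]) (auto simp: bdd_above_def)
qed

abbreviation dnorm :: "('a \<Rightarrow> complex) \<Rightarrow> real" where "dnorm \<equiv> opnorm E complex_space"

lemma functional_opnorm:
  assumes "functional \<gamma> G"
  shows "functional \<gamma> (dnorm \<gamma>)"
proof -
  have 1: "cmod (\<gamma> x) \<le> dnorm \<gamma>" if "x \<in> carr E" "vnorm E x \<le> 1" for x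
  proof -
    \<comment> \<open>A negative G is possible when the carrier is trivial, hence the
      maximum.\<close>
    have "cmod (\<gamma> y) \<le> max G 0" if "y \<in> carr E" "vnorm E y \<le> 1" for y
      using functional_le[OF functional_mono[OF assms max.cobounded1[of G 0]] that(1)]
        mult_left_le[OF that(2), of "max G 0"] by linarith
    then show ?thesis
      unfolding opnorm_def using that
      by (intro cSUP_upper2[where x = x]) (auto simp: bdd_above_def complex_space_def)
  qed
  have "cmod (\<gamma> x) \<le> dnorm \<gamma> * vnorm E x" if x: "x \<in> carr E" for x
  proof (cases "vnorm E x = 0")
    case True
    then show ?thesis using functional_le[OF assms x] by simp
  next
    case False
    then have pos: "0 < vnorm E x" using vnorm_nonneg[OF x] by simp
    define y where "y = vscale E (of_real (1 / vnorm E x)) x"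
    have "y \<in> carr E" "vnorm E y \<le> 1"
      using pos x by (auto simp: y_def scale_closed norm_scale norm_divide)
    then have "cmod (\<gamma> y) \<le> dnorm \<gamma>" by (rule 1)
    then show ?thesis
      using pos x by (simp add: y_def functional_scale[OF assms] norm_mult norm_divide field_simps)
  qed
  then show ?thesis using assms by (simp add: functional_def)
qed

lemma opnorm_functional_le:
  assumes "functional \<gamma> G" "0 \<le> G"
  shows "0 \<le> dnorm \<gamma>" "dnorm \<gamma> \<le> G"
proof -
  have "\<gamma> (vzero E) = 0"
    using functional_le[OF assms(1) zero_closed] by (simp add: vnorm_zero)
  then show "0 \<le> dnorm \<gamma>" "dnorm \<gamma> \<le> G"
    using assms opnorm_bound[of complex_space \<gamma> G]
    by (simp_all add: complex_space_def functional_le)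
qed

lemma opnorm_functional_nonneg: "functional \<gamma> G \<Longrightarrow> 0 \<le> dnorm \<gamma>"
  using opnorm_functional_le(1)[OF functional_mono[OF _ max.cobounded1[of G 0]]] by simp

text \<open>The norm axioms let \<open>N_closure\<close> turn topological density in the dual into
  approximation in norm.\<close>

lemma dual_normed: "fun_normed (carr (dual_space E)) dnorm"
proof -
  let ?D = "fun_space (carr (dual_space E)) dnorm"
  note on = functional_opnorm opnorm_functional_nonneg
  have "complex_normed ?D"
  proof
    show "vzero ?D \<in> carr ?D"
      using functional_zero by (auto simp: fun_space_def carr_dual)
    show "vadd ?D f g \<in> carr ?D" if "f \<in> carr ?D" "g \<in> carr ?D" for f g
      using that functional_lincomb[of f _ g _ 1] by (auto simp: fun_space_def carr_dual)
    show "vscale ?D a f \<in> carr ?D" if "f \<in> carr ?D" for a f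
      using that functional_cmult[of f _ a] by (auto simp: fun_space_def carr_dual)
    show "vnorm ?D f = 0 \<longleftrightarrow> f = vzero ?D" if m: "f \<in> carr ?D" for f
    proof
      obtain G where f: "functional f G" using m by (auto simp: fun_space_def carr_dual)
      assume "vnorm ?D f = 0"
      then have "f x = 0" for x
        using functional_le[OF functional_opnorm[OF f], of x] functional_off[OF f, of x]
        by (cases "x \<in> carr E") (simp_all add: fun_space_def)
      then show "f = vzero ?D" by (auto simp: fun_space_def)
    next
      assume "f = vzero ?D"
      then show "vnorm ?D f = 0"
        using opnorm_functional_le[OF functional_zero] by (simp add: fun_space_def)
    qed
    show "vnorm ?D (vadd ?D f g) \<le> vnorm ?D f + vnorm ?D g" if m: "f \<in> carr ?D" "g \<in> carr ?D" for f g
    proof -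
      obtain G H where "functional f G" "functional g H"
        using m by (auto simp: fun_space_def carr_dual)
      then show ?thesis
        using opnorm_functional_le(2)[OF functional_lincomb[of f "dnorm f" g
          "dnorm g" 1]] on by (simp add: fun_space_def)
    qed
    show "vnorm ?D (vscale ?D a f) = cmod a * vnorm ?D f" if m: "f \<in> carr ?D" for a f
    proof -
      have le: "dnorm (\<lambda>x. a * f x) \<le> cmod a * dnorm f"
        if "functional f G" for a f G
        using opnorm_functional_le(2)[OF functional_cmult[OF functional_opnorm[OF that], of a]]
          on(2)[OF that] by simp
      obtain G where f: "functional f G" using m by (auto simp: fun_space_def carr_dual)
      \<comment> \<open>The reverse inequality is \<open>le\<close> again, for a f multiplied by the
        inverse of a.\<close>
      have "cmod a * dnorm f \<le> dnorm (\<lambda>x. a * f x)"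
      proof (cases "a = 0")
        case False
        then show ?thesis
          using le[OF functional_cmult[OF f, of a], of "inverse a"]
          by (simp add: norm_divide field_simps)
      qed (use on(2)[OF functional_zero] in simp)
      then show ?thesis using le[OF f, of a] by (simp add: fun_space_def)
    qed
  qed (auto simp: fun_space_def algebra_simps)
  then show ?thesis by unfold_locales (auto simp: complex_normed_def)
qed

text \<open>Separability in the form in which it is used: the error is itself a functional with a
  small bound, so that monomials containing it have small ideal norm.\<close>

lemma separable_dualE:
  assumes "separable_space (vtopology (dual_space E))"
  obtains D where "countable D" "\<And>\<gamma>. \<gamma> \<in> D \<Longrightarrow> \<exists>G. functional \<gamma> G"
    "\<And>\<gamma> G e. functional \<gamma> G \<Longrightarrow> 0 < e \<Longrightarrow> \<exists>\<delta>\<in>D. functional (\<lambda>x. \<gamma> x - \<delta> x) e"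
proof -
  have ds: "dual_space E = fun_space (carr (dual_space E)) dnorm"
    by (simp add: dual_space_def fun_space_def)
  interpret D: fun_normed "carr (dual_space E)" "dnorm" by (rule dual_normed)
  have top: "topspace (vtopology (dual_space E)) = carr (dual_space E)"
    using Metric_space.topspace_mtopology[OF D.metric_space_vdist] ds
    by (simp add: vtopology_def)
  obtain D where D: "countable D" "D \<subseteq> carr (dual_space E)"
      "vtopology (dual_space E) closure_of D = carr (dual_space E)"
    using assms unfolding separable_space_def top by blast
  show ?thesis
  proof
    show "countable D" by fact
    show "\<exists>G. functional \<gamma> G" if "\<gamma> \<in> D" for \<gamma> using D that by (auto simp: carr_dual)
    fix \<gamma> G and e :: real assume "functional \<gamma> G" "0 < e"
    then have "\<gamma> \<in> vtopology (fun_space (carr (dual_space E)) dnorm) closure_of D"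
      using D(3) by (subst ds[symmetric]) (auto simp: carr_dual)
    then obtain \<delta> where "\<delta> \<in> D" "dnorm (\<lambda>x. \<gamma> x - \<delta> x) < e"
      using \<open>0 < e\<close> by (rule D.N_closure)
    moreover obtain G' where "functional \<delta> G'" using \<open>\<delta> \<in> D\<close> D(2) by (auto simp: carr_dual)
    then have "functional (\<lambda>x. \<gamma> x - \<delta> x) (dnorm (\<lambda>x. \<gamma> x - \<delta> x))"
      using functional_opnorm[OF functional_lincomb[OF \<open>functional \<gamma> G\<close>, of \<delta> G' "-1"]] by simp
    ultimately show "\<exists>\<delta>\<in>D. functional (\<lambda>x. \<gamma> x - \<delta> x) e"
      using functional_mono less_imp_le by blast
  qed
qed

end

text \<open>The complex plane transported along an injection into the universe, so that the
  normalisation axiom of the ideals can be applied.\<close>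

definition line_space :: "(complex \<Rightarrow> 'a) \<Rightarrow> 'a cnspace" where
  "line_space \<iota> = \<lparr>carr = range \<iota>, vadd = (\<lambda>x y. \<iota> (inv \<iota> x + inv \<iota> y)), vzero = \<iota> 0,
     vscale = (\<lambda>a x. \<iota> (a * inv \<iota> x)), vnorm = (\<lambda>x. cmod (inv \<iota> x))\<rparr>"

lemma complex_banach_line:
  assumes "inj \<iota>"
  shows "complex_banach (line_space \<iota>)"
proof -
  let ?L = "line_space \<iota>"
  note s = line_space_def inv_f_f[OF assms]
  interpret L: complex_normed "line_space \<iota>"
  proof
    show "vnorm ?L x = 0 \<longleftrightarrow> x = vzero ?L" if "x \<in> carr ?L" for x
      using that assms by (auto simp: s inj_eq)
  qed (auto simp: s algebra_simps norm_mult norm_triangle_ineq)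
  interpret M: Metric_space "carr ?L" "vdist ?L"
    by (rule L.metric_space_vdist)
  have d: "vdist ?L x y = dist (inv \<iota> x) (inv \<iota> y)" if "x \<in> range \<iota>" "y \<in> range \<iota>" for x y
    using that by (auto simp: vdist_def vsub_def s dist_norm)
  show ?thesis
  proof
    show "M.mcomplete"
      unfolding M.mcomplete_def
    proof (intro allI impI)
      fix \<sigma> assume C: "M.MCauchy \<sigma>"
      then have r: "\<sigma> n \<in> range \<iota>" for n
        unfolding M.MCauchy_def by (auto simp: line_space_def)
      have "Cauchy (\<lambda>n. inv \<iota> (\<sigma> n))"
        using C unfolding M.MCauchy_def Cauchy_def by (simp add: d[OF r r] Ball_def)
      then obtain t where t: "(\<lambda>n. inv \<iota> (\<sigma> n)) \<longlonglongrightarrow> t"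
        by (auto simp: Cauchy_convergent_iff convergent_def)
      have "limitin M.mtopology \<sigma> (\<iota> t) sequentially"
        unfolding M.limit_metric_sequentially
      proof (intro conjI allI impI)
        show "\<iota> t \<in> carr ?L" by (simp add: s)
        fix e :: real assume "0 < e"
        then obtain N where "\<forall>n\<ge>N. dist (inv \<iota> (\<sigma> n)) t < e"
          using t by (auto simp: lim_sequentially)
        then show "\<exists>N. \<forall>n\<ge>N. \<sigma> n \<in> carr ?L \<and> vdist ?L (\<sigma> n) (\<iota> t) < e"
          using r d[OF r, of "\<iota> t"] by (auto simp: s)
      qed
      then show "\<exists>x. limitin M.mtopology \<sigma> x sequentially" by blast
    qed
  qed
qed

lemma isometric_iso_line:
  assumes "inj \<iota>"
  shows "isometric_iso (line_space \<iota>) complex_space (inv \<iota>)"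
proof -
  note s = line_space_def inv_f_f[OF assms]
  have "inv \<iota> ` range \<iota> = UNIV" by (auto simp: s image_image)
  then show ?thesis
    unfolding isometric_iso_def bounded_lin_def
    by (auto simp: s complex_space_def intro!: exI[of _ 1])
qed

lemma multilinear_form_homogeneous:
  assumes M: "multilinear_form E k M" and x: "x \<in> carr E" and ax: "vscale E a x \<in> carr E"
  shows "M (replicate k (vscale E a x)) = a ^ k * M (replicate k x)"
proof -
  let ?L = "\<lambda>i. replicate i (vscale E a x) @ replicate (k - i) x"
  have "i \<le> k \<Longrightarrow> M (?L i) = a ^ i * M (replicate k x)" for i
  proof (induction i)
    case (Suc i)
    have e: "replicate (k - i) x = x # replicate (k - Suc i) x"
      using Suc.prems by (metis Suc_diff_Suc Suc_le_lessD replicate_Suc)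
    have in_v: "?L i \<in> vlists E k"
      using Suc.prems x ax by (auto simp: vlists_def)
    have "(?L i)[i := x] = ?L i" "(?L i)[i := vscale E a x] = ?L (Suc i)"
      by (simp_all add: e list_update_append flip: replicate_app_Cons_same)
    moreover have "M ((?L i)[i := vscale E a x]) = a * M ((?L i)[i := x])"
      using M in_v x Suc.prems unfolding multilinear_form_def by (meson Suc_le_lessD)
    ultimately show ?case using Suc by simp
  qed simp
  from this[of k] show ?thesis by simp
qed

section \<open>Polynomials in the ideals\<close>

text \<open>The non-zero vector is part of the locale because its span provides the copy of the
  complex plane inside the universe \<open>'a\<close> to which the normalisation axiom
  refers.\<close>

locale poly_ideals = complex_banach E for E :: "'a cnspace" +
  fixes \<AA> :: "nat \<Rightarrow> 'a poly_ideal" and z0 :: 'a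
  assumes ideals: "\<And>k. banach_ideal k (\<AA> k)"
    and z0: "z0 \<in> carr E" "z0 \<noteq> vzero E"
begin

abbreviation A :: "nat \<Rightarrow> ('a \<Rightarrow> complex) set" where "A k \<equiv> fst (\<AA> k) E"
abbreviation nA :: "nat \<Rightarrow> ('a \<Rightarrow> complex) \<Rightarrow> real" where "nA k \<equiv> snd (\<AA> k) E"

lemma banach_ideal_space: "complex_banach F \<Longrightarrow> complex_banach (ideal_space (\<AA> k) F)"
  using ideals[of k] unfolding banach_ideal_def by blast

end

sublocale poly_ideals \<subseteq> A: fun_banach "A k" "nA k" for k
  using banach_ideal_space[OF complex_banach_axioms, of k]
  by (simp add: fun_banach_def ideal_space_def)

context poly_ideals
begin

lemma A_hom_polys: "P \<in> A k \<Longrightarrow> P \<in> hom_polys E k"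
  using ideals[of k] complex_banach_axioms
  by (auto simp: banach_ideal_def ideal_space_def fun_space_def)

lemma A_off: "P \<in> A k \<Longrightarrow> x \<notin> carr E \<Longrightarrow> P x = 0"
  using A_hom_polys by (auto simp: hom_polys_def)

lemma hom_polys_scale:
  assumes "P \<in> hom_polys E k" "x \<in> carr E"
  shows "P (vscale E a x) = a ^ k * P x"
  using assms multilinear_form_homogeneous[OF _ assms(2) scale_closed[OF assms(2)]]
  by (force simp: hom_polys_def scale_closed)

lemma ideal_comp:
  assumes "complex_banach F" "complex_banach F1" "bounded_lin F1 F R" "P \<in> fst (\<AA> k) F"
  shows "on_carr F1 (P \<circ> R) \<in> fst (\<AA> k) F1"
    "snd (\<AA> k) F1 (on_carr F1 (P \<circ> R)) \<le> snd (\<AA> k) F P * opnorm F1 F R ^ k"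
  using ideals[of k] assms unfolding banach_ideal_def
  by (force simp: ideal_space_def fun_space_def)+

lemma ideal_line:
  fixes \<iota> :: "complex \<Rightarrow> 'a"
  assumes "inj \<iota>"
  shows "on_carr (line_space \<iota>) (\<lambda>z. inv \<iota> z ^ k) \<in> fst (\<AA> k) (line_space \<iota>)"
    "snd (\<AA> k) (line_space \<iota>) (on_carr (line_space \<iota>) (\<lambda>z. inv \<iota> z ^ k)) = 1"
  using ideals[of k] complex_banach_line[OF assms] isometric_iso_line[OF assms]
  unfolding banach_ideal_def by (force simp: ideal_space_def fun_space_def)+

abbreviation pw :: "('a \<Rightarrow> complex) \<Rightarrow> nat \<Rightarrow> 'a \<Rightarrow> complex" where
  "pw \<gamma> k \<equiv> on_carr E (\<lambda>x. \<gamma> x ^ k)"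

abbreviation pw2 :: "('a \<Rightarrow> complex) \<Rightarrow> nat \<Rightarrow> ('a \<Rightarrow> complex) \<Rightarrow> nat \<Rightarrow> 'a \<Rightarrow> complex" where
  "pw2 \<gamma> i \<eta> j \<equiv> on_carr E (\<lambda>x. \<gamma> x ^ i * \<eta> x ^ j)"

lemma z0_pos: "0 < vnorm E z0"
  using z0 norm_eq_zero vnorm_nonneg by force

definition \<iota> :: "complex \<Rightarrow> 'a" where "\<iota> t = vscale E t z0"

lemma inj_\<iota>: "inj \<iota>"
proof (rule injI)
  fix s t assume "\<iota> s = \<iota> t"
  then have "vscale E (s - t) z0 = vzero E"
    using vsub_scale[OF z0(1)] vsub_self[OF scale_closed[OF z0(1)]] by (metis \<iota>_def)
  then have "cmod (s - t) * vnorm E z0 = 0"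
    using norm_scale[OF z0(1)] vnorm_zero by metis
  then show "s = t" using z0_pos by simp
qed

text \<open>The polynomial is the k-th power of the coordinate on the line, which has norm 1 there,
  composed with the bounded map sending x to \<open>\<gamma> x\<close> times
  \<open>z0\<close>.\<close>

lemma power_in_A:
  assumes \<gamma>: "functional \<gamma> G" and G: "0 \<le> G"
  shows "pw \<gamma> k \<in> A k" "nA k (pw \<gamma> k) \<le> G ^ k"
proof -
  let ?L = "line_space \<iota>"
  let ?R = "\<lambda>x. \<iota> (\<gamma> x)"
  note s = line_space_def inv_f_f[OF inj_\<iota>]
  have R: "bounded_lin E ?L ?R"
    unfolding bounded_lin_def using \<gamma>
    by (auto simp: s functional_add functional_scale intro: functional_le)
  have "\<gamma> (vzero E) = 0"
    using functional_le[OF \<gamma> zero_closed] by (simp add: vnorm_zero)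
  then have op: "0 \<le> opnorm E ?L ?R" "opnorm E ?L ?R \<le> G"
    using opnorm_bound[of ?L ?R G] functional_le[OF \<gamma>] G by (auto simp: s)
  have e: "on_carr E (on_carr ?L (\<lambda>z. inv \<iota> z ^ k) \<circ> ?R) = pw \<gamma> k"
    by (auto simp: on_carr_def s)
  note c = ideal_comp[OF complex_banach_line[OF inj_\<iota>] complex_banach_axioms R
      ideal_line(1)[OF inj_\<iota>, of k], unfolded e ideal_line(2)[OF inj_\<iota>]]
  show "pw \<gamma> k \<in> A k" by (rule c(1))
  show "nA k (pw \<gamma> k) \<le> G ^ k"
    using c(2) power_mono[OF op(2,1), of k] by simp
qed

text \<open>Restrict P to the line through x, where the normalisation axiom computes the ideal norm.\<close>

lemma A_eval:
  assumes P: "P \<in> A k" and x: "x \<in> carr E"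
  shows "cmod (P x) \<le> nA k P * vnorm E x ^ k"
proof -
  let ?L = "line_space \<iota>"
  let ?R = "\<lambda>y. vscale E (inv \<iota> y) x"
  let ?Q = "on_carr ?L (\<lambda>z. inv \<iota> z ^ k)"
  note s = line_space_def inv_f_f[OF inj_\<iota>]
  interpret L: fun_banach "fst (\<AA> k) ?L" "snd (\<AA> k) ?L"
    using banach_ideal_space[OF complex_banach_line[OF inj_\<iota>], of k]
    by (simp add: fun_banach_def ideal_space_def)
  interpret Lc: complex_banach ?L by (rule complex_banach_line[OF inj_\<iota>])
  have R: "bounded_lin ?L E ?R"
    unfolding bounded_lin_def using x
    by (auto simp: s scale_closed scale_add_left scale_scale norm_scale intro!: exI[of _ "vnorm E x"])
  have op: "0 \<le> opnorm ?L E ?R" "opnorm ?L E ?R \<le> vnorm E x"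
    using Lc.opnorm_bound[of E ?R "vnorm E x"] x
    by (auto simp: s norm_scale vnorm_nonneg scale_zero_left vnorm_zero)
  have e: "on_carr ?L (P \<circ> ?R) = (\<lambda>y. P x * ?Q y)"
    using hom_polys_scale[OF A_hom_polys[OF P] x] by (auto simp: on_carr_def)
  have "cmod (P x) = snd (\<AA> k) ?L (on_carr ?L (P \<circ> ?R))"
    unfolding e using L.N_cmult ideal_line[OF inj_\<iota>] by simp
  also have "\<dots> \<le> nA k P * opnorm ?L E ?R ^ k"
    by (rule ideal_comp(2)[OF complex_banach_axioms complex_banach_line[OF inj_\<iota>] R P])
  also have "\<dots> \<le> nA k P * vnorm E x ^ k"
    using op A.N_nonneg[OF P] by (intro mult_left_mono power_mono)
  finally show ?thesis .
qed

end

text \<open>Roots of unity extract the term of index j from the binomial expansion.\<close>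

lemma binomial_coefficient_average:
  fixes a b :: complex
  assumes "j \<le> k"
  defines "\<omega> \<equiv> cis (2 * pi / real (k + 1))"
  shows "a ^ (k - j) * b ^ j =
    (\<Sum>t\<le>k. inverse (of_nat ((k + 1) * (k choose j)) * \<omega> ^ (t * j)) * (a + \<omega> ^ t * b) ^ k)"
proof -
  have \<omega>0: "\<omega> \<noteq> 0" by (simp add: \<omega>_def)
  have \<omega>1: "\<omega> ^ (k + 1) = 1"
  proof -
    have "real (k + 1) * (2 * pi / real (k + 1)) = 2 * pi" by simp
    then show ?thesis unfolding \<omega>_def by (metis Complex.DeMoivre cis_2pi)
  qed
  have root: "\<omega> ^ l \<noteq> \<omega> ^ j" if "l \<le> k" "l \<noteq> j" for l
  proof
    assume "\<omega> ^ l = \<omega> ^ j"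
    then have "cis (2 * pi * real l / real (k + 1)) = cis (2 * pi * real j / real (k + 1))"
      by (simp add: \<omega>_def Complex.DeMoivre mult.commute)
    moreover have "inj_on (\<lambda>l. cis (2 * pi * real l / real (k + 1))) {..<k+1}"
      using Complex.bij_betw_roots_unity[of "k + 1"] by (simp add: bij_betw_def)
    ultimately show False using that assms(1) by (auto simp: inj_on_def)
  qed
  have geo: "(\<Sum>t\<le>k. (\<omega> ^ l / \<omega> ^ j) ^ t) = (if l = j then of_nat (k + 1) else 0)" if "l \<le> k" for l
  proof (cases "l = j")
    case False
    define q where "q = \<omega> ^ l / \<omega> ^ j"
    have q1: "q \<noteq> 1" using root[OF that False] \<omega>0 by (simp add: q_def)
    have "q ^ Suc k = (\<omega> ^ (k + 1)) ^ l / (\<omega> ^ (k + 1)) ^ j"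
      unfolding q_def power_divide power_mult[symmetric] by (simp add: mult.commute)
    then have "q ^ Suc k = 1" using \<omega>1 by simp
    then have "(\<Sum>t\<le>k. q ^ t) = 0"
      using sum_gp_basic[of q k] q1 by simp
    then show ?thesis using False by (simp add: q_def)
  qed (use \<omega>0 in simp)
  have "(\<Sum>t\<le>k. inverse (\<omega> ^ (t * j)) * (a + \<omega> ^ t * b) ^ k)
      = (\<Sum>t\<le>k. \<Sum>l\<le>k. of_nat (k choose l) * a ^ (k - l) * b ^ l * (\<omega> ^ l / \<omega> ^ j) ^ t)"
  proof (rule sum.cong[OF refl])
    fix t
    have "(a + \<omega> ^ t * b) ^ k = (\<Sum>l\<le>k. of_nat (k choose l) * (\<omega> ^ t * b) ^ l * a ^ (k - l))"
      by (simp add: binomial_ring add.commute[of a])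
    then show "inverse (\<omega> ^ (t * j)) * (a + \<omega> ^ t * b) ^ k
        = (\<Sum>l\<le>k. of_nat (k choose l) * a ^ (k - l) * b ^ l * (\<omega> ^ l / \<omega> ^ j) ^ t)"
      by (simp add: sum_distrib_left power_mult_distrib power_divide power_mult[symmetric]
          field_simps)
  qed
  also have "\<dots> = (\<Sum>l\<le>k. of_nat (k choose l) * a ^ (k - l) * b ^ l * (\<Sum>t\<le>k. (\<omega> ^ l / \<omega> ^ j) ^ t))"
    by (subst sum.swap) (simp add: sum_distrib_left)
  also have "\<dots> = (\<Sum>l\<le>k. if l = j then of_nat ((k + 1) * (k choose j)) * (a ^ (k - j) * b ^ j) else 0)"
    by (intro sum.cong) (auto simp: geo algebra_simps)
  also have "\<dots> = of_nat ((k + 1) * (k choose j)) * (a ^ (k - j) * b ^ j)"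
    using assms(1) by (simp only: sum.delta finite_atMost atMost_iff if_True)
  finally have S: "(\<Sum>t\<le>k. inverse (\<omega> ^ (t * j)) * (a + \<omega> ^ t * b) ^ k)
      = of_nat ((k + 1) * (k choose j)) * (a ^ (k - j) * b ^ j)" .
  have nz: "(of_nat ((k + 1) * (k choose j)) :: complex) \<noteq> 0"
    using assms(1) by (simp only: of_nat_eq_0_iff) simp
  have "(\<Sum>t\<le>k. inverse (of_nat ((k + 1) * (k choose j)) * \<omega> ^ (t * j)) * (a + \<omega> ^ t * b) ^ k)
      = inverse (of_nat ((k + 1) * (k choose j))) * (\<Sum>t\<le>k. inverse (\<omega> ^ (t * j)) * (a + \<omega> ^ t * b) ^ k)"
    by (simp add: sum_distrib_left mult.assoc del: of_nat_mult of_nat_add of_nat_Suc)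
  also have "\<dots> = a ^ (k - j) * b ^ j"
    unfolding S by (simp only: mult.assoc[symmetric] left_inverse[OF nz] mult_1_left)
  finally show ?thesis by simp
qed

section \<open>Monomials in two functionals\<close>

context poly_ideals
begin

text \<open>By the root-of-unity formula the monomial is a combination of k + 1 powers, each of norm
  at most 2^k, with coefficients of modulus at most 1/(k + 1).\<close>

lemma unit_monomial_in_A:
  assumes \<gamma>: "functional \<gamma> 1" and \<eta>: "functional \<eta> 1"
  shows "pw2 \<gamma> i \<eta> j \<in> A (i + j)"
    "nA (i + j) (pw2 \<gamma> i \<eta> j) \<le> 2 ^ (i + j)"
proof -
  define k where "k = i + j"
  define \<omega> where "\<omega> = cis (2 * pi / real (k + 1))"
  define c where "c t = inverse (of_nat ((k + 1) * (k choose j)) * \<omega> ^ (t * j))" for t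
  define Q where "Q t = on_carr E (\<lambda>x. (\<gamma> x + \<omega> ^ t * \<eta> x) ^ k)" for t
  have "functional (\<lambda>x. \<gamma> x + \<omega> ^ t * \<eta> x) 2" for t
    using functional_lincomb[OF \<gamma> \<eta>, of "\<omega> ^ t"] by (simp add: \<omega>_def norm_power)
  from power_in_A[OF this] have Q: "Q t \<in> A k" "nA k (Q t) \<le> 2 ^ k" for t
    by (simp_all add: Q_def)
  have e: "pw2 \<gamma> i \<eta> j = (\<lambda>x. \<Sum>t\<le>k. c t * Q t x)"
    using binomial_coefficient_average[of j k]
    by (auto simp: k_def on_carr_def Q_def c_def \<omega>_def)
  show "pw2 \<gamma> i \<eta> j \<in> A (i + j)"
    unfolding e k_def[symmetric] by (intro A.mem_sum A.mem_cmult Q)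
  have one: "1 \<le> k choose j" using zero_less_binomial[of j k] unfolding k_def by linarith
  have "cmod (c t) = inverse (real ((k + 1) * (k choose j)))" for t
    unfolding c_def norm_inverse norm_mult norm_of_nat by (simp add: \<omega>_def norm_power)
  also have "\<dots> \<le> inverse (real (k + 1))"
  proof (rule le_imp_inverse_le)
    have "k + 1 \<le> (k + 1) * (k choose j)" using mult_le_mono2[OF one, of "k + 1"] by simp
    then show "real (k + 1) \<le> real ((k + 1) * (k choose j))" by (simp only: of_nat_le_iff)
  qed simp
  finally have c: "cmod (c t) \<le> inverse (real (k + 1))" for t .
  have "nA k (\<lambda>x. \<Sum>t\<le>k. c t * Q t x) \<le> (\<Sum>t\<le>k. nA k (\<lambda>x. c t * Q t x))"
    by (intro A.N_sum A.mem_cmult Q)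
  also have "\<dots> = (\<Sum>t\<le>k. cmod (c t) * nA k (Q t))"
    by (simp add: A.N_cmult Q)
  also have "\<dots> \<le> (\<Sum>t\<le>k. inverse (real (k + 1)) * 2 ^ k)"
    by (intro sum_mono mult_mono c Q A.N_nonneg) auto
  also have "\<dots> = 2 ^ k" by simp
  finally show "nA (i + j) (pw2 \<gamma> i \<eta> j) \<le> 2 ^ (i + j)"
    unfolding e k_def[symmetric] .
qed

text \<open>Rescaling both functionals first keeps the two bounds separate: the power of G is
  exactly i, so a small functional contributes a small factor. Averaging without rescaling would
  only give a power of G + H.\<close>

lemma monomial_in_A:
  assumes \<gamma>: "functional \<gamma> G" and \<eta>: "functional \<eta> H" and pos: "0 < G" "0 < H"
  shows "pw2 \<gamma> i \<eta> j \<in> A (i + j)"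
    "nA (i + j) (pw2 \<gamma> i \<eta> j) \<le> (2 * G) ^ i * (2 * H) ^ j"
proof -
  let ?\<gamma> = "\<lambda>x. complex_of_real (inverse G) * \<gamma> x" and ?\<eta> = "\<lambda>x. complex_of_real (inverse H) * \<eta> x"
  have f: "functional ?\<gamma> 1" "functional ?\<eta> 1"
    using functional_cmult[OF \<gamma>, of "inverse G"] functional_cmult[OF \<eta>, of "inverse H"] pos
    by (simp_all add: norm_inverse)
  note u = unit_monomial_in_A[OF f, of i j]
  have e: "pw2 \<gamma> i \<eta> j
      = (\<lambda>x. complex_of_real (G ^ i * H ^ j) * pw2 ?\<gamma> i ?\<eta> j x)"
    using pos by (auto simp: on_carr_def power_mult_distrib field_simps)
  show "pw2 \<gamma> i \<eta> j \<in> A (i + j)"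
    unfolding e by (intro A.mem_cmult u)
  have "nA (i + j) (pw2 \<gamma> i \<eta> j)
      = G ^ i * H ^ j * nA (i + j) (pw2 ?\<gamma> i ?\<eta> j)"
    unfolding e A.N_cmult[OF u(1)] using pos by (simp add: norm_mult norm_power)
  also have "\<dots> \<le> G ^ i * H ^ j * 2 ^ (i + j)"
    using u pos by (intro mult_left_mono) auto
  finally show "nA (i + j) (pw2 \<gamma> i \<eta> j) \<le> (2 * G) ^ i * (2 * H) ^ j"
    by (simp add: power_add power_mult_distrib mult_ac)
qed

section \<open>Entire functions with everywhere convergent expansions\<close>

abbreviation Hb :: "('a \<Rightarrow> complex) set" where "Hb \<equiv> HbA \<AA> E"
abbreviation Hb_top :: "('a \<Rightarrow> complex) topology" where "Hb_top \<equiv> HbA_topology \<AA> E"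
abbreviation shift :: "'a \<Rightarrow> ('a \<Rightarrow> complex) \<Rightarrow> 'a \<Rightarrow> complex" where
  "shift \<equiv> translation E"
abbreviation p :: "real \<Rightarrow> ('a \<Rightarrow> complex) \<Rightarrow> real" where "p \<equiv> HbA_seminorm \<AA> E"

text \<open>Summability for every weight s is the root condition of the space in a form that is
  stable under the sums and estimates to follow. Convergence is required on the whole space, not
  only near the origin.\<close>

definition expansion :: "('a \<Rightarrow> complex) \<Rightarrow> (nat \<Rightarrow> 'a \<Rightarrow> complex) \<Rightarrow> bool" where
  "expansion f R \<longleftrightarrow> (\<forall>k. R k \<in> A k) \<and> (\<forall>s>0. summable (\<lambda>k. s ^ k * nA k (R k))) \<and>
     (\<forall>x\<in>carr E. (\<lambda>k. R k x) sums f x) \<and> (\<forall>x. x \<notin> carr E \<longrightarrow> f x = 0)"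

text \<open>Only the series at the origin is examined. \<open>HbA_X\<close> shows that
  \<open>X\<close> contains \<open>Hb\<close>; for the opposite direction \<open>HbA_I\<close> asks
  that all translates lie in \<open>X\<close>.\<close>

definition X :: "('a \<Rightarrow> complex) set" where "X = {f. \<exists>R. expansion f R}"

lemma power_series_line:
  assumes P: "power_series_at E f (vzero E) P" and x: "x \<in> carr E"
  shows "\<exists>r>0. \<forall>t. cmod t < r \<longrightarrow> (\<lambda>k. P k x * t ^ k) sums f (vscale E t x)"
proof -
  obtain r where r: "r > 0" and u: "uniform_limit {x\<in>carr E. vnorm E (vsub E x (vzero E)) < r}
      (\<lambda>n x. \<Sum>k<n. P k (vsub E x (vzero E))) f sequentially"
    and hp: "\<And>k. P k \<in> hom_polys E k"
    using P unfolding power_series_at_def by blast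
  show ?thesis
  proof (intro exI[of _ "r / (vnorm E x + 1)"] conjI allI impI)
    have n: "0 \<le> vnorm E x" by (rule vnorm_nonneg[OF x])
    then show "0 < r / (vnorm E x + 1)" using r by simp
    fix t assume t: "cmod t < r / (vnorm E x + 1)"
    have "cmod t * vnorm E x \<le> cmod t * (vnorm E x + 1)" by (intro mult_left_mono) auto
    also have "\<dots> < r" using t n by (simp add: field_simps)
    finally have "vnorm E (vscale E t x) < r" using x by (simp add: norm_scale)
    moreover have c: "vscale E t x \<in> carr E" using x by (rule scale_closed)
    ultimately have "(\<lambda>n. \<Sum>k<n. P k (vsub E (vscale E t x) (vzero E))) \<longlonglongrightarrow> f (vscale E t x)"
      by (intro tendsto_uniform_limitI[OF u]) (auto simp: vsub_zero)
    then show "(\<lambda>k. P k x * t ^ k) sums f (vscale E t x)"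
      by (simp add: sums_def vsub_zero[OF c] hom_polys_scale[OF hp x] mult.commute)
  qed
qed

text \<open>Makes the \<open>THE\<close> in \<open>taylor_term\<close> meaningful. On the complex
  line through x both series are power series in one variable with the same sum near 0.\<close>

lemma power_series_at_zero_unique:
  assumes P: "power_series_at E f (vzero E) P" and Q: "power_series_at E f (vzero E) Q"
  shows "P = Q"
proof (intro ext)
  fix k x
  show "P k x = Q k x"
  proof (cases "x \<in> carr E")
    case False
    then show ?thesis using P Q by (auto simp: power_series_at_def hom_polys_def)
  next
    case True
    obtain r s where rs: "r > 0" "s > 0"
      and sr: "\<And>t. cmod t < r \<Longrightarrow> (\<lambda>k. P k x * t ^ k) sums f (vscale E t x)"
      and ss: "\<And>t. cmod t < s \<Longrightarrow> (\<lambda>k. Q k x * t ^ k) sums f (vscale E t x)"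
      using power_series_line[OF P True] power_series_line[OF Q True] by blast
    define d where "d k = P k x - Q k x" for k
    have d: "(\<lambda>k. d k * t ^ k) sums 0" if "cmod t < min r s" for t
      using sums_diff[OF sr ss, of t t] that by (simp add: d_def algebra_simps)
    have "d 0 = 0"
      using sums_unique2[OF powser_sums_zero d] rs by simp
    moreover have "d k = 0" if k: "0 < k"
    proof (rule ccontr)
      assume "d k \<noteq> 0"
      \<comment> \<open>A power series with a non-zero coefficient does not vanish in some punctured
        disc, but here its sum is the constant 0.\<close>
      then obtain u where "0 < u" "\<And>z::complex. z \<in> cball 0 u - {0} \<Longrightarrow> (0::complex) \<noteq> 0"
        using powser_0_nonzero[of "min r s" 0 d "\<lambda>_. 0" k] d rs k by auto
      moreover have "complex_of_real u \<in> cball 0 u - {0}" using \<open>0 < u\<close> by simp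
      ultimately show False by blast
    qed
    ultimately show ?thesis by (cases k) (auto simp: d_def)
  qed
qed

lemma expansionD:
  assumes "expansion f R"
  shows "R k \<in> A k" "0 < s \<Longrightarrow> summable (\<lambda>k. s ^ k * nA k (R k))"
    "x \<in> carr E \<Longrightarrow> (\<lambda>k. R k x) sums f x" "x \<notin> carr E \<Longrightarrow> f x = 0"
  using assms by (auto simp: expansion_def)

lemma expansion_term_le:
  assumes "expansion f R" "x \<in> carr E" "vnorm E x \<le> s"
  shows "cmod (R k x) \<le> s ^ k * nA k (R k)"
proof -
  have "cmod (R k x) \<le> nA k (R k) * vnorm E x ^ k"
    by (rule A_eval[OF expansionD(1)[OF assms(1)] assms(2)])
  also have "\<dots> \<le> nA k (R k) * s ^ k"
    using assms by (intro mult_left_mono power_mono A.N_nonneg vnorm_nonneg expansionD(1))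
  finally show ?thesis by (simp add: mult.commute)
qed

lemma expansion_uniform_limit:
  assumes R: "expansion f R"
  shows "uniform_limit {x\<in>carr E. vnorm E x < 1} (\<lambda>n x. \<Sum>k<n. R k x) f sequentially"
proof -
  have "uniform_limit {x\<in>carr E. vnorm E x < 1} (\<lambda>n x. \<Sum>k<n. R k x) (\<lambda>x. \<Sum>k. R k x) sequentially"
    using expansion_term_le[OF R, of _ 1] expansionD(2)[OF R, of 1]
    by (intro Weierstrass_m_test[where M = "\<lambda>k. 1 ^ k * nA k (R k)"]) auto
  then show ?thesis
    by (rule uniform_limit_cong'[THEN iffD1, rotated -1])
      (auto dest: expansionD(3)[OF R] simp: sums_iff)
qed

lemma taylor_term_eq:
  assumes R: "expansion f R"
  shows "taylor_term E f = R"
proof -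
  have eq: "{x\<in>carr E. vnorm E (vsub E x (vzero E)) < 1} = {x\<in>carr E. vnorm E x < 1}"
    by (auto simp: vsub_zero)
  have "uniform_limit {x\<in>carr E. vnorm E x < 1} (\<lambda>n x. \<Sum>k<n. R k (vsub E x (vzero E))) f sequentially"
    using expansion_uniform_limit[OF R]
    by (rule uniform_limit_cong'[THEN iffD1, rotated -1]) (auto simp: vsub_zero)
  then have "power_series_at E f (vzero E) R"
    unfolding power_series_at_def using A_hom_polys expansionD(1)[OF R]
    by (intro conjI allI exI[of _ 1]) (auto simp: eq)
  then show ?thesis
    unfolding taylor_term_def using power_series_at_zero_unique by (intro the_equality) auto
qed

section \<open>The seminorms on \<open>X\<close>\<close>

lemma p_eq: "expansion f R \<Longrightarrow> p s f = (\<Sum>k. s ^ k * nA k (R k))"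
  by (simp add: HbA_seminorm_def taylor_term_eq ideal_space_def fun_space_def)

lemma X_expansion: "f \<in> X \<Longrightarrow> expansion f (taylor_term E f)"
  by (auto simp: X_def taylor_term_eq)

lemma X_off: "f \<in> X \<Longrightarrow> x \<notin> carr E \<Longrightarrow> f x = 0"
  by (auto simp: X_def expansion_def)

lemma p_nonneg:
  assumes "f \<in> X" "0 < s"
  shows "0 \<le> p s f"
  using assms expansionD[OF X_expansion[OF assms(1)]]
  by (auto simp: p_eq[OF X_expansion] A.N_nonneg intro!: suminf_nonneg)

lemma p_mono:
  assumes "f \<in> X" "0 < s" "s \<le> t"
  shows "p s f \<le> p t f"
  using assms expansionD[OF X_expansion[OF assms(1)]]
  by (auto simp: p_eq[OF X_expansion] A.N_nonneg intro!: suminf_le mult_right_mono power_mono)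

lemma p_eval:
  assumes f: "f \<in> X" and s: "0 < s" and x: "x \<in> carr E" "vnorm E x \<le> s"
  shows "cmod (f x) \<le> p s f"
proof -
  note R = X_expansion[OF f]
  have sm: "summable (\<lambda>k. cmod (taylor_term E f k x))"
    by (rule summable_comparison_test'[OF expansionD(2)[OF R s], of 0])
      (simp add: expansion_term_le[OF R x])
  have "cmod (f x) \<le> (\<Sum>k. cmod (taylor_term E f k x))"
    using summable_norm[OF sm] sums_unique[OF expansionD(3)[OF R x(1)]] by simp
  also have "\<dots> \<le> p s f"
    unfolding p_eq[OF R]
    by (rule suminf_le[OF expansion_term_le[OF R x] sm expansionD(2)[OF R s]])
  finally show ?thesis .
qed

lemma expansion_zero: "expansion (\<lambda>x. 0) (\<lambda>k x. 0)"
  by (simp add: expansion_def A.mem_zero A.N_zero)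

lemma p_zero: "p s (\<lambda>x. 0) = 0"
  by (simp add: p_eq[OF expansion_zero] A.N_zero)

lemma expansion_lincomb:
  assumes f: "expansion f R" and g: "expansion g S"
  shows "expansion (\<lambda>x. f x + c * g x) (\<lambda>k x. R k x + (c :: complex) * S k x)"
    "0 < s \<Longrightarrow> p s (\<lambda>x. f x + c * g x) \<le> p s f + cmod c * p s g"
proof -
  have le: "s ^ k * nA k (\<lambda>x. R k x + c * S k x) \<le> s ^ k * nA k (R k) + cmod c * (s ^ k * nA k (S k))"
    if "0 < s" for s k
  proof -
    have "nA k (\<lambda>x. R k x + c * S k x) \<le> nA k (R k) + cmod c * nA k (S k)"
      using A.N_add[OF expansionD(1)[OF f, of k] A.mem_cmult[OF expansionD(1)[OF g, of k], of c]]
        A.N_cmult[OF expansionD(1)[OF g, of k], of c] by simp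
    then have "s ^ k * nA k (\<lambda>x. R k x + c * S k x) \<le> s ^ k * (nA k (R k) + cmod c * nA k (S k))"
      using that by (intro mult_left_mono) auto
    then show ?thesis by (simp add: algebra_simps)
  qed
  have mem: "(\<lambda>x. R k x + c * S k x) \<in> A k" for k
    by (intro A.mem_add A.mem_cmult expansionD(1)[OF f] expansionD(1)[OF g])
  have smr: "summable (\<lambda>k. s ^ k * nA k (R k) + cmod c * (s ^ k * nA k (S k)))" if "0 < s" for s
    using expansionD(2)[OF f that] expansionD(2)[OF g that] by (intro summable_add summable_mult)
  have sm: "summable (\<lambda>k. s ^ k * nA k (\<lambda>x. R k x + c * S k x))" if "0 < s" for s
    using le[OF that] A.N_nonneg[OF mem] that by (intro summable_comparison_test'[OF smr[OF that]]) auto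
  show ex: "expansion (\<lambda>x. f x + c * g x) (\<lambda>k x. R k x + c * S k x)"
    unfolding expansion_def using sm mem expansionD(3,4)[OF f] expansionD(3,4)[OF g]
    by (auto intro!: sums_add sums_mult)
  show "p s (\<lambda>x. f x + c * g x) \<le> p s f + cmod c * p s g" if s: "0 < s"
  proof -
    have "p s (\<lambda>x. f x + c * g x) \<le> (\<Sum>k. s ^ k * nA k (R k) + cmod c * (s ^ k * nA k (S k)))"
      unfolding p_eq[OF ex] by (intro suminf_le le s sm smr)
    also have "\<dots> = p s f + cmod c * p s g"
      unfolding p_eq[OF f] p_eq[OF g] using expansionD(2)[OF f s] expansionD(2)[OF g s]
      by (simp add: suminf_add[symmetric] suminf_mult summable_mult)
    finally show ?thesis .
  qed
qed

lemma X_zero: "(\<lambda>x. 0) \<in> X"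
  using expansion_zero by (auto simp: X_def)

lemma X_lincomb: "f \<in> X \<Longrightarrow> g \<in> X \<Longrightarrow> (\<lambda>x. f x + c * g x) \<in> X"
  using expansion_lincomb(1) by (fastforce simp: X_def)

lemma X_add: "f \<in> X \<Longrightarrow> g \<in> X \<Longrightarrow> (\<lambda>x. f x + g x) \<in> X"
  using X_lincomb[of f g 1] by simp

lemma X_diff: "f \<in> X \<Longrightarrow> g \<in> X \<Longrightarrow> (\<lambda>x. f x - g x) \<in> X"
  using X_lincomb[of f g "-1"] by simp

lemma X_cmult: "f \<in> X \<Longrightarrow> (\<lambda>x. (c :: complex) * f x) \<in> X"
  using X_lincomb[OF X_zero, of f c] by simp

lemma X_sum: "(\<And>i. i \<in> I \<Longrightarrow> f i \<in> X) \<Longrightarrow> (\<lambda>x. \<Sum>i\<in>I. f i x) \<in> X"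
  by (induction I rule: infinite_finite_induct) (auto simp: X_zero X_add)

lemma p_lincomb: "f \<in> X \<Longrightarrow> g \<in> X \<Longrightarrow> 0 < s \<Longrightarrow> p s (\<lambda>x. f x + c * g x) \<le> p s f + cmod c * p s g"
  using expansion_lincomb(2)[OF X_expansion X_expansion] by blast

lemma p_add: "f \<in> X \<Longrightarrow> g \<in> X \<Longrightarrow> 0 < s \<Longrightarrow> p s (\<lambda>x. f x + g x) \<le> p s f + p s g"
  using p_lincomb[of f g s 1] by simp

lemma p_cmult_le: "f \<in> X \<Longrightarrow> 0 < s \<Longrightarrow> p s (\<lambda>x. c * f x) \<le> cmod c * p s f"
  using p_lincomb[OF X_zero, of f s c] by (simp add: p_zero)

lemma p_diff_commute: "f \<in> X \<Longrightarrow> g \<in> X \<Longrightarrow> 0 < s \<Longrightarrow> p s (\<lambda>x. f x - g x) = p s (\<lambda>x. g x - f x)"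
  using p_cmult_le[OF X_diff, of f g s "-1"] p_cmult_le[OF X_diff, of g f s "-1"] by simp

lemma p_triangle:
  assumes "f \<in> X" "g \<in> X" "h \<in> X" "0 < s"
  shows "p s (\<lambda>x. f x - h x) \<le> p s (\<lambda>x. f x - g x) + p s (\<lambda>x. g x - h x)"
  using p_add[OF X_diff X_diff, of f g g h s] assms by simp

lemma p_sum: "(\<And>i. i \<in> I \<Longrightarrow> f i \<in> X) \<Longrightarrow> 0 < s \<Longrightarrow> p s (\<lambda>x. \<Sum>i\<in>I. f i x) \<le> (\<Sum>i\<in>I. p s (f i))"
proof (induction I rule: infinite_finite_induct)
  case (insert i I)
  then show ?case using p_add[OF _ X_sum[of I f], of "f i" s] by force
qed (auto simp: p_zero)

text \<open>The terms of each degree k are summed in the Banach space \<open>A k\<close>;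
  \<open>D m k\<close> is the degree k part of the remainder after m functions. Its bounds for m = 0
  put the sum into \<open>X\<close>, and for m tending to infinity they identify it with the
  pointwise sum.\<close>

lemma p_suminf:
  assumes f: "\<And>j::nat. f j \<in> X" and sm: "\<And>s. 0 < s \<Longrightarrow> summable (\<lambda>j. p s (f j))"
  shows "(\<lambda>x. \<Sum>j. f j x) \<in> X" "0 < s \<Longrightarrow> p s (\<lambda>x. \<Sum>j. f j x) \<le> (\<Sum>j. p s (f j))"
    "x \<in> carr E \<Longrightarrow> summable (\<lambda>j. f j x)"
proof -
  define R where "R j = taylor_term E (f j)" for j
  have R: "expansion (f j) (R j)" for j unfolding R_def by (rule X_expansion[OF f])
  have term_le: "s ^ k * nA k (R j k) \<le> p s (f j)" if "0 < s" for j k s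
  proof -
    have "(\<Sum>k\<in>{k}. s ^ k * nA k (R j k)) \<le> (\<Sum>k. s ^ k * nA k (R j k))"
      using that by (intro sum_le_suminf expansionD(2)[OF R]) (auto intro!: mult_nonneg_nonneg A.N_nonneg expansionD(1)[OF R])
    then show ?thesis by (simp add: p_eq[OF R])
  qed
  have nn: "0 \<le> nA k (R j k)" for j k by (intro A.N_nonneg expansionD(1)[OF R])
  have smk: "summable (\<lambda>j. nA k (R j k))" for k
  proof (rule summable_comparison_test'[of "\<lambda>j. p 1 (f j)" 0])
    show "summable (\<lambda>j. p 1 (f j))" using sm[of 1] by simp
    show "norm (nA k (R j k)) \<le> p 1 (f j)" for j using term_le[of 1 k j] nn[of k j] by simp
  qed
  have "\<exists>T. T \<in> A k \<and> (\<forall>m. nA k (\<lambda>x. T x - (\<Sum>j<m. R j k x)) \<le> (\<Sum>j. nA k (R (j + m) k)))" for k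
    using A.abs_summable_series[of "\<lambda>j. R j k" k, OF expansionD(1)[OF R] smk] by blast
  then have "\<exists>T. \<forall>k. T k \<in> A k \<and> (\<forall>m. nA k (\<lambda>x. T k x - (\<Sum>j<m. R j k x)) \<le> (\<Sum>j. nA k (R (j + m) k)))"
    by (intro choice allI)
  then obtain T where T: "\<And>k. T k \<in> A k"
      "\<And>k m. nA k (\<lambda>x. T k x - (\<Sum>j<m. R j k x)) \<le> (\<Sum>j. nA k (R (j + m) k))"
    by blast
  define D where "D m k = (\<lambda>x. T k x - (\<Sum>j<m. R j k x))" for m k
  have D: "D m k \<in> A k" for m k
    unfolding D_def by (intro A.mem_diff A.mem_sum T expansionD(1)[OF R])
  \<comment> \<open>Only finitely many degrees are summed, so the interchange with the sum over j
    needs no summability in k; letting n grow then yields \<open>smD\<close>.\<close>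
  have part: "(\<Sum>k<n. s ^ k * nA k (D m k)) \<le> (\<Sum>j. p s (f (j + m)))" if s: "0 < s" for s n m
  proof -
    have smk': "summable (\<lambda>j. s ^ k * nA k (R (j + m) k))" for k
      by (intro summable_mult summable_ignore_initial_segment[OF smk])
    have "(\<Sum>k<n. s ^ k * nA k (D m k)) \<le> (\<Sum>k<n. \<Sum>j. s ^ k * nA k (R (j + m) k))"
    proof (rule sum_mono)
      fix k
      have "s ^ k * nA k (D m k) \<le> s ^ k * (\<Sum>j. nA k (R (j + m) k))"
        using T(2)[of k m] s by (simp add: D_def)
      then show "s ^ k * nA k (D m k) \<le> (\<Sum>j. s ^ k * nA k (R (j + m) k))"
        by (simp add: suminf_mult[OF summable_ignore_initial_segment[OF smk]])
    qed
    also have "\<dots> = (\<Sum>j. \<Sum>k<n. s ^ k * nA k (R (j + m) k))"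
      using smk' by (simp add: suminf_sum)
    also have "\<dots> \<le> (\<Sum>j. p s (f (j + m)))"
    proof (intro suminf_le)
      show "(\<Sum>k<n. s ^ k * nA k (R (j + m) k)) \<le> p s (f (j + m))" for j
        unfolding p_eq[OF R] using s nn by (intro sum_le_suminf expansionD(2)[OF R]) auto
      show "summable (\<lambda>j. \<Sum>k<n. s ^ k * nA k (R (j + m) k))"
        using smk' by (intro summable_sum)
      show "summable (\<lambda>j. p s (f (j + m)))" by (rule summable_ignore_initial_segment[OF sm[OF s]])
    qed
    finally show ?thesis .
  qed
  have nnD: "0 \<le> nA k (D m k)" for m k by (rule A.N_nonneg[OF D])
  have smD: "summable (\<lambda>k. s ^ k * nA k (D m k))"
    and leD: "(\<Sum>k. s ^ k * nA k (D m k)) \<le> (\<Sum>j. p s (f (j + m)))" if "0 < s" for s m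
  proof -
    show s1: "summable (\<lambda>k. s ^ k * nA k (D m k))"
    proof (rule bounded_imp_summable[where B = "\<Sum>j. p s (f (j + m))"])
      show "(\<Sum>k\<le>n. s ^ k * nA k (D m k)) \<le> (\<Sum>j. p s (f (j + m)))" for n
        using part[OF that, where m = m and n = "Suc n"] by (simp only: lessThan_Suc_atMost)
    qed (use nnD that in simp)
    show "(\<Sum>k. s ^ k * nA k (D m k)) \<le> (\<Sum>j. p s (f (j + m)))"
      by (rule suminf_le_const[OF s1 part[OF that]])
  qed
  define F where "F = on_carr E (\<lambda>x. \<Sum>k. T k x)"
  have T0: "T = D 0" by (auto simp: D_def fun_eq_iff)
  have smT: "summable (\<lambda>k. T k x)" if x: "x \<in> carr E" for x
  proof (rule summable_comparison_test')
    show "summable (\<lambda>k. (vnorm E x + 1) ^ k * nA k (T k))"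
      unfolding T0 using vnorm_nonneg[OF x] by (intro smD) simp
    fix k
    have "cmod (T k x) \<le> nA k (T k) * vnorm E x ^ k" by (rule A_eval[OF T(1) x])
    also have "\<dots> \<le> nA k (T k) * (vnorm E x + 1) ^ k"
      using vnorm_nonneg[OF x] by (intro mult_left_mono power_mono A.N_nonneg T) auto
    finally show "norm (T k x) \<le> (vnorm E x + 1) ^ k * nA k (T k)" by (simp add: mult.commute)
  qed
  have F: "expansion F T"
    unfolding expansion_def using T(1) smD[of _ 0] smT
    by (auto simp: F_def on_carr_def summable_sums T0[symmetric])
  \<comment> \<open>The remainders have expansions of their own, so \<open>p_eval\<close> turns the
    bound \<open>leD\<close> into pointwise convergence.\<close>
  have Fm: "expansion (\<lambda>x. F x - (\<Sum>j<m. f j x)) (D m)" for m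
    unfolding expansion_def
  proof (intro conjI allI ballI impI)
    fix x assume x: "x \<in> carr E"
    show "(\<lambda>k. D m k x) sums (F x - (\<Sum>j<m. f j x))"
      unfolding D_def by (intro sums_diff sums_sum expansionD(3)[OF F x] expansionD(3)[OF R x])
  qed (use D smD expansionD(4)[OF F] expansionD(4)[OF R] in auto)
  have lim: "(\<lambda>j. f j x) sums F x" if x: "x \<in> carr E" for x
  proof -
    define s where "s = vnorm E x + 1"
    have s: "0 < s" "vnorm E x \<le> s" using vnorm_nonneg[OF x] by (auto simp: s_def)
    have "(\<lambda>m. F x - (\<Sum>j<m. f j x)) \<longlonglongrightarrow> 0"
    proof (rule tendsto_0_le[where K = 1])
      show "(\<lambda>m. \<Sum>j. p s (f (j + m))) \<longlonglongrightarrow> 0" using suminf_exist_split2[OF sm[OF s(1)]] .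
      have le: "cmod (F x - (\<Sum>j<m. f j x)) \<le> (\<Sum>j. p s (f (j + m)))" for m
      proof -
        have "(\<lambda>x. F x - (\<Sum>j<m. f j x)) \<in> X" using Fm by (auto simp: X_def)
        from p_eval[OF this s(1) x s(2)] show ?thesis
          using leD[OF s(1), of m] by (simp add: p_eq[OF Fm])
      qed
      show "\<forall>\<^sub>F m in sequentially. norm (F x - (\<Sum>j<m. f j x)) \<le> norm (\<Sum>j. p s (f (j + m))) * 1"
        by (intro always_eventually allI) (rule order_trans[OF le], simp)
    qed
    then have "(\<lambda>m. F x - (F x - (\<Sum>j<m. f j x))) \<longlonglongrightarrow> F x - 0" by (intro tendsto_diff tendsto_const)
    then show ?thesis by (simp add: sums_def)
  qed
  have eq: "(\<lambda>x. \<Sum>j. f j x) = F"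
  proof
    fix x show "(\<Sum>j. f j x) = F x"
      using sums_unique[OF lim[of x]] X_off[OF f, of x] by (cases "x \<in> carr E") (auto simp: F_def on_carr_def)
  qed
  show "(\<lambda>x. \<Sum>j. f j x) \<in> X" unfolding eq X_def using F by blast
  show "p s (\<lambda>x. \<Sum>j. f j x) \<le> (\<Sum>j. p s (f j))" if "0 < s"
    unfolding eq p_eq[OF F] using leD[OF that, of 0] by (simp add: T0[symmetric])
  show "summable (\<lambda>j. f j x)" if "x \<in> carr E" using lim[OF that] by (rule sums_summable)
qed

section \<open>Comparison of \<open>X\<close> with \<open>Hb\<close>\<close>

lemma translation_zero: "(\<And>x. x \<notin> carr E \<Longrightarrow> f x = 0) \<Longrightarrow> shift (vzero E) f = f"
  by (auto simp: translation_def on_carr_def add_zero_right)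

text \<open>The Taylor series at a is that of the translate by a at the origin, so analyticity
  everywhere reduces to expansions at 0.\<close>

lemma power_series_at_translation:
  assumes a: "a \<in> carr E" and f: "shift a f \<in> X"
  shows "power_series_at E f a (taylor_term E (shift a f))"
proof -
  let ?g = "shift a f" and ?B = "{x\<in>carr E. vnorm E (vsub E x a) < 1}"
  note R = X_expansion[OF f]
  have "uniform_limit ?B (\<lambda>n x. \<Sum>k<n. taylor_term E ?g k (vsub E x a)) (\<lambda>x. ?g (vsub E x a)) sequentially"
    by (rule uniform_limit_compose'[OF expansion_uniform_limit[OF R]]) (auto simp: a vsub_closed)
  moreover have "?g (vsub E x a) = f x" if "x \<in> ?B" for x
    using that a by (simp add: translation_def on_carr_def vsub_closed vsub_add)
  ultimately have "uniform_limit ?B (\<lambda>n x. \<Sum>k<n. taylor_term E ?g k (vsub E x a)) f sequentially"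
    by (subst (asm) uniform_limit_cong') auto
  then show ?thesis
    unfolding power_series_at_def using A_hom_polys expansionD(1)[OF R]
    by (intro conjI allI exI[of _ 1]) auto
qed

lemma root_tendsto_zero:
  fixes b :: "nat \<Rightarrow> real"
  assumes b: "\<And>k. 0 \<le> b k" and sm: "\<And>s. 0 < s \<Longrightarrow> summable (\<lambda>k. s ^ k * b k)"
  shows "(\<lambda>k. root k (b k)) \<longlonglongrightarrow> 0"
proof (rule LIMSEQ_I)
  fix e :: real assume e: "0 < e"
  have "(\<lambda>k. inverse e ^ k * b k) \<longlonglongrightarrow> 0"
    using sm[of "inverse e"] e by (intro summable_LIMSEQ_zero) auto
  then have "\<forall>\<^sub>F k in sequentially. inverse e ^ k * b k < 1"
    by (rule order_tendstoD) simp
  then obtain K where K: "\<And>k. K \<le> k \<Longrightarrow> inverse e ^ k * b k < 1"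
    by (auto simp: eventually_sequentially)
  show "\<exists>no. \<forall>n\<ge>no. norm (root n (b n) - 0) < e"
  proof (intro exI allI impI)
    \<comment> \<open>\<open>root 0\<close> is constantly 0, so the strict comparison of roots
      starts at index 1.\<close>
    fix k assume k: "max K 1 \<le> k"
    then have "b k < e ^ k" using K[of k] e by (simp add: field_simps power_inverse)
    then have "root k (b k) < root k (e ^ k)" using k by (intro real_root_less_mono) auto
    then show "norm (root k (b k) - 0) < e"
      using k e b by (simp add: real_root_power_cancel)
  qed
qed

text \<open>This criterion is the reason why later estimates allow an arbitrary vector a beside the
  multiple of \<open>z0\<close>.\<close>

lemma HbA_I:
  assumes off: "\<And>x. x \<notin> carr E \<Longrightarrow> f x = 0" and tr: "\<And>a. a \<in> carr E \<Longrightarrow> shift a f \<in> X"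
  shows "f \<in> Hb"
proof -
  have "f \<in> X" using tr[OF zero_closed] translation_zero[of f] off by simp
  note R = X_expansion[OF this]
  have "f \<in> entire_funs E"
    unfolding entire_funs_def using off power_series_at_translation[OF _ tr] by blast
  moreover have "diff_at_zero E f k \<in> A k" for k
    unfolding diff_at_zero_def by (intro A.mem_cmult expansionD(1)[OF R])
  moreover have "(\<lambda>k. root k (nA k (taylor_term E f k))) \<longlonglongrightarrow> 0"
    using expansionD(2)[OF R] A.N_nonneg[OF expansionD(1)[OF R]] by (intro root_tendsto_zero)
  ultimately show ?thesis
    by (simp add: HbA_def ideal_space_def fun_space_def)
qed

lemma summable_of_root_tendsto_zero:
  fixes b :: "nat \<Rightarrow> real"
  assumes b: "\<And>k. 0 \<le> b k" and lim: "(\<lambda>k. root k (b k)) \<longlonglongrightarrow> 0" and s: "0 < s"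
  shows "summable (\<lambda>k. s ^ k * b k)"
proof -
  have "\<forall>\<^sub>F k in sequentially. root k (b k) < 1 / (2 * s)"
    using lim by (rule order_tendstoD) (use s in simp)
  then obtain K where K: "\<And>k. K \<le> k \<Longrightarrow> root k (b k) < 1 / (2 * s)"
    by (auto simp: eventually_sequentially)
  show ?thesis
  proof (rule summable_comparison_test'[of "\<lambda>k. (1 / 2) ^ k" "max K 1"])
    show "summable (\<lambda>k. (1 / 2 :: real) ^ k)" by (rule summable_geometric) simp
    fix k assume k: "max K 1 \<le> k"
    have "b k = root k (b k) ^ k" using k b by simp
    also have "\<dots> \<le> (1 / (2 * s)) ^ k"
      using K[of k] k b by (intro power_mono) auto
    finally have "s ^ k * b k \<le> s ^ k * (1 / (2 * s)) ^ k" using s by simp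
    also have "\<dots> = (1 / 2) ^ k" using s by (simp add: power_divide power_mult_distrib)
    finally show "norm (s ^ k * b k) \<le> (1 / 2) ^ k" using s b by simp
  qed
qed

text \<open>A power series at 0 represents an entire function only near 0; the identity theorem on
  complex lines extends the representation to the whole space.\<close>

lemma entire_line_holomorphic:
  assumes f: "f \<in> entire_funs E" and x: "x \<in> carr E"
  shows "(\<lambda>w. f (vscale E w x)) holomorphic_on UNIV"
proof -
  have "\<exists>r>0. (\<lambda>w. f (vscale E w x)) holomorphic_on ball w0 r" for w0
  proof -
    obtain P where P: "power_series_at E f (vscale E w0 x) P"
      using f scale_closed[OF x] unfolding entire_funs_def by blast
    then obtain r where r: "r > 0" and u: "uniform_limit {y\<in>carr E. vnorm E (vsub E y (vscale E w0 x)) < r}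
        (\<lambda>n y. \<Sum>k<n. P k (vsub E y (vscale E w0 x))) f sequentially"
      and hp: "\<And>k. P k \<in> hom_polys E k"
      unfolding power_series_at_def by blast
    have n: "0 \<le> vnorm E x" by (rule vnorm_nonneg[OF x])
    have "(\<lambda>w. f (vscale E w x)) holomorphic_on ball w0 (r / (vnorm E x + 1))"
    proof (rule power_series_holomorphic)
      fix w assume "w \<in> ball w0 (r / (vnorm E x + 1))"
      then have w: "cmod (w - w0) < r / (vnorm E x + 1)" by (simp add: dist_norm norm_minus_commute)
      have "cmod (w - w0) * vnorm E x \<le> cmod (w - w0) * (vnorm E x + 1)" by (intro mult_left_mono) auto
      also have "\<dots> < r" using w n by (simp add: field_simps)
      finally have "vnorm E (vsub E (vscale E w x) (vscale E w0 x)) < r"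
        using x by (simp add: norm_scale vsub_scale)
      then have "(\<lambda>n. \<Sum>k<n. P k (vsub E (vscale E w x) (vscale E w0 x))) \<longlonglongrightarrow> f (vscale E w x)"
        using scale_closed[OF x] by (intro tendsto_uniform_limitI[OF u]) auto
      then show "(\<lambda>k. P k x * (w - w0) ^ k) sums f (vscale E w x)"
        by (simp add: sums_def vsub_scale[OF x] hom_polys_scale[OF hp x] mult.commute)
    qed
    moreover have "0 < r / (vnorm E x + 1)" using r n by simp
    ultimately show ?thesis by blast
  qed
  then have "(\<lambda>w. f (vscale E w x)) field_differentiable at w0" for w0
    by (meson centre_in_ball holomorphic_on_imp_differentiable_at open_ball)
  then show ?thesis by (simp add: holomorphic_on_def)
qed

lemma HbA_X: "f \<in> Hb \<Longrightarrow> f \<in> X"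
proof -
  assume f: "f \<in> Hb"
  define R where "R = taylor_term E f"
  have ent: "f \<in> entire_funs E" using f by (simp add: HbA_def)
  obtain P where P: "power_series_at E f (vzero E) P"
    using ent zero_closed unfolding entire_funs_def by blast
  then have "R = P"
    unfolding R_def taylor_term_def by (intro the_equality power_series_at_zero_unique)
  then have ps: "power_series_at E f (vzero E) R" using P by simp
  have RA: "R k \<in> A k" for k
  proof -
    have "(\<lambda>x. fact k * R k x) \<in> A k"
      using f by (auto simp: HbA_def diff_at_zero_def R_def ideal_space_def fun_space_def)
    from A.mem_cmult[OF this, of "inverse (fact k)"] show ?thesis
      by (simp add: mult.assoc[symmetric])
  qed
  have sm: "summable (\<lambda>k. s ^ k * nA k (R k))" if "0 < s" for s
    using f that A.N_nonneg[OF RA]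
    by (intro summable_of_root_tendsto_zero) (auto simp: HbA_def R_def ideal_space_def fun_space_def)
  have sums: "(\<lambda>k. R k x) sums f x" if x: "x \<in> carr E" for x
  proof -
    \<comment> \<open>\<open>h\<close> sums the Taylor terms along the line through x. The ideal
      norms make it entire, whereas its agreement with f is at first known only near 0; the point of
      interest is w = 1.\<close>
    define h where "h = (\<lambda>w. \<Sum>k. R k x * w ^ k)"
    have h: "(\<lambda>k. R k x * w ^ k) sums h w" for w
      unfolding h_def
    proof (rule summable_sums, rule summable_comparison_test')
      have n: "0 \<le> vnorm E x" by (rule vnorm_nonneg[OF x])
      define s where "s = cmod w * vnorm E x + 1"
      have s: "0 < s" "cmod w * vnorm E x \<le> s" using n by (auto simp: s_def add_nonneg_pos)
      show "summable (\<lambda>k. s ^ k * nA k (R k))" by (rule sm[OF s(1)])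
      fix k
      have "norm (R k x * w ^ k) \<le> nA k (R k) * vnorm E x ^ k * cmod w ^ k"
        unfolding norm_mult norm_power by (intro mult_right_mono A_eval[OF RA x]) auto
      also have "\<dots> = nA k (R k) * (cmod w * vnorm E x) ^ k" by (simp add: power_mult_distrib)
      also have "\<dots> \<le> nA k (R k) * s ^ k"
        using s n by (intro mult_left_mono power_mono A.N_nonneg RA) auto
      finally show "norm (R k x * w ^ k) \<le> s ^ k * nA k (R k)" by (simp add: mult.commute)
    qed
    have hh: "h holomorphic_on UNIV"
    proof -
      have "h holomorphic_on ball 0 r" for r
        using h by (intro power_series_holomorphic[where a = "\<lambda>k. R k x"]) simp
      then have "h field_differentiable at w" for w
        by (rule holomorphic_on_imp_differentiable_at[of _ "ball 0 (cmod w + 1)"]) auto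
      then show ?thesis by (simp add: holomorphic_on_def)
    qed
    obtain r where r: "r > 0" and near: "\<And>w. cmod w < r \<Longrightarrow> (\<lambda>k. R k x * w ^ k) sums f (vscale E w x)"
      using power_series_line[OF ps x] by blast
    have "f (vscale E 1 x) = h 1"
    proof (rule analytic_continuation_open[of "ball 0 r" UNIV "\<lambda>w. f (vscale E w x)" h])
      show "f (vscale E w x) = h w" if "w \<in> ball 0 r" for w
        using sums_unique2[OF near h, of w] that by simp
    qed (use r entire_line_holomorphic[OF ent x] hh in auto)
    then show ?thesis using h[of 1] x by (simp add: scale_one)
  qed
  have "expansion f R"
    unfolding expansion_def using RA sm sums ent by (auto simp: entire_funs_def)
  then show ?thesis by (auto simp: X_def)
qed

end

section \<open>The Hahn-Banach theorem\<close>

context complex_normed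
begin

abbreviation rs :: "real \<Rightarrow> 'a \<Rightarrow> 'a" where "rs t x \<equiv> vscale E (of_real t) x"

text \<open>Domination by the norm makes the infima exist and the final functional bounded.
  Homogeneity is one-sided, since the opposite inequality follows by scaling with 1/t. The value 0
  off the carrier lets the pointwise order be used on the whole type.\<close>

definition sublinear :: "('a \<Rightarrow> real) \<Rightarrow> bool" where
  "sublinear q \<longleftrightarrow>
     (\<forall>x\<in>carr E. \<forall>y\<in>carr E. q (vadd E x y) \<le> q x + q y) \<and>
     (\<forall>x\<in>carr E. \<forall>t>0. q (rs t x) \<le> t * q x) \<and>
     (\<forall>x\<in>carr E. q x \<le> vnorm E x) \<and> (\<forall>x. x \<notin> carr E \<longrightarrow> q x = 0)"

lemma sublinearD:
  assumes "sublinear q"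
  shows "x \<in> carr E \<Longrightarrow> y \<in> carr E \<Longrightarrow> q (vadd E x y) \<le> q x + q y"
    "x \<in> carr E \<Longrightarrow> 0 < t \<Longrightarrow> q (rs t x) \<le> t * q x"
    "x \<in> carr E \<Longrightarrow> q x \<le> vnorm E x" "x \<notin> carr E \<Longrightarrow> q x = 0"
  using assms by (auto simp: sublinear_def)

lemma sublinear_zero: "sublinear q \<Longrightarrow> q (vzero E) = 0"
  using sublinearD(1)[of q "vzero E" "vzero E"] sublinearD(3)[of q "vzero E"]
  by (simp add: zero_closed add_zero vnorm_zero)

lemma sublinear_neg: "sublinear q \<Longrightarrow> x \<in> carr E \<Longrightarrow> 0 \<le> q x + q (vneg x)"
  using sublinearD(1)[of q x "vneg x"] by (simp add: scale_closed add_neg sublinear_zero)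

lemma sublinear_ge: "sublinear q \<Longrightarrow> x \<in> carr E \<Longrightarrow> - vnorm E x \<le> q x"
  using sublinear_neg[of q x] sublinearD(3)[of q "vneg x"]
  by (simp add: scale_closed norm_scale)

text \<open>A minimal sublinear functional is fixed by all of these reductions, and therefore additive.\<close>

definition reduce :: "('a \<Rightarrow> real) \<Rightarrow> 'a \<Rightarrow> 'a \<Rightarrow> real" where
  "reduce q a x =
     (if x \<in> carr E then INF t\<in>{0..}. q (vadd E x (rs t a)) - t * q a else 0)"

text \<open>The point is that the infimum is over a set bounded below: t q(a) \<le> q(t a) \<le> q(x
  + t a) + q(-x), and q(-x) is at most the norm of x.\<close>

lemma reduce_le:
  assumes q: "sublinear q" and a: "a \<in> carr E" and x: "x \<in> carr E" and t: "0 \<le> t"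
  shows "reduce q a x \<le> q (vadd E x (rs t a)) - t * q a"
proof -
  have "- vnorm E x \<le> q (vadd E x (rs t a)) - t * q a" if t: "0 \<le> t" for t
  proof -
    let ?ta = "rs t a"
    have ta: "?ta \<in> carr E" using a by (rule scale_closed)
    have "t * q a \<le> q ?ta"
    proof (cases "t = 0")
      case True
      then show ?thesis using a q by (simp add: scale_zero_left sublinear_zero)
    next
      case False
      then show ?thesis
        using sublinearD(2)[OF q ta, of "inverse t"] t a
        by (simp add: scale_scale scale_one field_simps flip: of_real_mult of_real_inverse)
    qed
    also have "?ta = vadd E (vadd E x ?ta) (vneg x)"
      using x ta add_commute[of "vadd E x ?ta" "vneg x"]
        add_assoc[of "vneg x" x ?ta] add_commute[of "vneg x" x]
      by (simp add: add_closed scale_closed add_neg add_zero)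
    also have "q \<dots> \<le> q (vadd E x ?ta) + q (vneg x)"
      using q x ta by (intro sublinearD) (auto simp: add_closed scale_closed)
    also have "q (vneg x) \<le> vnorm E x"
      using sublinearD(3)[OF q scale_closed[OF x], of "-1"] x by (simp add: norm_scale)
    finally show ?thesis by simp
  qed
  then have "bdd_below ((\<lambda>t. q (vadd E x (rs t a)) - t * q a) ` {0..})"
    by (intro bdd_belowI[of _ "- vnorm E x"]) auto
  then show ?thesis using x t by (auto simp: reduce_def intro: cINF_lower)
qed

lemma le_reduce:
  assumes "x \<in> carr E" "\<And>t. 0 \<le> t \<Longrightarrow> b \<le> q (vadd E x (rs t a)) - t * q a"
  shows "b \<le> reduce q a x"
  using assms by (auto simp: reduce_def intro!: cINF_greatest)

lemma reduce_le_self: "sublinear q \<Longrightarrow> a \<in> carr E \<Longrightarrow> reduce q a x \<le> q x"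
  using reduce_le[of q a x 0]
  by (cases "x \<in> carr E") (auto simp: scale_zero_left add_zero_right sublinearD reduce_def)

text \<open>Parameters add under sums and scale under dilations: s for x and t for y give s + t for
  the sum, and t for x gives c t for the multiple by c.\<close>

lemma sublinear_reduce:
  assumes q: "sublinear q" and a: "a \<in> carr E"
  shows "sublinear (reduce q a)"
  unfolding sublinear_def
proof (intro conjI ballI allI impI)
  let ?v = "\<lambda>x t. vadd E x (rs t a)"
  show "reduce q a (vadd E x y) \<le> reduce q a x + reduce q a y" if xy: "x \<in> carr E" "y \<in> carr E" for x y
  proof -
    have key: "reduce q a (vadd E x y) \<le> (q (?v x s) - s * q a) + (q (?v y t) - t * q a)"
      if st: "0 \<le> s" "0 \<le> t" for s t
    proof -
      have sa: "rs s a \<in> carr E" "rs t a \<in> carr E"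
        using a by (simp_all add: scale_closed)
      have "?v (vadd E x y) (s + t) = vadd E (vadd E x y) (vadd E (rs s a) (rs t a))"
        using a by (simp add: scale_add_left)
      also have "\<dots> = vadd E (?v x s) (?v y t)"
        using xy sa
        by (simp add: add_assoc add_closed) (metis add_assoc add_commute add_closed)
      finally have e: "?v (vadd E x y) (s + t) = vadd E (?v x s) (?v y t)" .
      have "reduce q a (vadd E x y) \<le> q (?v (vadd E x y) (s + t)) - (s + t) * q a"
        using xy st by (intro reduce_le q a add_closed) auto
      moreover have "q (vadd E (?v x s) (?v y t)) \<le> q (?v x s) + q (?v y t)"
        using q xy sa by (intro sublinearD add_closed)
      ultimately show ?thesis unfolding e by (simp add: algebra_simps)
    qed
    have "reduce q a (vadd E x y) - (q (?v x s) - s * q a) \<le> reduce q a y" if "0 \<le> s" for s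
    proof (rule le_reduce[OF xy(2)])
      fix t :: real assume "0 \<le> t"
      from key[OF that this]
      show "reduce q a (vadd E x y) - (q (?v x s) - s * q a) \<le> q (?v y t) - t * q a" by linarith
    qed
    then have "reduce q a (vadd E x y) - reduce q a y \<le> reduce q a x"
      using xy by (intro le_reduce) (force simp: algebra_simps)+
    then show ?thesis by simp
  qed
  show "reduce q a (rs c x) \<le> c * reduce q a x" if x: "x \<in> carr E" and c: "0 < c" for x c
  proof -
    have "reduce q a (rs c x) / c \<le> reduce q a x"
    proof (rule le_reduce[OF x])
      fix t :: real assume t: "0 \<le> t"
      have "reduce q a (rs c x) \<le> q (?v (rs c x) (c * t)) - (c * t) * q a"
        using x c t by (intro reduce_le q a scale_closed) auto
      also have "?v (rs c x) (c * t) = rs c (?v x t)"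
        using x a by (simp add: scale_add_right scale_scale scale_closed)
      also have "q \<dots> \<le> c * q (?v x t)"
        using x a c by (intro sublinearD[OF q] add_closed scale_closed)
      finally show "reduce q a (rs c x) / c \<le> q (?v x t) - t * q a"
        using c by (simp add: field_simps)
    qed
    then show ?thesis using c by (simp add: field_simps)
  qed
  show "reduce q a x \<le> vnorm E x" if "x \<in> carr E" for x
    using reduce_le_self[OF q a, of x] sublinearD(3)[OF q that] by simp
qed (simp add: reduce_def)

text \<open>Zorn's lemma for the reversed pointwise order, where a chain is bounded by its infimum.
  Subadditivity survives because two members of a chain are comparable, so the smaller one serves
  both arguments.\<close>

lemma exists_minimal_sublinear:
  assumes q0: "sublinear q0"
  obtains m where "sublinear m" "\<And>x. m x \<le> q0 x"
    "\<And>q. sublinear q \<Longrightarrow> (\<And>x. q x \<le> m x) \<Longrightarrow> q = m"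
proof -
  define S where "S = {q. sublinear q \<and> (\<forall>x. q x \<le> q0 x)}"
  define P :: "('a \<Rightarrow> real) \<Rightarrow> ('a \<Rightarrow> real) \<Rightarrow> bool" where "P f g \<longleftrightarrow> (\<forall>x. g x \<le> f x)" for f g
  have "\<exists>m\<in>S. \<forall>q\<in>S. P m q \<longrightarrow> q = m"
  proof (rule predicate_Zorn)
    show "partial_order_on S (relation_of P S)"
      by (auto simp: partial_order_on_def preorder_on_def refl_on_def trans_def antisym_def
          relation_of_def P_def fun_eq_iff intro: order_trans order_antisym)
    fix C assume "C \<in> Chains (relation_of P S)"
    then have CS: "C \<subseteq> S" and cmp: "\<And>f g. f \<in> C \<Longrightarrow> g \<in> C \<Longrightarrow> P f g \<or> P g f"
      by (auto simp: Chains_def relation_of_def)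
    show "\<exists>u\<in>S. \<forall>a\<in>C. P a u"
    proof (cases "C = {}")
      case True
      then show ?thesis using q0 by (auto simp: S_def)
    next
      case False
      then obtain q1 where q1: "q1 \<in> C" by blast
      have sub: "sublinear q" if "q \<in> C" for q using that CS by (auto simp: S_def)
      define u where "u x = (INF q\<in>C. q x)" for x
      have low: "u x \<le> q x" if "q \<in> C" for q x
      proof (cases "x \<in> carr E")
        case True
        then have "bdd_below ((\<lambda>q. q x) ` C)"
          using sublinear_ge[OF sub] by (intro bdd_belowI[of _ "- vnorm E x"]) auto
        then show ?thesis unfolding u_def using that by (rule cINF_lower)
      next
        case False
        then have "(\<lambda>q. q x) ` C = {0}" using q1 sublinearD(4)[OF sub] by force
        then show ?thesis using sublinearD(4)[OF sub[OF that] False] by (simp add: u_def)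
      qed
      have great: "b \<le> u x" if "\<And>q. q \<in> C \<Longrightarrow> b \<le> q x" for b x
        unfolding u_def using q1 that by (intro cINF_greatest) auto
      have "sublinear u"
        unfolding sublinear_def
      proof (intro conjI ballI allI impI)
        fix x y assume xy: "x \<in> carr E" "y \<in> carr E"
        have key: "u (vadd E x y) \<le> f x + g y" if fg: "f \<in> C" "g \<in> C" for f g
        proof -
          obtain q where q: "q \<in> C" "q x \<le> f x" "q y \<le> g y"
            using cmp[OF fg] fg unfolding P_def by (meson order_refl)
          then show ?thesis
            using low[OF q(1), of "vadd E x y"] sublinearD(1)[OF sub[OF q(1)] xy] by linarith
        qed
        have "u (vadd E x y) - f x \<le> u y" if "f \<in> C" for f
        proof (rule great)
          fix g assume "g \<in> C"
          from key[OF that this] show "u (vadd E x y) - f x \<le> g y" by linarith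
        qed
        then have "u (vadd E x y) - u y \<le> u x"
          by (intro great) (simp add: algebra_simps)
        then show "u (vadd E x y) \<le> u x + u y" by simp
      next
        fix x and t :: real assume x: "x \<in> carr E" and t: "0 < t"
        have "u (rs t x) / t \<le> u x"
        proof (rule great)
          fix q assume q: "q \<in> C"
          have "u (rs t x) \<le> t * q x"
            using low[OF q] sublinearD(2)[OF sub[OF q] x t] by (rule order_trans)
          then show "u (rs t x) / t \<le> q x" using t by (simp add: field_simps)
        qed
        then show "u (rs t x) \<le> t * u x" using t by (simp add: field_simps)
      next
        fix x assume "x \<in> carr E"
        then show "u x \<le> vnorm E x"
          using low[OF q1] sublinearD(3)[OF sub[OF q1]] order_trans by blast
      next
        fix x assume "x \<notin> carr E"
        then have "(\<lambda>q. q x) ` C = {0}" using q1 sublinearD(4)[OF sub] by force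
        then show "u x = 0" by (simp add: u_def)
      qed
      moreover have "u x \<le> q0 x" for x
        using low[OF q1] q1 CS by (auto simp: S_def intro: order_trans)
      ultimately show ?thesis using low by (auto simp: S_def P_def)
    qed
  qed
  then obtain m where "m \<in> S" "\<And>q. q \<in> S \<Longrightarrow> P m q \<Longrightarrow> q = m" by blast
  then show ?thesis
    by (intro that[of m]) (auto simp: S_def P_def intro: order_trans)
qed

text \<open>No extension from a subspace is made: a minimal sublinear functional m is already
  real-linear, and x \<mapsto> m(x) - i m(i x) is complex-linear. Starting below
  \<open>reduce q z\<close> instead of the norm forces m(-z) \<le> -||z||, so the value at z does
  not vanish.\<close>

lemma exists_functional:
  assumes z: "z \<in> carr E" "z \<noteq> vzero E"
  obtains \<eta> G where "functional \<eta> G" "0 < G" "\<eta> z = 1"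
proof -
  define q where "q x = (if x \<in> carr E then vnorm E x else 0)" for x
  have q: "sublinear q"
    by (auto simp: sublinear_def q_def add_closed scale_closed norm_triangle norm_scale)
  obtain m where m: "sublinear m" and mq: "\<And>x. m x \<le> reduce q z x"
    and min: "\<And>r. sublinear r \<Longrightarrow> (\<And>x. r x \<le> m x) \<Longrightarrow> r = m"
    using exists_minimal_sublinear[OF sublinear_reduce[OF q z(1)]] by blast
  have neg: "vneg x \<in> carr E" if "x \<in> carr E" for x using that by (rule scale_closed)
  have add: "m (vadd E x a) = m x + m a" if "x \<in> carr E" "a \<in> carr E" for x a
  proof -
    \<comment> \<open>Minimality makes m a fixed point of the reduction; its parameter t = 1 is the
      missing half of additivity.\<close>
    have "reduce m a = m"
      using that by (intro min sublinear_reduce[OF m] reduce_le_self[OF m])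
    then have "m x \<le> m (vadd E x a) - m a"
      using reduce_le[OF m that(2,1), of 1] that by (simp add: scale_one)
    then show ?thesis using sublinearD(1)[OF m that] by simp
  qed
  have m_neg: "m (vneg x) = - m x" if "x \<in> carr E" for x
    using add[OF that neg[OF that]] that by (simp add: add_neg sublinear_zero[OF m])
  have m_pos: "m (rs t x) = t * m x" if x: "x \<in> carr E" and t: "0 < t" for x t
  proof (rule order_antisym)
    show "m (rs t x) \<le> t * m x" using m x t by (rule sublinearD)
    have "m (rs (inverse t) (rs t x)) \<le> inverse t * m (rs t x)"
      using m x t by (intro sublinearD scale_closed) auto
    then show "t * m x \<le> m (rs t x)"
      using x t by (simp add: scale_scale scale_one field_simps flip: of_real_mult of_real_inverse)
  qed
  have m_scale: "m (rs t x) = t * m x" if x: "x \<in> carr E" for x t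
  proof -
    consider "t = 0" | "0 < t" | "t < 0" by linarith
    then show ?thesis
    proof cases
      case 3
      have "rs t x = vneg (rs (- t) x)"
        using x by (simp add: scale_scale)
      then show ?thesis using m_pos[OF x, of "- t"] 3 m_neg[OF scale_closed[OF x]] by simp
    qed (use x m in \<open>auto simp: scale_zero_left sublinear_zero m_pos\<close>)
  qed
  have m_complex: "m (vscale E c x) = Re c * m x + Im c * m (vscale E \<i> x)" if x: "x \<in> carr E" for c x
  proof -
    have "vscale E c x = vadd E (rs (Re c) x) (rs (Im c) (vscale E \<i> x))"
      using x scale_add_left[OF x, of "of_real (Re c)" "of_real (Im c) * \<i>"]
      by (simp add: scale_scale mult.commute complex_eq[symmetric])
    then show ?thesis using x by (simp add: add scale_closed m_scale)
  qed
  define \<eta> where "\<eta> x = (if x \<in> carr E then Complex (m x) (- m (vscale E \<i> x)) else 0)" for x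
  have "functional \<eta> 2"
    unfolding functional_def
  proof (intro conjI ballI allI impI)
    fix x assume x: "x \<in> carr E"
    show "\<eta> (vadd E x y) = \<eta> x + \<eta> y" if "y \<in> carr E" for y
      using x that by (simp add: \<eta>_def add_closed scale_closed scale_add_right add complex_eq_iff)
    show "\<eta> (vscale E c x) = c * \<eta> x" for c
      using x m_complex[OF x, of c] m_complex[OF x, of "\<i> * c"]
      by (simp add: \<eta>_def scale_closed scale_scale complex_eq_iff algebra_simps)
    have "\<bar>m y\<bar> \<le> vnorm E y" if "y \<in> carr E" for y
      using sublinear_ge[OF m that] sublinearD(3)[OF m that] by linarith
    from this[OF x] this[OF scale_closed[OF x], of \<i>]
    show "cmod (\<eta> x) \<le> 2 * vnorm E x"
      using x complex_Re_le_cmod cmod_le[of "\<eta> x"] by (simp add: \<eta>_def norm_scale)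
  qed (simp add: \<eta>_def)
  moreover have "\<eta> z \<noteq> 0"
  proof
    assume "\<eta> z = 0"
    then have "m z = 0" using z by (simp add: \<eta>_def complex_eq_iff)
    \<comment> \<open>The parameter 1 in the reduction at -z leaves the value of q at 0 minus
      q(z).\<close>
    moreover have "m (vneg z) \<le> - q z"
      using mq[of "vneg z"] reduce_le[OF q z(1) neg[OF z(1)], of 1] z
        add_neg[OF z(1)] add_commute[OF z(1) neg[OF z(1)]]
      by (simp add: scale_one sublinear_zero[OF q])
    ultimately have "vnorm E z \<le> 0" using m_neg[OF z(1)] z by (simp add: q_def)
    then show False using norm_eq_zero[OF z(1)] vnorm_nonneg[OF z(1)] z by simp
  qed
  ultimately have "functional (\<lambda>x. inverse (\<eta> z) * \<eta> x) (cmod (inverse (\<eta> z)) * 2)"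
      "0 < cmod (inverse (\<eta> z)) * 2" "inverse (\<eta> z) * \<eta> z = 1"
    using functional_cmult by auto
  then show ?thesis by (rule that)
qed

end

section \<open>Products of a power of a functional and a function of another functional\<close>

context poly_ideals
begin

definition block :: "('a \<Rightarrow> complex) \<Rightarrow> nat \<Rightarrow> ('a \<Rightarrow> complex) \<Rightarrow> (complex \<Rightarrow> complex) \<Rightarrow> 'a \<Rightarrow> complex" where
  "block \<gamma> m \<eta> \<phi> = on_carr E (\<lambda>x. \<gamma> x ^ m * \<phi> (\<eta> x))"

text \<open>Cauchy's estimates on the circle of radius 4Hs bound the terms by a geometric series.\<close>

lemma expansion_block:
  assumes \<gamma>: "functional \<gamma> G" "0 < G" and \<eta>: "functional \<eta> H" "0 < H"
    and \<phi>: "\<phi> holomorphic_on UNIV"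
  shows block_X: "block \<gamma> m \<eta> \<phi> \<in> X"
    and p_block: "0 < s \<Longrightarrow> (\<And>w. cmod w \<le> 4 * H * s \<Longrightarrow> cmod (\<phi> w) \<le> B) \<Longrightarrow>
      p s (block \<gamma> m \<eta> \<phi>) \<le> (2 * G * s) ^ m * (2 * B)"
proof -
  define a where "a k = (deriv ^^ k) \<phi> 0 / fact k" for k
  define Q where "Q k = on_carr E (\<lambda>x. \<gamma> x ^ m * \<eta> x ^ k)" for k
  define R where "R k = (if k < m then (\<lambda>x. 0) else (\<lambda>x. a (k - m) * Q (k - m) x))" for k
  have Q: "Q k \<in> A (m + k)" "nA (m + k) (Q k) \<le> (2 * G) ^ m * (2 * H) ^ k" for k
    unfolding Q_def by (rule monomial_in_A[OF \<gamma>(1) \<eta>(1) \<gamma>(2) \<eta>(2)])+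
  have RA: "R k \<in> A k" for k
    using Q(1)[of "k - m"] by (auto simp: R_def A.mem_zero intro!: A.mem_cmult)
  have a_le: "cmod (a k) \<le> B / (4 * H * s) ^ k"
    if s: "0 < s" and B: "\<And>w. cmod w \<le> 4 * H * s \<Longrightarrow> cmod (\<phi> w) \<le> B" for s B k
  proof -
    have "cmod ((deriv ^^ k) \<phi> 0) \<le> fact k * B / (4 * H * s) ^ k"
      using \<phi> s \<eta>(2) B
      by (intro Cauchy_inequality)
        (auto intro: holomorphic_on_subset holomorphic_on_imp_continuous_on)
    then show ?thesis by (simp add: a_def norm_divide field_simps)
  qed
  have R_le: "s ^ (m + k) * nA (m + k) (R (m + k)) \<le> (2 * G * s) ^ m * B * (1 / 2) ^ k"
    if s: "0 < s" and B: "\<And>w. cmod w \<le> 4 * H * s \<Longrightarrow> cmod (\<phi> w) \<le> B" for s B k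
  proof -
    have "0 \<le> cmod (\<phi> 0)" by simp
    also have "\<dots> \<le> B" using s \<eta>(2) by (intro B) simp
    finally have B0: "0 \<le> B" .
    have "nA (m + k) (R (m + k)) = cmod (a k) * nA (m + k) (Q k)"
      by (simp add: R_def A.N_cmult Q)
    also have "\<dots> \<le> (B / (4 * H * s) ^ k) * ((2 * G) ^ m * (2 * H) ^ k)"
      using s \<eta>(2) B0 by (intro mult_mono a_le[OF s B] Q(2) A.N_nonneg[OF Q(1)]) auto
    finally have "s ^ (m + k) * nA (m + k) (R (m + k))
        \<le> s ^ (m + k) * ((B / (4 * H * s) ^ k) * ((2 * G) ^ m * (2 * H) ^ k))"
      using s by (intro mult_left_mono) auto
    also have "\<dots> = (2 * G * s) ^ m * B * ((2 * H * s) ^ k / (4 * H * s) ^ k)"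
      by (simp add: power_add power_mult_distrib)
    \<comment> \<open>The ideal norm of the k-th power of \<open>\<eta>\<close> costs (2 H)^k, so
      the radius \<open>4 * H * s\<close> leaves the ratio 1/2.\<close>
    also have "(2 * H * s) ^ k / (4 * H * s) ^ k = (1 / 2) ^ k"
      unfolding power_divide[symmetric] using s \<eta>(2) by simp
    finally show ?thesis .
  qed
  have shift: "summable (\<lambda>k. s ^ k * nA k (R k)) \<and> (\<Sum>k. s ^ k * nA k (R k)) \<le> (2 * G * s) ^ m * (2 * B)"
    if s: "0 < s" and B: "\<And>w. cmod w \<le> 4 * H * s \<Longrightarrow> cmod (\<phi> w) \<le> B" for s B
  proof -
    let ?b = "\<lambda>k. s ^ (k + m) * nA (k + m) (R (k + m))"
    have geo: "(\<lambda>k. (2 * G * s) ^ m * B * (1 / 2) ^ k) sums ((2 * G * s) ^ m * B * (1 / (1 - 1 / 2)))"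
      by (intro sums_mult geometric_sums) simp
    have le: "?b k \<le> (2 * G * s) ^ m * B * (1 / 2) ^ k" for k
      using R_le[OF s B, of k] by (simp add: add.commute)
    have sb: "summable ?b"
    proof (rule summable_comparison_test'[OF sums_summable[OF geo], of 0])
      show "norm (?b k) \<le> (2 * G * s) ^ m * B * (1 / 2) ^ k" for k
        using le[of k] s A.N_nonneg[OF RA] by simp
    qed
    then have sm: "summable (\<lambda>k. s ^ k * nA k (R k))"
      by (rule summable_iff_shift[THEN iffD1])
    have "(\<Sum>k. s ^ k * nA k (R k)) = (\<Sum>k. ?b k) + (\<Sum>k<m. s ^ k * nA k (R k))"
      using suminf_split_initial_segment[OF sm, of m] by simp
    also have "(\<Sum>k<m. s ^ k * nA k (R k)) = 0"
      by (intro sum.neutral) (simp add: R_def A.N_zero)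
    also have "(\<Sum>k. ?b k) \<le> (2 * G * s) ^ m * B * (1 / (1 - 1 / 2))"
      using suminf_le[OF le sb sums_summable[OF geo]] sums_unique[OF geo] by simp
    finally show ?thesis using sm by (simp add: mult_ac)
  qed
  have ex: "expansion (block \<gamma> m \<eta> \<phi>) R"
    unfolding expansion_def
  proof (intro conjI allI ballI impI)
    show "R k \<in> A k" for k by (rule RA)
    show "block \<gamma> m \<eta> \<phi> x = 0" if "x \<notin> carr E" for x
      using that by (simp add: block_def on_carr_def)
    show "summable (\<lambda>k. s ^ k * nA k (R k))" if s: "0 < s" for s
    proof -
      have "compact (\<phi> ` cball 0 (4 * H * s))"
        using \<phi> by (intro compact_continuous_image)
          (auto intro: holomorphic_on_subset holomorphic_on_imp_continuous_on)
      then obtain B where "\<forall>w\<in>cball 0 (4 * H * s). cmod (\<phi> w) \<le> B"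
        using compact_imp_bounded bounded_iff by (metis (no_types, lifting) imageI)
      then show ?thesis using shift[OF s, of B] by simp
    qed
    fix x assume x: "x \<in> carr E"
    have "(\<lambda>k. a k * \<eta> x ^ k) sums \<phi> (\<eta> x)"
      unfolding a_def using holomorphic_power_series[of \<phi> 0 "cmod (\<eta> x) + 1" "\<eta> x"] \<phi>
      by (auto intro: holomorphic_on_subset)
    then have "(\<lambda>k. \<gamma> x ^ m * (a k * \<eta> x ^ k)) sums (\<gamma> x ^ m * \<phi> (\<eta> x))"
      by (rule sums_mult)
    then have "(\<lambda>k. R (k + m) x) sums block \<gamma> m \<eta> \<phi> x"
      using x by (simp add: R_def Q_def on_carr_def block_def mult_ac)
    then show "(\<lambda>k. R k x) sums block \<gamma> m \<eta> \<phi> x"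
      by (subst (asm) sums_zero_iff_shift) (auto simp: R_def)
  qed
  then show "block \<gamma> m \<eta> \<phi> \<in> X" by (auto simp: X_def)
  show "p s (block \<gamma> m \<eta> \<phi>) \<le> (2 * G * s) ^ m * (2 * B)"
    if "0 < s" "\<And>w. cmod w \<le> 4 * H * s \<Longrightarrow> cmod (\<phi> w) \<le> B"
    unfolding p_eq[OF ex] using shift[OF that] by blast
qed

text \<open>Expanding the power of \<open>\<gamma>\<close> keeps translates within finite sums of
  blocks; the other factor only moves its argument.\<close>

lemma translation_block:
  assumes \<gamma>: "functional \<gamma> G" and \<eta>: "functional \<eta> H" and a: "a \<in> carr E"
  shows "shift a (block \<gamma> m \<eta> \<phi>) =
    (\<lambda>x. \<Sum>i\<le>m. of_nat (m choose i) * \<gamma> a ^ (m - i) * block \<gamma> i \<eta> (\<lambda>w. \<phi> (w + \<eta> a)) x)"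
proof
  fix x
  show "shift a (block \<gamma> m \<eta> \<phi>) x =
    (\<Sum>i\<le>m. of_nat (m choose i) * \<gamma> a ^ (m - i) * block \<gamma> i \<eta> (\<lambda>w. \<phi> (w + \<eta> a)) x)"
    using a by (simp add: translation_def block_def on_carr_def add_closed functional_add[OF \<gamma>]
        functional_add[OF \<eta>] binomial_ring sum_distrib_left sum_distrib_right mult_ac)
qed

text \<open>The bounds of the blocks recombine by the binomial theorem: each factor
  \<open>\<gamma>\<close> contributes its value at a plus the cost \<open>2 * G * s\<close> of a
  monomial.\<close>

lemma p_translation_block:
  assumes \<gamma>: "functional \<gamma> G" "0 < G" and \<eta>: "functional \<eta> H" "0 < H"
    and \<phi>: "\<phi> holomorphic_on UNIV" and a: "a \<in> carr E"
  shows translation_block_X: "shift a (block \<gamma> m \<eta> \<phi>) \<in> X"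
    and "0 < s \<Longrightarrow> (\<And>w. cmod w \<le> 4 * H * s \<Longrightarrow> cmod (\<phi> (w + \<eta> a)) \<le> B) \<Longrightarrow>
      p s (shift a (block \<gamma> m \<eta> \<phi>)) \<le> (cmod (\<gamma> a) + 2 * G * s) ^ m * (2 * B)"
proof -
  let ?\<phi> = "\<lambda>w. \<phi> (w + \<eta> a)"
  have "?\<phi> holomorphic_on UNIV"
    using holomorphic_on_compose_gen[of "\<lambda>w. w + \<eta> a" UNIV \<phi> UNIV] \<phi>
    by (simp add: o_def holomorphic_intros)
  note b = block_X[OF \<gamma> \<eta> this] p_block[OF \<gamma> \<eta> this]
  show "shift a (block \<gamma> m \<eta> \<phi>) \<in> X"
    unfolding translation_block[OF \<gamma>(1) \<eta>(1) a] by (intro X_sum X_cmult b)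
  show "p s (shift a (block \<gamma> m \<eta> \<phi>)) \<le> (cmod (\<gamma> a) + 2 * G * s) ^ m * (2 * B)"
    if s: "0 < s" and B: "\<And>w. cmod w \<le> 4 * H * s \<Longrightarrow> cmod (\<phi> (w + \<eta> a)) \<le> B"
  proof -
    let ?c = "\<lambda>i. of_nat (m choose i) * \<gamma> a ^ (m - i)"
    have "p s (shift a (block \<gamma> m \<eta> \<phi>)) \<le> (\<Sum>i\<le>m. p s (\<lambda>x. ?c i * block \<gamma> i \<eta> ?\<phi> x))"
      unfolding translation_block[OF \<gamma>(1) \<eta>(1) a] using s by (intro p_sum X_cmult b)
    also have "\<dots> \<le> (\<Sum>i\<le>m. cmod (?c i) * ((2 * G * s) ^ i * (2 * B)))"
    proof (rule sum_mono)
      fix i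
      have "p s (\<lambda>x. ?c i * block \<gamma> i \<eta> ?\<phi> x) \<le> cmod (?c i) * p s (block \<gamma> i \<eta> ?\<phi>)"
        by (rule p_cmult_le[OF b(1) s])
      also have "\<dots> \<le> cmod (?c i) * ((2 * G * s) ^ i * (2 * B))"
        by (intro mult_left_mono b(2)[OF s B]) auto
      finally show "p s (\<lambda>x. ?c i * block \<gamma> i \<eta> ?\<phi> x) \<le> cmod (?c i) * ((2 * G * s) ^ i * (2 * B))" .
    qed
    also have "\<dots> = (\<Sum>i\<le>m. of_nat (m choose i) * (2 * G * s) ^ i * cmod (\<gamma> a) ^ (m - i)) * (2 * B)"
      by (simp add: sum_distrib_left sum_distrib_right norm_mult norm_power mult_ac)
    also have "(\<Sum>i\<le>m. of_nat (m choose i) * (2 * G * s) ^ i * cmod (\<gamma> a) ^ (m - i))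
        = (cmod (\<gamma> a) + 2 * G * s) ^ m"
      by (simp only: binomial_ring[symmetric] add.commute[of "cmod (\<gamma> a)"])
    finally show ?thesis .
  qed
qed

end

section \<open>Functions with rapidly decaying orbits\<close>

lemma norm_sin_cos_le:
  fixes w :: complex
  shows "cmod (sin w) \<le> exp \<bar>Im w\<bar>" "cmod (cos w) \<le> exp \<bar>Im w\<bar>"
proof -
  have e: "cmod (exp (\<i> * w)) \<le> exp \<bar>Im w\<bar>" "cmod (exp (- (\<i> * w))) \<le> exp \<bar>Im w\<bar>"
    by (simp_all add: norm_exp_eq_Re)
  have "cmod (sin w) = cmod (exp (\<i> * w) - exp (- (\<i> * w))) / 2"
    by (simp add: sin_exp_eq norm_divide norm_mult)
  also have "\<dots> \<le> (exp \<bar>Im w\<bar> + exp \<bar>Im w\<bar>) / 2"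
    using e by (intro divide_right_mono norm_triangle_le_diff add_mono) auto
  finally show "cmod (sin w) \<le> exp \<bar>Im w\<bar>" by simp
  have "cmod (cos w) = cmod (exp (\<i> * w) + exp (- (\<i> * w))) / 2"
    by (simp add: cos_exp_eq norm_divide)
  also have "\<dots> \<le> (exp \<bar>Im w\<bar> + exp \<bar>Im w\<bar>) / 2"
    using e by (intro divide_right_mono norm_triangle_le add_mono) auto
  finally show "cmod (cos w) \<le> exp \<bar>Im w\<bar>" by simp
qed

definition sinc :: "complex \<Rightarrow> complex" where
  "sinc w = (if w = 0 then 1 else sin w / w)"

lemma mult_sinc: "w * sinc w = sin w"
  by (simp add: sinc_def)

lemma holomorphic_sinc: "sinc holomorphic_on UNIV"
proof (rule pole_theorem_0[of sin _ 0])
  show "sinc 0 = deriv sin 0"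
    using DERIV_imp_deriv[OF DERIV_sin, of "0::complex"] by (simp add: sinc_def)
qed (auto simp: mult_sinc holomorphic_on_sin)

text \<open>Origin of the 6: inside the unit disc the derivative of the sine is at most e \<le> 3
  and 1 + |Re w| \<le> 2. Outside, 1 + |Re w| \<le> 2 |w|, so the same constant is ample.\<close>

lemma norm_sinc_le: "cmod (sinc w) \<le> 6 * exp \<bar>Im w\<bar> / (1 + \<bar>Re w\<bar>)"
proof (cases "cmod w < 1")
  case True
  have "cmod (sin w - sin 0) \<le> 3 * cmod (w - 0)"
  proof (rule field_differentiable_bound[of "cball 0 1" sin cos])
    fix z :: complex assume "z \<in> cball 0 1"
    then have "\<bar>Im z\<bar> \<le> 1" using abs_Im_le_cmod[of z] by simp
    then have "exp \<bar>Im z\<bar> \<le> exp 1" by simp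
    then show "cmod (cos z) \<le> 3" using norm_sin_cos_le(2)[of z] exp_le by linarith
  qed (use True in \<open>auto intro: DERIV_subset DERIV_sin\<close>)
  then have "cmod (sinc w) \<le> 3"
    by (simp add: sinc_def norm_divide field_simps)
  also have "\<dots> \<le> 6 / (1 + \<bar>Re w\<bar>)"
    using True abs_Re_le_cmod[of w] by (simp add: field_simps)
  also have "\<dots> \<le> 6 * exp \<bar>Im w\<bar> / (1 + \<bar>Re w\<bar>)"
    by (intro divide_right_mono) auto
  finally show ?thesis .
next
  case False
  then have w: "1 \<le> cmod w" "w \<noteq> 0" by auto
  have "cmod (sinc w) \<le> exp \<bar>Im w\<bar> / cmod w"
    using w norm_sin_cos_le(1)[of w] by (simp add: sinc_def norm_divide divide_right_mono)
  also have "\<dots> \<le> exp \<bar>Im w\<bar> / ((1 + \<bar>Re w\<bar>) / 6)"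
    using w abs_Re_le_cmod[of w] by (intro divide_left_mono mult_pos_pos) auto
  finally show ?thesis by (simp add: mult.commute)
qed

text \<open>An entire function of small exponential type which is close to the k-th power on bounded
  sets and decays on the real line.\<close>

definition damped_power :: "real \<Rightarrow> nat \<Rightarrow> complex \<Rightarrow> complex" where
  "damped_power \<delta> k w = w ^ k * sinc (of_real \<delta> * w) ^ (k + 4)"

lemma holomorphic_damped_power: "damped_power \<delta> k holomorphic_on UNIV"
proof -
  have "(\<lambda>w. sinc (of_real \<delta> * w)) holomorphic_on UNIV"
    using holomorphic_on_compose_gen[of "\<lambda>w. of_real \<delta> * w" UNIV sinc UNIV] holomorphic_sinc
    by (simp add: o_def holomorphic_intros)
  then show ?thesis unfolding damped_power_def by (intro holomorphic_intros)
qed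

text \<open>Of the k + 4 factors, k are paired with w^k to give powers of the sine divided by
  \<open>\<delta>\<close>, bounded on the real line; the other four provide the decay. The
  exponential type is that of k + 4 sines.\<close>

lemma damped_power_bound:
  assumes "0 < \<delta>" "\<delta> \<le> 1"
  shows "\<exists>C\<ge>0. \<forall>w. cmod (damped_power \<delta> k w)
           \<le> C * exp (real (k + 4) * \<delta> * \<bar>Im w\<bar>) / (1 + \<bar>Re w\<bar>) ^ 4"
proof (intro exI[of _ "(1 / \<delta>) ^ k * (6 / \<delta>) ^ 4"] conjI allI)
  fix w :: complex
  let ?u = "of_real \<delta> * w"
  have "damped_power \<delta> k w = (w * sinc ?u) ^ k * sinc ?u ^ 4"
    by (simp add: damped_power_def power_add power_mult_distrib)
  also have "w * sinc ?u = sin ?u / of_real \<delta>"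
    using assms mult_sinc[of ?u] by (simp add: field_simps)
  finally have "cmod (damped_power \<delta> k w) = (cmod (sin ?u) / \<delta>) ^ k * cmod (sinc ?u) ^ 4"
    using assms by (simp add: norm_mult norm_power norm_divide)
  also have "\<dots> \<le> (exp \<bar>Im ?u\<bar> / \<delta>) ^ k * ((6 / \<delta>) * exp \<bar>Im ?u\<bar> / (1 + \<bar>Re w\<bar>)) ^ 4"
  proof (intro mult_mono power_mono divide_right_mono)
    show "cmod (sin ?u) \<le> exp \<bar>Im ?u\<bar>" by (rule norm_sin_cos_le)
    have "cmod (sinc ?u) \<le> 6 * exp \<bar>Im ?u\<bar> / (1 + \<bar>Re ?u\<bar>)" by (rule norm_sinc_le)
    \<comment> \<open>\<open>\<delta> \<le> 1\<close> enters here: \<delta> (1 + |Re w|) \<le> 1 +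
      \<delta> |Re w|.\<close>
    also have "\<dots> \<le> 6 * exp \<bar>Im ?u\<bar> / (\<delta> * (1 + \<bar>Re w\<bar>))"
      using assms by (intro divide_left_mono mult_pos_pos) (auto simp: algebra_simps abs_mult add_pos_nonneg)
    finally show "cmod (sinc ?u) \<le> (6 / \<delta>) * exp \<bar>Im ?u\<bar> / (1 + \<bar>Re w\<bar>)" by simp
  qed (use assms in auto)
  also have "\<dots> = (1 / \<delta>) ^ k * (6 / \<delta>) ^ 4 * exp \<bar>Im ?u\<bar> ^ (k + 4) / (1 + \<bar>Re w\<bar>) ^ 4"
    by (simp add: power_divide power_mult_distrib power_add mult_ac)
  also have "exp \<bar>Im ?u\<bar> ^ (k + 4) = exp (real (k + 4) * \<delta> * \<bar>Im w\<bar>)"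
    using assms by (simp only: exp_of_nat_mult[symmetric]) (simp add: abs_mult)
  finally show "cmod (damped_power \<delta> k w) \<le> (1 / \<delta>) ^ k * (6 / \<delta>) ^ 4 *
      exp (real (k + 4) * \<delta> * \<bar>Im w\<bar>) / (1 + \<bar>Re w\<bar>) ^ 4" .
qed (use assms in auto)

text \<open>\<open>sinc\<close> is continuous with value 1 at 0, so a small \<open>\<delta>\<close>
  makes the damping factor almost 1 on the given disc. The cap \<open>\<kappa>\<close> will limit
  the exponential type.\<close>

lemma damped_power_approx:
  assumes "0 < e" "0 < \<kappa>"
  shows "\<exists>\<delta>>0. \<delta> \<le> \<kappa> \<and> (\<forall>w. cmod w \<le> r \<longrightarrow> cmod (damped_power \<delta> k w - w ^ k) \<le> e)"
proof -
  define e' where "e' = e / (\<bar>r\<bar> + 1) ^ k"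
  have e': "0 < e'" using assms by (simp add: e'_def)
  have "isCont (\<lambda>u. sinc u ^ (k + 4)) 0"
    using holomorphic_on_imp_continuous_on[OF holomorphic_sinc]
    by (intro continuous_intros) (simp add: continuous_on_eq_continuous_at)
  then have "\<exists>d>0. \<forall>u. dist u 0 < d \<longrightarrow> dist (sinc u ^ (k + 4)) (sinc 0 ^ (k + 4)) < e'"
    using e' by (simp only: continuous_at_eps_delta)
  then obtain d where d: "0 < d" "\<And>u. cmod u < d \<Longrightarrow> cmod (sinc u ^ (k + 4) - 1) < e'"
    by (auto simp: dist_norm sinc_def)
  define \<delta> where "\<delta> = min \<kappa> (d / (\<bar>r\<bar> + 1) / 2)"
  have \<delta>: "0 < \<delta>" "\<delta> \<le> \<kappa>" "\<delta> * (\<bar>r\<bar> + 1) < d"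
  proof -
    show "0 < \<delta>" "\<delta> \<le> \<kappa>" using d assms by (auto simp: \<delta>_def)
    have "\<delta> * (\<bar>r\<bar> + 1) \<le> (d / (\<bar>r\<bar> + 1) / 2) * (\<bar>r\<bar> + 1)"
      by (intro mult_right_mono) (auto simp: \<delta>_def)
    also have "\<dots> = d / 2"
    proof -
      have "\<bar>r\<bar> + 1 \<noteq> 0" by linarith
      then show ?thesis by (simp only: divide_divide_eq_left times_divide_eq_left mult.commute[of _ "2::real"]
        mult_divide_mult_cancel_right not_False_eq_True)
    qed
    also have "\<dots> < d" using d(1) by simp
    finally show "\<delta> * (\<bar>r\<bar> + 1) < d" .
  qed
  have "cmod (damped_power \<delta> k w - w ^ k) \<le> e" if w: "cmod w \<le> r" for w
  proof -
    have "cmod (of_real \<delta> * w) \<le> \<delta> * (\<bar>r\<bar> + 1)"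
      using w \<delta> by (simp add: norm_mult)
    then have s: "cmod (sinc (of_real \<delta> * w) ^ (k + 4) - 1) < e'" using \<delta> by (intro d) simp
    have "damped_power \<delta> k w - w ^ k = w ^ k * (sinc (of_real \<delta> * w) ^ (k + 4) - 1)"
      by (simp add: damped_power_def algebra_simps)
    then have "cmod (damped_power \<delta> k w - w ^ k) = cmod w ^ k * cmod (sinc (of_real \<delta> * w) ^ (k + 4) - 1)"
      by (simp only: norm_mult norm_power)
    also have "\<dots> \<le> (\<bar>r\<bar> + 1) ^ k * e'"
      using w s by (intro mult_mono power_mono) auto
    also have "\<dots> = e" by (simp add: e'_def)
    finally show ?thesis .
  qed
  then show ?thesis using \<delta> by blast
qed

text \<open>Absorbs polynomial factors into a fraction of the exponential type: take the m-th power
  of 1 + d t \<le> exp(d t) with m d at most \<open>\<delta>\<close>.\<close>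

lemma power_le_exp:
  fixes \<delta> :: real
  assumes "0 < \<delta>"
  obtains C where "0 < C" "\<And>t. 0 \<le> t \<Longrightarrow> (1 + t) ^ m \<le> C * exp (\<delta> * t)"
proof -
  define d where "d = min 1 (\<delta> / (real m + 1))"
  have d: "0 < d" "d \<le> 1" "real m * d \<le> \<delta>"
  proof -
    show "0 < d" "d \<le> 1" using assms by (auto simp: d_def)
    have "real m * d \<le> real m * (\<delta> / (real m + 1))" by (intro mult_left_mono) (auto simp: d_def)
    also have "\<dots> \<le> \<delta>" using assms by (simp add: field_simps)
    finally show "real m * d \<le> \<delta>" .
  qed
  have "(1 + t) ^ m \<le> (1 / d) ^ m * exp (\<delta> * t)" if t: "0 \<le> t" for t
  proof -
    have "d * (1 + t) \<le> 1 + d * t" using d by (simp add: algebra_simps)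
    also have "\<dots> \<le> exp (d * t)" by (rule exp_ge_add_one_self)
    finally have "1 + t \<le> (1 / d) * exp (d * t)" using d by (simp add: field_simps)
    then have "(1 + t) ^ m \<le> ((1 / d) * exp (d * t)) ^ m" using t by (intro power_mono) auto
    also have "\<dots> = (1 / d) ^ m * exp (real m * d * t)"
      by (simp only: power_mult_distrib exp_of_nat_mult[symmetric] mult.assoc)
    also have "\<dots> \<le> (1 / d) ^ m * exp (\<delta> * t)"
      using d t by (intro mult_left_mono) (auto intro: mult_right_mono)
    finally show ?thesis .
  qed
  then show ?thesis using d by (intro that[of "(1 / d) ^ m"]) auto
qed

text \<open>The exponent 4 is spent as follows in the construction of the hypercyclic function: one
  power pays for constants growing linearly with the index, one makes the interference at a visit of
  index l of order 1/(l + 1), and two make the sum over all visits converge.\<close>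

abbreviation wt :: "int \<Rightarrow> real" where "wt n \<equiv> (1 + \<bar>of_int n\<bar>) ^ 4"

text \<open>An inequality of Peetre type: moving the centre of the weight costs only a polynomial in
  u, uniformly in n.\<close>

lemma shift_weight:
  fixes u :: real and n :: int
  shows "1 / (1 + \<bar>u + of_int n\<bar>) ^ 4 \<le> (1 + \<bar>u\<bar>) ^ 4 / wt n"
proof -
  have "1 + \<bar>of_int n :: real\<bar> \<le> (1 + \<bar>u\<bar>) * (1 + \<bar>u + of_int n\<bar>)"
  proof -
    have "\<bar>of_int n :: real\<bar> \<le> \<bar>u\<bar> + \<bar>u + of_int n\<bar>" by linarith
    moreover have "0 \<le> \<bar>u\<bar> * \<bar>u + of_int n\<bar>" by simp
    ultimately show ?thesis unfolding distrib_left distrib_right by linarith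
  qed
  then have le: "(1 + \<bar>of_int n :: real\<bar>) ^ 4 \<le> (1 + \<bar>u\<bar>) ^ 4 * (1 + \<bar>u + of_int n\<bar>) ^ 4"
    unfolding power_mult_distrib[symmetric] by (intro power_mono) auto
  have pos: "0 < (1 + \<bar>u + of_int n\<bar>) ^ 4" "0 < (1 + \<bar>of_int n :: real\<bar>) ^ 4"
    by (simp_all add: add_pos_nonneg)
  show ?thesis
    unfolding pos_divide_le_eq[OF pos(1)] times_divide_eq_left pos_le_divide_eq[OF pos(2)]
    using le by simp
qed

section \<open>Orbits under translation by multiples of \<open>z0\<close>\<close>

locale translation_setting = poly_ideals +
  fixes \<eta> :: "'a \<Rightarrow> complex" and H :: real
  assumes \<eta>: "functional \<eta> H" and H: "0 < H" and \<eta>_z0: "\<eta> z0 = 1"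
begin

definition tr :: "int \<Rightarrow> 'a \<Rightarrow> 'a" where
  "tr n a = vadd E a (vscale E (of_int n) z0)"

abbreviation tn :: "int \<Rightarrow> 'a \<Rightarrow> ('a \<Rightarrow> complex) \<Rightarrow> 'a \<Rightarrow> complex" where
  "tn n a \<equiv> shift (tr n a)"

lemma tr_closed: "a \<in> carr E \<Longrightarrow> tr n a \<in> carr E"
  by (simp add: tr_def add_closed scale_closed z0)

lemma tr_0: "a \<in> carr E \<Longrightarrow> tr 0 a = a"
  by (simp add: tr_def scale_zero_left z0 add_zero_right)

lemma functional_tr: "functional \<gamma> G \<Longrightarrow> a \<in> carr E \<Longrightarrow> \<gamma> (tr n a) = \<gamma> a + of_int n * \<gamma> z0"
  by (simp add: tr_def functional_add functional_scale scale_closed z0)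

text \<open>Negative n are included because f will be a sum of backward translates. The
  \<open>B r\<close> control the seminorms of translates that are also displaced by an arbitrary
  vector a; C controls the pointwise growth, of type \<open>\<epsilon>\<close> uniformly along the
  orbit.\<close>

definition decay_with :: "real \<Rightarrow> ('a \<Rightarrow> complex) \<Rightarrow> (real \<Rightarrow> real) \<Rightarrow> real \<Rightarrow> bool" where
  "decay_with \<epsilon> x B C \<longleftrightarrow> (\<forall>z. z \<notin> carr E \<longrightarrow> x z = 0) \<and>
     (\<forall>r>0. \<forall>n. \<forall>a\<in>carr E. vnorm E a \<le> r \<longrightarrow> tn n a x \<in> X \<and>
        p r (tn n a x) \<le> B r / wt n) \<and>
     (\<forall>n. \<forall>z\<in>carr E. cmod (x (tr n z)) \<le> C * exp (\<epsilon> * vnorm E z) / wt n)"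

definition decay :: "real \<Rightarrow> ('a \<Rightarrow> complex) \<Rightarrow> bool" where
  "decay \<epsilon> x \<longleftrightarrow> (\<exists>B C. decay_with \<epsilon> x B C)"

lemma decay_X: "decay \<epsilon> x \<Longrightarrow> x \<in> X"
  unfolding decay_def decay_with_def
  using translation_zero[of x] zero_closed tr_0[of "vzero E"] vnorm_zero by (metis zero_le_one zero_less_one)

lemma decay_zero: "decay_with \<epsilon> (\<lambda>x. 0) (\<lambda>r. 0) 0"
proof -
  have "shift a (\<lambda>x. 0) = (\<lambda>x. 0)" for a
    by (simp add: translation_def on_carr_def)
  then show ?thesis by (simp add: decay_with_def X_zero p_zero)
qed

lemma decay_lincomb:
  assumes x: "decay \<epsilon> x" and y: "decay \<epsilon> y"
  shows "decay \<epsilon> (\<lambda>z. x z + c * y z)"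
proof -
  obtain B C B' C' where x: "decay_with \<epsilon> x B C" and y: "decay_with \<epsilon> y B' C'"
    using assms by (auto simp: decay_def)
  have t: "shift a (\<lambda>z. x z + c * y z) = (\<lambda>z. shift a x z + c * shift a y z)" for a
    by (auto simp: translation_def on_carr_def)
  have "decay_with \<epsilon> (\<lambda>z. x z + c * y z) (\<lambda>r. B r + cmod c * B' r) (C + cmod c * C')"
    unfolding decay_with_def t
  proof (intro conjI allI ballI impI)
    fix r :: real and n a assume ra: "0 < r" "a \<in> carr E" "vnorm E a \<le> r"
    have X: "tn n a x \<in> X" "tn n a y \<in> X"
      using x y ra by (auto simp: decay_with_def)
    then show "(\<lambda>z. tn n a x z + c * tn n a y z) \<in> X"
      by (rule X_lincomb)
    have "p r (\<lambda>z. tn n a x z + c * tn n a y z)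
        \<le> p r (tn n a x) + cmod c * p r (tn n a y)"
      using X ra(1) by (rule p_lincomb)
    also have "\<dots> \<le> B r / wt n + cmod c * (B' r / wt n)"
      using x y ra by (intro add_mono mult_left_mono) (auto simp: decay_with_def)
    finally show "p r (\<lambda>z. tn n a x z + c * tn n a y z)
        \<le> (B r + cmod c * B' r) / wt n"
      by (simp add: add_divide_distrib)
  next
    fix n z assume z: "z \<in> carr E"
    have "cmod (x (tr n z) + c * y (tr n z)) \<le> cmod (x (tr n z)) + cmod c * cmod (y (tr n z))"
      by (metis norm_mult norm_triangle_ineq)
    also have "\<dots> \<le> C * exp (\<epsilon> * vnorm E z) / wt n
        + cmod c * (C' * exp (\<epsilon> * vnorm E z) / wt n)"
      using x y z by (intro add_mono mult_left_mono) (auto simp: decay_with_def)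
    finally show "cmod (x (tr n z) + c * y (tr n z))
        \<le> (C + cmod c * C') * exp (\<epsilon> * vnorm E z) / wt n"
      by (simp add: add_divide_distrib algebra_simps)
  qed (use x y in \<open>auto simp: decay_with_def\<close>)
  then show ?thesis by (auto simp: decay_def)
qed

text \<open>As \<open>\<gamma> z0 = 0\<close>, translation by n \<open>z0\<close> leaves the power
  of \<open>\<gamma>\<close> alone and moves the argument of \<open>\<phi>\<close> by the real
  number n, along which \<open>\<phi>\<close> decays. Half of \<open>\<epsilon>\<close> is used by
  \<open>\<phi>\<close>; the other half absorbs the polynomial factors from the power and the
  weight.\<close>

lemma decay_block:
  assumes \<gamma>: "functional \<gamma> G" "0 < G" "\<gamma> z0 = 0"
    and \<phi>: "\<phi> holomorphic_on UNIV"
    and C: "0 \<le> C" "\<And>w. cmod (\<phi> w) \<le> C * exp (\<kappa> * \<bar>Im w\<bar>) / (1 + \<bar>Re w\<bar>) ^ 4"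
    and \<kappa>: "0 \<le> \<kappa>" "\<kappa> * H \<le> \<epsilon> / 2" and \<epsilon>: "0 < \<epsilon>"
  shows "decay \<epsilon> (block \<gamma> m \<eta> \<phi>)"
proof -
  have shifted: "cmod (\<phi> (w + of_int n)) \<le> C * exp (\<kappa> * \<rho>) * (1 + \<rho>) ^ 4 / wt n"
    if w: "cmod w \<le> \<rho>" for w \<rho> and n :: int
  proof -
    have "\<bar>Im w\<bar> \<le> \<rho>" "\<bar>Re w\<bar> \<le> \<rho>"
      using w abs_Im_le_cmod[of w] abs_Re_le_cmod[of w] by linarith+
    have "cmod (\<phi> (w + of_int n)) \<le> C * exp (\<kappa> * \<bar>Im w\<bar>) * (1 / (1 + \<bar>Re w + of_int n\<bar>) ^ 4)"
      using C(2)[of "w + of_int n"] by simp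
    also have "\<dots> \<le> C * exp (\<kappa> * \<rho>) * ((1 + \<bar>Re w\<bar>) ^ 4 / wt n)"
      using \<open>\<bar>Im w\<bar> \<le> \<rho>\<close> C(1) \<kappa>(1)
      by (intro mult_mono shift_weight mult_left_mono) (auto intro: mult_left_mono)
    also have "\<dots> \<le> C * exp (\<kappa> * \<rho>) * ((1 + \<rho>) ^ 4 / wt n)"
      using \<open>\<bar>Re w\<bar> \<le> \<rho>\<close> C(1) by (intro mult_left_mono divide_right_mono power_mono) auto
    finally show ?thesis by simp
  qed
  obtain K where K: "0 < K" "\<And>t. 0 \<le> t \<Longrightarrow> (1 + t) ^ (m + 4) \<le> K * exp (\<epsilon> / 2 * t)"
    using power_le_exp[of "\<epsilon> / 2" "m + 4"] \<epsilon> by auto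
  \<comment> \<open>5 H r is the radius 4 H r of \<open>p_translation_block\<close> plus the bound H
    r for \<open>\<eta> a\<close>; likewise 3 G r is 2 G r plus the bound for
    \<open>\<gamma> a\<close>.\<close>
  define B where "B r = (3 * G * r) ^ m * (2 * (C * exp (\<kappa> * (5 * H * r)) * (1 + 5 * H * r) ^ 4))" for r
  have "decay_with \<epsilon> (block \<gamma> m \<eta> \<phi>) B (C * (1 + G) ^ m * (1 + H) ^ 4 * K)"
    unfolding decay_with_def
  proof (intro conjI allI ballI impI)
    fix r :: real and n a assume ra: "0 < r" "a \<in> carr E" "vnorm E a \<le> r"
    note T = p_translation_block[OF \<gamma>(1,2) \<eta> H \<phi> tr_closed[OF ra(2), of n], where m = m]
    show "tn n a (block \<gamma> m \<eta> \<phi>) \<in> X" by (rule T)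
    have \<gamma>a: "cmod (\<gamma> (tr n a)) \<le> G * r"
      using order_trans[OF functional_le[OF \<gamma>(1) ra(2)] mult_left_mono[OF ra(3)]] \<gamma>(2)
      by (simp add: functional_tr[OF \<gamma>(1) ra(2)] \<gamma>(3))
    have \<eta>a: "cmod (\<eta> a) \<le> H * r"
      using order_trans[OF functional_le[OF \<eta> ra(2)] mult_left_mono[OF ra(3)]] H by simp
    define b where "b = C * exp (\<kappa> * (5 * H * r)) * (1 + 5 * H * r) ^ 4 / wt n"
    have b0: "0 \<le> b" using C H ra by (simp add: b_def)
    have "cmod (\<phi> (w + \<eta> (tr n a))) \<le> b" if "cmod w \<le> 4 * H * r" for w
    proof -
      have "cmod (w + \<eta> a) \<le> 5 * H * r"
        using that \<eta>a norm_triangle_ineq[of w "\<eta> a"] by simp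
      from shifted[OF this, of n] show ?thesis
        by (simp add: b_def functional_tr[OF \<eta> ra(2)] \<eta>_z0 add.assoc)
    qed
    then have "p r (tn n a (block \<gamma> m \<eta> \<phi>))
        \<le> (cmod (\<gamma> (tr n a)) + 2 * G * r) ^ m * (2 * b)"
      by (rule T(2)[OF ra(1)])
    also have "\<dots> \<le> (3 * G * r) ^ m * (2 * b)"
      using \<gamma>a b0 \<gamma>(2) ra by (intro mult_right_mono power_mono) auto
    also have "\<dots> = B r / wt n" by (simp add: B_def b_def)
    finally show "p r (tn n a (block \<gamma> m \<eta> \<phi>)) \<le> B r / wt n" .
  next
    fix n z assume z: "z \<in> carr E"
    define t where "t = vnorm E z"
    have t: "0 \<le> t" using vnorm_nonneg[OF z] by (simp add: t_def)
    have \<gamma>z: "cmod (\<gamma> z) \<le> G * t" and \<eta>z: "cmod (\<eta> z) \<le> H * t"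
      using functional_le[OF \<gamma>(1) z] functional_le[OF \<eta> z] by (simp_all add: t_def)
    have "cmod (block \<gamma> m \<eta> \<phi> (tr n z)) = cmod (\<gamma> z) ^ m * cmod (\<phi> (\<eta> z + of_int n))"
      using z by (simp add: block_def on_carr_def tr_closed functional_tr[OF \<gamma>(1) z]
          functional_tr[OF \<eta> z] \<eta>_z0 \<gamma>(3) norm_mult norm_power)
    also have "\<dots> \<le> (G * t) ^ m * (C * exp (\<kappa> * (H * t)) * (1 + H * t) ^ 4 / wt n)"
      using \<gamma>z \<gamma>(2) t by (intro mult_mono power_mono shifted[OF \<eta>z]) auto
    also have "\<dots> = C * ((G * t) ^ m * (1 + H * t) ^ 4) * exp (\<kappa> * (H * t)) / wt n"
      by simp
    also have "\<dots> \<le> C * (((1 + G) * (1 + t)) ^ m * ((1 + H) * (1 + t)) ^ 4) * exp (\<epsilon> / 2 * t) / wt n"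
    proof (intro divide_right_mono mult_mono mult_left_mono power_mono)
      show "exp (\<kappa> * (H * t)) \<le> exp (\<epsilon> / 2 * t)"
        using mult_right_mono[OF \<kappa>(2) t] by (simp add: mult.assoc)
    qed (use C H \<gamma>(2) t in \<open>auto simp: algebra_simps\<close>)
    also have "\<dots> = C * (1 + G) ^ m * (1 + H) ^ 4 * (1 + t) ^ (m + 4) * exp (\<epsilon> / 2 * t) / wt n"
      by (simp add: power_mult_distrib power_add)
    also have "\<dots> \<le> C * (1 + G) ^ m * (1 + H) ^ 4 * (K * exp (\<epsilon> / 2 * t)) * exp (\<epsilon> / 2 * t) / wt n"
      using C H \<gamma>(2) by (intro divide_right_mono mult_right_mono mult_left_mono K(2)[OF t]) auto
    also have "\<dots> = C * (1 + G) ^ m * (1 + H) ^ 4 * K * exp (\<epsilon> / 2 * t + \<epsilon> / 2 * t) / wt n"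
      by (simp only: exp_add mult.assoc)
    finally show "cmod (block \<gamma> m \<eta> \<phi> (tr n z))
        \<le> C * (1 + G) ^ m * (1 + H) ^ 4 * K * exp (\<epsilon> * vnorm E z) / wt n"
      by (simp add: t_def)
  qed (simp add: block_def on_carr_def)
  then show ?thesis by (auto simp: decay_def)
qed

section \<open>Approximation by functions with decaying orbits\<close>

definition approximable :: "real \<Rightarrow> ('a \<Rightarrow> complex) \<Rightarrow> bool" where
  "approximable \<epsilon> g \<longleftrightarrow> g \<in> X \<and> (\<forall>s>0. \<forall>e>0. \<exists>x. decay \<epsilon> x \<and> p s (\<lambda>z. x z - g z) < e)"

lemma approximable_lincomb:
  assumes f: "approximable \<epsilon> f" and g: "approximable \<epsilon> g"
  shows "approximable \<epsilon> (\<lambda>z. f z + c * g z)"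
  unfolding approximable_def
proof (intro conjI allI impI)
  show "(\<lambda>z. f z + c * g z) \<in> X" using f g by (intro X_lincomb) (auto simp: approximable_def)
  fix s e :: real assume s: "0 < s" and e: "0 < e"
  have "0 < e / (2 * (cmod c + 1))" using e by (simp add: add_nonneg_pos)
  then obtain x y where x: "decay \<epsilon> x" "p s (\<lambda>z. x z - f z) < e / 2"
    and y: "decay \<epsilon> y" "p s (\<lambda>z. y z - g z) < e / (2 * (cmod c + 1))"
    using f g s half_gt_zero[OF e] unfolding approximable_def by blast
  have "p s (\<lambda>z. (x z - f z) + c * (y z - g z)) \<le> p s (\<lambda>z. x z - f z) + cmod c * p s (\<lambda>z. y z - g z)"
    using f g s decay_X[OF x(1)] decay_X[OF y(1)]
    by (intro p_lincomb X_diff) (auto simp: approximable_def)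
  also have "\<dots> < e / 2 + e / 2"
  proof (intro add_less_le_mono x)
    have "cmod c * p s (\<lambda>z. y z - g z) \<le> cmod c * (e / (2 * (cmod c + 1)))"
      using y by (intro mult_left_mono) auto
    also have "\<dots> = e / 2 * (cmod c / (cmod c + 1))" by simp
    also have "\<dots> \<le> e / 2"
      using e by (intro mult_left_le) (auto simp: divide_le_eq add_nonneg_pos)
    finally show "cmod c * p s (\<lambda>z. y z - g z) \<le> e / 2" .
  qed
  finally have "p s (\<lambda>z. (x z + c * y z) - (f z + c * g z)) < e"
    by (simp add: algebra_simps)
  then show "\<exists>x. decay \<epsilon> x \<and> p s (\<lambda>z. x z - (f z + c * g z)) < e"
    using decay_lincomb[OF x(1) y(1)] by blast
qed

lemma approximable_zero: "approximable \<epsilon> (\<lambda>z. 0)"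
  unfolding approximable_def using decay_zero by (auto simp: X_zero decay_def p_zero intro!: exI[of _ "\<lambda>x. 0"])

lemma approximable_add: "approximable \<epsilon> f \<Longrightarrow> approximable \<epsilon> g \<Longrightarrow> approximable \<epsilon> (\<lambda>z. f z + g z)"
  using approximable_lincomb[of \<epsilon> f g 1] by simp

lemma approximable_cmult: "approximable \<epsilon> g \<Longrightarrow> approximable \<epsilon> (\<lambda>z. c * g z)"
  using approximable_lincomb[OF approximable_zero, of \<epsilon> g c] by simp

lemma approximable_sum:
  "(\<And>i. i \<in> I \<Longrightarrow> approximable \<epsilon> (f i)) \<Longrightarrow> approximable \<epsilon> (\<lambda>z. \<Sum>i\<in>I. f i z)"
  by (induction I rule: infinite_finite_induct) (auto simp: approximable_zero approximable_add)

lemma approximable_block: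
  assumes \<gamma>: "functional \<gamma> G" "0 < G" "\<gamma> z0 = 0" and \<epsilon>: "0 < \<epsilon>"
  shows "approximable \<epsilon> (block \<gamma> i \<eta> (\<lambda>w. w ^ k))"
  unfolding approximable_def
proof (intro conjI allI impI)
  show X: "block \<gamma> i \<eta> (\<lambda>w. w ^ k) \<in> X"
    by (intro block_X[OF \<gamma>(1,2) \<eta> H] holomorphic_intros)
  fix s e :: real assume s: "0 < s" and e: "0 < e"
  \<comment> \<open>\<open>p_block\<close> yields twice the sup bound, and a further factor 2 makes
    the inequality strict.\<close>
  define e' where "e' = e / (4 * (2 * G * s) ^ i)"
  have e': "0 < e'" using \<gamma> s e by (simp add: e'_def)
  \<comment> \<open>The first cap is required by \<open>damped_power_bound\<close>; the second gives
    type (k + 4) \<delta> H \<le> \<epsilon>/2, as \<open>decay_block\<close> demands.\<close>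
  define \<kappa> where "\<kappa> = min 1 (\<epsilon> / (2 * H * real (k + 4)))"
  have \<kappa>: "0 < \<kappa>" "\<kappa> \<le> 1" using \<epsilon> H by (auto simp: \<kappa>_def)
  obtain \<delta> where \<delta>: "0 < \<delta>" "\<delta> \<le> \<kappa>"
    and ap: "\<And>w. cmod w \<le> 4 * H * s \<Longrightarrow> cmod (damped_power \<delta> k w - w ^ k) \<le> e'"
    using damped_power_approx[OF e' \<kappa>(1), of "4 * H * s" k] by blast
  let ?x = "block \<gamma> i \<eta> (damped_power \<delta> k)"
  obtain C where C: "0 \<le> C" "\<And>w. cmod (damped_power \<delta> k w)
           \<le> C * exp (real (k + 4) * \<delta> * \<bar>Im w\<bar>) / (1 + \<bar>Re w\<bar>) ^ 4"
    using damped_power_bound[of \<delta> k] \<delta> \<kappa> by auto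
  have "real (k + 4) * \<delta> * H \<le> real (k + 4) * (\<epsilon> / (2 * H * real (k + 4))) * H"
    using \<delta>(2) H by (intro mult_right_mono mult_left_mono) (auto simp: \<kappa>_def)
  also have "\<dots> = \<epsilon> / 2" using H by simp
  finally have "decay \<epsilon> ?x"
    using \<delta>(1) \<epsilon> by (intro decay_block[OF \<gamma> holomorphic_damped_power C]) auto
  moreover have "(\<lambda>z. ?x z - block \<gamma> i \<eta> (\<lambda>w. w ^ k) z) = block \<gamma> i \<eta> (\<lambda>w. damped_power \<delta> k w - w ^ k)"
    by (auto simp: block_def on_carr_def algebra_simps)
  moreover have "p s (block \<gamma> i \<eta> (\<lambda>w. damped_power \<delta> k w - w ^ k)) \<le> (2 * G * s) ^ i * (2 * e')"
    by (rule p_block[OF \<gamma>(1,2) \<eta> H _ s ap]) (intro holomorphic_intros holomorphic_damped_power)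
  moreover have "(2 * G * s) ^ i * (2 * e') < e"
    using \<gamma> s e by (simp add: e'_def)
  ultimately show "\<exists>x. decay \<epsilon> x \<and> p s (\<lambda>z. x z - block \<gamma> i \<eta> (\<lambda>w. w ^ k) z) < e"
    by (intro exI[of _ ?x]) auto
qed

text \<open>Subtracting the multiple \<open>\<gamma> z0\<close> of \<open>\<eta>\<close> from
  \<open>\<gamma>\<close> leaves a functional vanishing at \<open>z0\<close>; the binomial theorem
  then turns the power of \<open>\<gamma>\<close> into blocks.\<close>

lemma approximable_power:
  assumes \<gamma>: "functional \<gamma> G" and \<epsilon>: "0 < \<epsilon>"
  shows "approximable \<epsilon> (pw \<gamma> k)"
proof -
  define c where "c = \<gamma> z0"
  define \<sigma> where "\<sigma> x = \<gamma> x + (- c) * \<eta> x" for x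
  have \<sigma>: "functional \<sigma> (\<bar>G\<bar> + cmod c * H + 1)" "0 < \<bar>G\<bar> + cmod c * H + 1" "\<sigma> z0 = 0"
  proof -
    have "functional \<sigma> (G + cmod c * H)"
      unfolding \<sigma>_def using functional_lincomb[OF \<gamma> \<eta>, of "- c"] by simp
    then show "functional \<sigma> (\<bar>G\<bar> + cmod c * H + 1)" by (rule functional_mono) simp
    show "0 < \<bar>G\<bar> + cmod c * H + 1" using H by (simp add: add_nonneg_pos)
    show "\<sigma> z0 = 0" by (simp add: \<sigma>_def c_def \<eta>_z0)
  qed
  have "pw \<gamma> k =
      (\<lambda>x. \<Sum>i\<le>k. (of_nat (k choose i) * c ^ (k - i)) * block \<sigma> i \<eta> (\<lambda>w. w ^ (k - i)) x)"
  proof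
    fix x
    have "\<gamma> x = \<sigma> x + c * \<eta> x" by (simp add: \<sigma>_def)
    then show "pw \<gamma> k x =
      (\<Sum>i\<le>k. (of_nat (k choose i) * c ^ (k - i)) * block \<sigma> i \<eta> (\<lambda>w. w ^ (k - i)) x)"
      by (auto simp: on_carr_def block_def binomial_ring power_mult_distrib mult_ac)
  qed
  then show ?thesis
    by (simp only:) (intro approximable_sum approximable_cmult approximable_block[OF \<sigma> \<epsilon>])
qed

end

section \<open>Density and separability\<close>

context poly_ideals
begin

section \<open>Taylor polynomials and power sums\<close>

lemma expansion_single:
  assumes Q: "Q \<in> A k"
  shows "expansion Q (\<lambda>j. if j = k then Q else (\<lambda>x. 0))"
  unfolding expansion_def
proof (intro conjI allI ballI impI)
  show "(if j = k then Q else (\<lambda>x. 0)) \<in> A j" for j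
    using Q by (auto simp: A.mem_zero)
  show "summable (\<lambda>j. s ^ j * nA j (if j = k then Q else (\<lambda>x. 0)))" for s
    by (rule summable_finite[of "{k}"]) (auto simp: A.N_zero)
  show "(\<lambda>j. (if j = k then Q else (\<lambda>x. 0)) x) sums Q x" for x
    using sums_single[of k "\<lambda>_. Q x"] by (simp add: if_distrib[of "\<lambda>f. f x"] cong: if_cong)
qed (use A_off[OF Q] in auto)

lemma A_X: "Q \<in> A k \<Longrightarrow> Q \<in> X"
  using expansion_single by (auto simp: X_def)

lemma p_A:
  assumes "Q \<in> A k"
  shows "p s Q = s ^ k * nA k Q"
proof -
  have "p s Q = (\<Sum>j. if j = k then s ^ k * nA k Q else 0)"
    unfolding p_eq[OF expansion_single[OF assms]] by (intro suminf_cong) (auto simp: A.N_zero)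
  then show ?thesis using sums_unique[OF sums_single[of k "\<lambda>_. s ^ k * nA k Q"]] by simp
qed

lemma taylor_polynomial_approx:
  assumes g: "g \<in> X" and s: "0 < s" and e: "0 < e"
  shows "\<exists>n. p s (\<lambda>x. g x - (\<Sum>k<n. taylor_term E g k x)) < e"
proof -
  define R where "R = taylor_term E g"
  have R: "expansion g R" unfolding R_def by (rule X_expansion[OF g])
  obtain n where n: "(\<Sum>k. s ^ (k + n) * nA (k + n) (R (k + n))) < e"
    using order_tendstoD(2)[OF suminf_exist_split2[OF expansionD(2)[OF R s]] e]
    by (auto simp: eventually_sequentially)
  define D where "D k = (if k < n then (\<lambda>x. 0) else R k)" for k
  have DR: "s ^ k * nA k (D k) \<le> s ^ k * nA k (R k)" if "0 < s" for s k
    using that A.N_nonneg[OF expansionD(1)[OF R]] by (simp add: D_def A.N_zero)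
  have D: "D k \<in> A k" for k using expansionD(1)[OF R] by (simp add: D_def A.mem_zero)
  have sm: "summable (\<lambda>k. s ^ k * nA k (D k))" if "0 < s" for s
    by (rule summable_comparison_test'[OF expansionD(2)[OF R that], of 0])
      (use DR[OF that] A.N_nonneg[OF D] that in simp)
  have ex: "expansion (\<lambda>x. g x - (\<Sum>k<n. R k x)) D"
    unfolding expansion_def
  proof (intro conjI allI ballI impI)
    fix x assume x: "x \<in> carr E"
    have "(\<lambda>k. if k < n then R k x else 0) sums (\<Sum>k<n. R k x)"
      using sums_If_finite_set[of "{..<n}" "\<lambda>k. R k x"] by simp
    from sums_diff[OF expansionD(3)[OF R x] this]
    show "(\<lambda>k. D k x) sums (g x - (\<Sum>k<n. R k x))"
      by (rule sums_cong[THEN iffD1, rotated]) (simp add: D_def)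
  qed (use D sm expansionD(4)[OF R] A_off[OF expansionD(1)[OF R]] in auto)
  have "p s (\<lambda>x. g x - (\<Sum>k<n. R k x)) = (\<Sum>k. s ^ (k + n) * nA (k + n) (D (k + n))) + (\<Sum>k<n. s ^ k * nA k (D k))"
    unfolding p_eq[OF ex] by (rule suminf_split_initial_segment[OF sm[OF s]])
  also have "(\<Sum>k<n. s ^ k * nA k (D k)) = 0" by (simp add: D_def A.N_zero)
  finally show ?thesis using n by (intro exI[of _ n]) (simp add: D_def R_def)
qed

text \<open>Expand the power of (\<gamma> - \<delta>) + \<delta>: the i = 0 term cancels and every
  other one contains the small functional, so a factor \<open>\<tau>\<close> comes out because
  \<open>\<tau> \<le> 1\<close>. The rest sums to (2 + 2 (G + 1))^k.\<close>

lemma power_diff_bound: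
  assumes \<gamma>: "functional \<gamma> G" "0 \<le> G" and \<sigma>: "functional (\<lambda>x. \<gamma> x - \<delta> x) \<tau>" "0 < \<tau>" "\<tau> \<le> 1"
  shows "(\<lambda>x. pw \<gamma> k x - pw \<delta> k x) \<in> A k" (is "?D \<in> _")
    "nA k (\<lambda>x. pw \<gamma> k x - pw \<delta> k x) \<le> \<tau> * (2 * (G + 2)) ^ k"
proof -
  let ?\<sigma> = "\<lambda>x. \<gamma> x - \<delta> x"
  have \<delta>: "functional \<delta> (G + 1)"
    using functional_mono[OF functional_lincomb[OF \<gamma>(1) \<sigma>(1), of "-1"]] \<sigma>(3) by simp
  define Q where "Q i = on_carr E (\<lambda>x. ?\<sigma> x ^ i * \<delta> x ^ (k - i))" for i
  have Q: "Q i \<in> A k" "nA k (Q i) \<le> (2 * \<tau>) ^ i * (2 * (G + 1)) ^ (k - i)" if "i \<le> k" for i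
    using monomial_in_A[OF \<sigma>(1) \<delta> \<sigma>(2), of i "k - i"] \<gamma>(2) that by (simp_all add: Q_def)
  have e: "?D
      = (\<lambda>x. \<Sum>i\<in>{1..k}. of_nat (k choose i) * Q i x)"
  proof
    fix x
    have "\<gamma> x ^ k = (?\<sigma> x + \<delta> x) ^ k" by simp
    also have "\<dots> = (\<Sum>i\<le>k. of_nat (k choose i) * ?\<sigma> x ^ i * \<delta> x ^ (k - i))"
      by (rule binomial_ring)
    also have "\<dots> = \<delta> x ^ k + (\<Sum>i\<in>{1..k}. of_nat (k choose i) * ?\<sigma> x ^ i * \<delta> x ^ (k - i))"
      by (simp add: atMost_atLeast0 sum.atLeast_Suc_atMost)
    finally show "?D x
      = (\<Sum>i\<in>{1..k}. of_nat (k choose i) * Q i x)"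
      by (auto simp: on_carr_def Q_def mult.assoc)
  qed
  show "?D \<in> A k"
    unfolding e by (intro A.mem_sum A.mem_cmult Q) auto
  have "nA k (\<lambda>x. \<Sum>i\<in>{1..k}. of_nat (k choose i) * Q i x)
      \<le> (\<Sum>i\<in>{1..k}. nA k (\<lambda>x. of_nat (k choose i) * Q i x))"
    by (intro A.N_sum A.mem_cmult Q) auto
  also have "\<dots> \<le> (\<Sum>i\<in>{1..k}. \<tau> * (of_nat (k choose i) * 2 ^ i * (2 * (G + 1)) ^ (k - i)))"
  proof (rule sum_mono)
    fix i assume i: "i \<in> {1..k}"
    have "\<tau> ^ i \<le> \<tau> ^ 1" using i \<sigma> by (intro power_decreasing) auto
    then have "(2 * \<tau>) ^ i \<le> 2 ^ i * \<tau>" by (simp add: power_mult_distrib)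
    then have "nA k (Q i) \<le> (2 ^ i * \<tau>) * (2 * (G + 1)) ^ (k - i)"
      using Q(2)[of i] i \<gamma>(2) by (intro order_trans[OF Q(2)] mult_right_mono) auto
    then have "of_nat (k choose i) * nA k (Q i) \<le> of_nat (k choose i) * ((2 ^ i * \<tau>) * (2 * (G + 1)) ^ (k - i))"
      by (intro mult_left_mono) auto
    then show "nA k (\<lambda>x. of_nat (k choose i) * Q i x)
        \<le> \<tau> * (of_nat (k choose i) * 2 ^ i * (2 * (G + 1)) ^ (k - i))"
      using A.N_cmult[OF Q(1), of i "of_nat (k choose i)"] i by (simp add: mult_ac)
  qed
  also have "\<dots> \<le> (\<Sum>i\<le>k. \<tau> * (of_nat (k choose i) * 2 ^ i * (2 * (G + 1)) ^ (k - i)))"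
    using \<sigma> \<gamma>(2) by (intro sum_mono2) auto
  also have "\<dots> = \<tau> * (2 + 2 * (G + 1)) ^ k"
    by (simp only: sum_distrib_left[symmetric] binomial_ring[symmetric])
  finally show "nA k ?D \<le> \<tau> * (2 * (G + 2)) ^ k"
    unfolding e by (simp add: algebra_simps)
qed

text \<open>Lists over a countable set are countable, and their concatenation serves as
  addition.\<close>

definition power_sum :: "(('a \<Rightarrow> complex) \<times> complex \<times> nat) list \<Rightarrow> 'a \<Rightarrow> complex" where
  "power_sum L x = (\<Sum>(\<gamma>, b, k)\<leftarrow>L. b * pw \<gamma> k x)"

lemma power_sum_append: "power_sum (L @ M) x = power_sum L x + power_sum M x"
  by (simp add: power_sum_def)

lemma power_X: "functional \<gamma> G \<Longrightarrow> pw \<gamma> k \<in> X"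
  using A_X[OF power_in_A(1)[OF functional_mono[OF _ max.cobounded1[of G 0]]]] by simp

lemma power_sum_X:
  assumes "\<And>\<gamma> b k. (\<gamma>, b, k) \<in> set L \<Longrightarrow> \<exists>G. functional \<gamma> G"
  shows "power_sum L \<in> X"
  using assms
proof (induction L)
  case Nil
  then show ?case by (simp add: power_sum_def[abs_def] X_zero)
next
  case (Cons t L)
  obtain \<gamma> b k where t: "t = (\<gamma>, b, k)" by (cases t)
  obtain G where "functional \<gamma> G" using Cons.prems[of \<gamma> b k] t by auto
  then have "(\<lambda>x. b * pw \<gamma> k x + power_sum L x) \<in> X"
    by (intro X_add X_cmult power_X Cons.IH Cons.prems) auto
  then show ?case by (simp add: power_sum_def[abs_def] t)
qed

abbreviation finite_type_dense :: "nat \<Rightarrow> bool" where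
  "finite_type_dense k \<equiv> vtopology (ideal_space (\<AA> k) E) closure_of finite_type_polys E k
     = carr (ideal_space (\<AA> k) E)"

text \<open>\<open>cl\<close> is the closure of the power sums, stable under addition and limits. It
  contains the multiples of powers of arbitrary functionals, hence the finite type polynomials,
  hence every \<open>A k\<close> by the density hypothesis, and finally \<open>X\<close> by Taylor
  polynomials.\<close>

lemma power_sums_dense:
  assumes ft: "\<And>k. finite_type_dense k"
    and D: "\<And>\<gamma>. \<gamma> \<in> D \<Longrightarrow> \<exists>G. functional \<gamma> G"
      "\<And>\<gamma> G e. functional \<gamma> G \<Longrightarrow> 0 < e \<Longrightarrow> \<exists>\<delta>\<in>D. functional (\<lambda>x. \<gamma> x - \<delta> x) e"
    and Q: "\<And>b e. 0 < e \<Longrightarrow> \<exists>q\<in>Q. cmod (b - q) < e"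
    and g: "g \<in> X" and s: "0 < s" and e: "0 < e"
  shows "\<exists>L \<in> lists (D \<times> Q \<times> UNIV). p s (\<lambda>x. power_sum L x - g x) < e"
proof -
  let ?W = "lists (D \<times> Q \<times> (UNIV :: nat set))"
  define cl where "cl = {g\<in>X. \<forall>s>0. \<forall>e>0. \<exists>L \<in> ?W. p s (\<lambda>x. g x - power_sum L x) < e}"
  have LX: "power_sum L \<in> X" if "L \<in> ?W" for L
    using that D(1) by (intro power_sum_X) auto
  have cl_add: "(\<lambda>x. f x + g x) \<in> cl" if f: "f \<in> cl" and g: "g \<in> cl" for f g
    unfolding cl_def
  proof (intro CollectI conjI allI impI)
    show "(\<lambda>x. f x + g x) \<in> X" using f g by (intro X_add) (auto simp: cl_def)
    fix s e :: real assume s: "0 < s" and e: "0 < e"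
    obtain L M where L: "L \<in> ?W" "p s (\<lambda>x. f x - power_sum L x) < e / 2"
      and M: "M \<in> ?W" "p s (\<lambda>x. g x - power_sum M x) < e / 2"
      using f g s half_gt_zero[OF e] unfolding cl_def by blast
    have "p s (\<lambda>x. (f x - power_sum L x) + (g x - power_sum M x))
        \<le> p s (\<lambda>x. f x - power_sum L x) + p s (\<lambda>x. g x - power_sum M x)"
      using f g L M s by (intro p_add X_diff LX) (auto simp: cl_def)
    then have "p s (\<lambda>x. (f x + g x) - power_sum (L @ M) x) < e"
      using L M by (simp add: power_sum_append algebra_simps)
    then show "\<exists>L \<in> ?W. p s (\<lambda>x. (f x + g x) - power_sum L x) < e"
      using L M by (intro bexI[of _ "L @ M"]) auto
  qed
  have cl_zero: "(\<lambda>x. 0) \<in> cl"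
    unfolding cl_def by (auto simp: X_zero power_sum_def p_zero intro!: bexI[of _ "[]"])
  have cl_sum: "(\<lambda>x. \<Sum>i\<in>I. f i x) \<in> cl" if "\<And>i. i \<in> I \<Longrightarrow> f i \<in> cl" for f and I :: "'i set"
    using that by (induction I rule: infinite_finite_induct) (auto simp: cl_zero cl_add)
  have cl_closed: "g \<in> cl" if gX: "g \<in> X" and ap: "\<And>s e. 0 < s \<Longrightarrow> 0 < e \<Longrightarrow> \<exists>h\<in>cl. p s (\<lambda>x. g x - h x) < e" for g
    unfolding cl_def
  proof (intro CollectI conjI allI impI)
    show "g \<in> X" by fact
    fix s e :: real assume s: "0 < s" and e: "0 < e"
    obtain h where h: "h \<in> cl" "p s (\<lambda>x. g x - h x) < e / 2" using ap[OF s half_gt_zero[OF e]] by blast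
    then obtain L where L: "L \<in> ?W" "p s (\<lambda>x. h x - power_sum L x) < e / 2"
      using s half_gt_zero[OF e] unfolding cl_def by blast
    have "p s (\<lambda>x. g x - power_sum L x) \<le> p s (\<lambda>x. g x - h x) + p s (\<lambda>x. h x - power_sum L x)"
      using gX h L s by (intro p_triangle LX) (auto simp: cl_def)
    then show "\<exists>L \<in> ?W. p s (\<lambda>x. g x - power_sum L x) < e"
      using L h by (intro bexI[of _ L]) auto
  qed
  have cl_power: "(\<lambda>x. b * pw \<gamma> k x) \<in> cl" if \<gamma>': "functional \<gamma> G'" for b \<gamma> G' k
    unfolding cl_def
  proof (intro CollectI conjI allI impI)
    show "(\<lambda>x. b * pw \<gamma> k x) \<in> X" by (intro X_cmult power_X[OF \<gamma>'])
    fix s e :: real assume s: "0 < s" and e: "0 < e"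
    define G where "G = max G' 0"
    have \<gamma>: "functional \<gamma> G" "0 \<le> G" using functional_mono[OF \<gamma>', of G] by (auto simp: G_def)
    \<comment> \<open>K bounds the seminorm of the power of \<open>\<gamma>\<close> and, by
      \<open>power_diff_bound\<close>, that of the difference divided by \<open>\<tau>\<close>; the
      summand 1 keeps it positive.\<close>
    define K where "K = s ^ k * (2 * (G + 2)) ^ k + 1"
    have K: "0 < K" using s \<gamma> by (simp add: K_def add_nonneg_pos)
    have KG: "s ^ k * G ^ k \<le> K"
    proof -
      have "G ^ k \<le> (2 * (G + 2)) ^ k" using \<gamma> by (intro power_mono) auto
      then have "s ^ k * G ^ k \<le> s ^ k * (2 * (G + 2)) ^ k" using s by (intro mult_left_mono) auto
      then show ?thesis by (simp add: K_def)
    qed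
    define \<tau> where "\<tau> = min 1 (e / (2 * K * (cmod b + 1)))"
    have \<tau>: "0 < \<tau>" "\<tau> \<le> 1" using e K by (auto simp: \<tau>_def add_nonneg_pos)
    obtain q where q: "q \<in> Q" "cmod (b - q) < min 1 (e / (2 * K))"
      using Q[of "min 1 (e / (2 * K))" b] e K by auto
    obtain \<delta> where \<delta>: "\<delta> \<in> D" "functional (\<lambda>x. \<gamma> x - \<delta> x) \<tau>"
      using D(2)[OF \<gamma>(1) \<tau>(1)] by blast
    let ?P = "pw \<gamma> k" and ?P' = "pw \<delta> k"
    let ?d = "\<lambda>x. ?P x - ?P' x"
    note d = power_diff_bound[OF \<gamma> \<delta>(2) \<tau>, of k]
    note P = power_in_A[OF \<gamma>, of k]
    \<comment> \<open>The error b \<gamma>^k - q \<delta>^k is split into a change of the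
      coefficient and a change of the functional, each costing at most e/2.\<close>
    have "p s (\<lambda>x. (b - q) * ?P x + q * ?d x) \<le> p s (\<lambda>x. (b - q) * ?P x) + cmod q * p s ?d"
      by (intro p_lincomb X_cmult A_X[OF P(1)] A_X[OF d(1)] s)
    also have "\<dots> \<le> cmod (b - q) * p s ?P + cmod q * p s ?d"
      by (intro add_right_mono p_cmult_le A_X[OF P(1)] s)
    also have "\<dots> < e / 2 + e / 2"
    proof (rule add_less_le_mono)
      have "p s ?P \<le> s ^ k * G ^ k" unfolding p_A[OF P(1)] using P(2) s by (intro mult_left_mono) auto
      also have "\<dots> \<le> K" by (rule KG)
      finally have "cmod (b - q) * p s ?P \<le> cmod (b - q) * K" by (intro mult_left_mono) auto
      also have "\<dots> < e / (2 * K) * K" using q(2) K by (intro mult_strict_right_mono) auto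
      also have "\<dots> = e / 2" using K by simp
      finally show "cmod (b - q) * p s ?P < e / 2" .
      have "cmod q \<le> cmod b + 1"
        using q(2) norm_triangle_ineq2[of q b] by (simp add: norm_minus_commute)
      moreover have "p s ?d \<le> \<tau> * K"
      proof -
        have "p s ?d \<le> s ^ k * (\<tau> * (2 * (G + 2)) ^ k)"
          unfolding p_A[OF d(1)] using d(2) s by (intro mult_left_mono) auto
        also have "\<dots> = \<tau> * (s ^ k * (2 * (G + 2)) ^ k)" by simp
        also have "\<dots> \<le> \<tau> * K" using \<tau> by (intro mult_left_mono) (auto simp: K_def)
        finally show ?thesis .
      qed
      ultimately have "cmod q * p s ?d \<le> (cmod b + 1) * (\<tau> * K)"
        using p_nonneg[OF A_X[OF d(1)] s] by (intro mult_mono) (auto simp: add_nonneg_nonneg)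
      also have "\<dots> \<le> (cmod b + 1) * (e / (2 * K * (cmod b + 1)) * K)"
        using K by (intro mult_left_mono mult_right_mono) (auto simp: \<tau>_def add_nonneg_nonneg)
      also have "\<dots> = e / 2"
      proof -
        have "cmod b + 1 \<noteq> 0" using norm_ge_zero[of b] by linarith
        then show ?thesis using K by (simp add: divide_simps)
      qed
      finally show "cmod q * p s ?d \<le> e / 2" .
    qed
    finally have "p s (\<lambda>x. b * ?P x - power_sum [(\<delta>, q, k)] x) < e"
      by (simp add: power_sum_def algebra_simps)
    then show "\<exists>L \<in> ?W. p s (\<lambda>x. b * ?P x - power_sum L x) < e"
      using \<delta> q by (intro bexI[of _ "[(\<delta>, q, k)]"]) auto
  qed
  have cl_A: "R \<in> cl" if R: "R \<in> A k" for R k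
  proof (rule cl_closed[OF A_X[OF R]])
    fix s e :: real assume s: "0 < s" and e: "0 < e"
    have RF: "R \<in> vtopology (fun_space (A k) (nA k)) closure_of finite_type_polys E k"
      using ft[of k] R by (simp add: ideal_space_def fun_space_def)
    obtain F where F: "F \<in> finite_type_polys E k" "F \<in> A k" "nA k (\<lambda>x. R x - F x) < e / s ^ k"
      using A.N_closure[OF RF divide_pos_pos[OF e zero_less_power[OF s]]] by blast
    then obtain G b where Gb: "finite G" "G \<subseteq> carr (dual_space E)" "F = on_carr E (\<lambda>x. \<Sum>\<gamma>\<in>G. b \<gamma> * \<gamma> x ^ k)"
      by (auto simp: finite_type_polys_def)
    have "F = (\<lambda>x. \<Sum>\<gamma>\<in>G. b \<gamma> * pw \<gamma> k x)"
      by (auto simp: Gb(3) on_carr_def)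
    moreover have "(\<lambda>x. \<Sum>\<gamma>\<in>G. b \<gamma> * pw \<gamma> k x) \<in> cl"
      using Gb(2) cl_power by (intro cl_sum) (auto simp: carr_dual)
    ultimately have "F \<in> cl" by simp
    moreover have "p s (\<lambda>x. R x - F x) < e"
      using F(3) s p_A[OF A.mem_diff[OF R F(2)], of s] by (simp add: field_simps)
    ultimately show "\<exists>h\<in>cl. p s (\<lambda>x. R x - h x) < e" by blast
  qed
  have "g \<in> cl"
  proof (rule cl_closed[OF g])
    fix s e :: real assume s: "0 < s" and e: "0 < e"
    obtain n where "p s (\<lambda>x. g x - (\<Sum>k<n. taylor_term E g k x)) < e"
      using taylor_polynomial_approx[OF g s e] by blast
    moreover have "(\<lambda>x. \<Sum>k<n. taylor_term E g k x) \<in> cl"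
      by (intro cl_sum cl_A[OF expansionD(1)[OF X_expansion[OF g]]])
    ultimately show "\<exists>h\<in>cl. p s (\<lambda>x. g x - h x) < e" by (rule bexI)
  qed
  then obtain L where L: "L \<in> ?W" "p s (\<lambda>x. g x - power_sum L x) < e"
    using s e unfolding cl_def by blast
  then show ?thesis using p_diff_commute[OF g LX[OF L(1)] s] by (intro bexI[of _ L]) auto
qed

end

context translation_setting
begin

text \<open>Each power sum L gets one decaying approximant per N, accurate to 1/(N + 1) in the
  seminorm of radius N + 1; since the seminorms increase with the radius, countably many suffice for
  all of them.\<close>

lemma countable_dense_decay:
  assumes ft: "\<And>k. finite_type_dense k"
    and sep: "separable_space (vtopology (dual_space E))" and \<epsilon>: "0 < \<epsilon>"
  obtains y :: "nat \<Rightarrow> 'a \<Rightarrow> complex" where "\<And>i. decay \<epsilon> (y i)"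
    "\<And>g s e. g \<in> X \<Longrightarrow> 0 < s \<Longrightarrow> 0 < e \<Longrightarrow> \<exists>i. p s (\<lambda>x. y i x - g x) < e"
proof -
  obtain D where D: "countable D" "\<And>\<gamma>. \<gamma> \<in> D \<Longrightarrow> \<exists>G. functional \<gamma> G"
    "\<And>\<gamma> G e. functional \<gamma> G \<Longrightarrow> 0 < e \<Longrightarrow> \<exists>\<delta>\<in>D. functional (\<lambda>x. \<gamma> x - \<delta> x) e"
    using separable_dualE[OF sep] by blast
  obtain Q :: "complex set" where Q: "countable Q" "\<And>U. open U \<Longrightarrow> U \<noteq> {} \<Longrightarrow> \<exists>q\<in>Q. q \<in> U"
    using countable_dense_setE by blast
  have Q': "\<exists>q\<in>Q. cmod (b - q) < e" if "0 < e" for b e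
    using Q(2)[of "ball b e"] that by (auto simp: dist_norm)
  define W where "W = lists (D \<times> Q \<times> (UNIV :: nat set))"
  have ap: "approximable \<epsilon> (power_sum L)" if "L \<in> W" for L
    using that unfolding W_def
  proof (induction L)
    case Nil
    then show ?case by (simp add: power_sum_def[abs_def] approximable_zero)
  next
    case (Cons t L)
    obtain \<gamma> b k where t: "t = (\<gamma>, b, k)" by (cases t)
    obtain G where "functional \<gamma> G" using Cons t D(2) by auto
    then have "approximable \<epsilon> (\<lambda>x. b * pw \<gamma> k x + power_sum L x)"
      by (intro approximable_add approximable_cmult approximable_power[OF _ \<epsilon>] Cons.IH)
    then show ?case by (simp add: power_sum_def[abs_def] t)
  qed
  have "\<exists>x. decay \<epsilon> x \<and> p (real N + 1) (\<lambda>z. x z - power_sum L z) < 1 / (real N + 1)" if "L \<in> W" for L N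
    using ap[OF that] unfolding approximable_def by (auto simp: add_nonneg_pos)
  then obtain x where x: "\<And>L N. L \<in> W \<Longrightarrow> decay \<epsilon> (x L N)"
      "\<And>L N. L \<in> W \<Longrightarrow> p (real N + 1) (\<lambda>z. x L N z - power_sum L z) < 1 / (real N + 1)"
    by metis
  define Y where "Y = (\<lambda>(L, N). x L N) ` (W \<times> (UNIV :: nat set))"
  have Y: "countable Y" "Y \<noteq> {}"
    using D(1) Q(1) by (auto simp: Y_def W_def intro!: countable_image countable_SIGMA countable_lists)
  show ?thesis
  proof
    show "decay \<epsilon> (from_nat_into Y i)" for i
      using from_nat_into[OF Y(2), of i] x(1) by (auto simp: Y_def)
    fix g and s e :: real assume g: "g \<in> X" and s: "0 < s" and e: "0 < e"
    obtain N :: nat where N: "max s (2 / e) < real N" using reals_Archimedean2 by blast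
    have N1: "0 < real N + 1" "s \<le> real N + 1" "1 / (real N + 1) < e / 2"
      using N s e by (auto simp: field_simps add_nonneg_pos)
    have "\<exists>L \<in> W. p s (\<lambda>z. power_sum L z - g z) < e / 2"
      unfolding W_def
      by (rule power_sums_dense[OF ft _ _ Q' g s half_gt_zero[OF e]]) (use D in blast)+
    then obtain L where L: "L \<in> W" "p s (\<lambda>z. power_sum L z - g z) < e / 2" by blast
    have LX: "power_sum L \<in> X" using ap[OF L(1)] by (simp add: approximable_def)
    have xX: "x L N \<in> X" by (rule decay_X[OF x(1)[OF L(1)]])
    have "p s (\<lambda>z. x L N z - g z) \<le> p s (\<lambda>z. x L N z - power_sum L z) + p s (\<lambda>z. power_sum L z - g z)"
      by (rule p_triangle[OF xX LX g s])
    also have "p s (\<lambda>z. x L N z - power_sum L z) \<le> p (real N + 1) (\<lambda>z. x L N z - power_sum L z)"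
      by (rule p_mono[OF X_diff[OF xX LX] s N1(2)])
    finally have "p s (\<lambda>z. x L N z - g z) < e"
      using x(2)[OF L(1), of N] N1(3) L(2) by linarith
    moreover have "x L N \<in> Y" using L(1) by (auto simp: Y_def)
    then obtain i where "x L N = from_nat_into Y i"
      using from_nat_into_surj[OF Y(1)] by metis
    ultimately show "\<exists>i. p s (\<lambda>z. from_nat_into Y i z - g z) < e" by auto
  qed
qed

end

section \<open>Visit times\<close>

text \<open>This is the exponent of 2 in n + 1: each value l occurs along an arithmetic progression,
  while the average stays at most 1.\<close>

function ruler :: "nat \<Rightarrow> nat" where
  "ruler n = (if even n then 0 else Suc (ruler (n div 2)))"
  by pat_completeness auto
termination
  by (relation "Wellfounded.measure id") (auto intro!: div_less_dividend odd_pos)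

declare ruler.simps [simp del]

lemma ruler_double [simp]: "ruler (2 * m) = 0" "ruler (2 * m + 1) = Suc (ruler m)"
  by (subst ruler.simps, simp)+

lemma ruler_progression: "ruler (2 ^ l - 1 + 2 ^ (l + 1) * t) = l"
proof (induction l arbitrary: t)
  case 0
  show ?case using ruler_double(1)[of t] by simp
next
  case (Suc l)
  \<comment> \<open>Writing the power as a successor removes the truncated subtraction.\<close>
  obtain b where "(2::nat) ^ l = Suc b" by (metis not0_implies_Suc power_not_zero zero_neq_numeral)
  then have "2 ^ Suc l - 1 + 2 ^ (Suc l + 1) * t = 2 * (2 ^ l - 1 + 2 ^ (l + 1) * t) + 1"
    by simp
  then show ?case using Suc ruler_double(2) by metis
qed

lemma sum_double: "(\<Sum>i<2 * (m::nat). f i) = (\<Sum>i<m. f (2 * i) + f (2 * i + 1) :: nat)"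
  by (induction m) (auto simp: algebra_simps)

text \<open>Even indices contribute 0 and an odd index 2m + 1 contributes 1 +
  \<open>ruler m\<close>, so the sum over 2m indices is m plus the sum over m. This makes the visit
  times grow linearly, which gives positive density.\<close>

lemma sum_ruler_le: "(\<Sum>i<n. ruler i) \<le> n"
proof (induction n rule: less_induct)
  case (less n)
  obtain m where m: "n = 2 * m \<or> n = 2 * m + 1" by (metis oddE evenE)
  have "(\<Sum>i<2 * m. ruler i) = m + (\<Sum>i<m. ruler i)"
    unfolding sum_double ruler_double by (simp add: sum_Suc)
  moreover have "(\<Sum>i<m. ruler i) \<le> m" using less[of m] m by (cases "m = 0") auto
  ultimately show ?case using m ruler_double(1)[of m] by auto
qed

text \<open>The block of index j has length twice ruler j + 1 and its centre is the j-th visit time, so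
  that visits with a large ruler value are far away from all others.\<close>

definition visit :: "nat \<Rightarrow> nat" where
  "visit j = (\<Sum>i<j. 2 * (ruler i + 1)) + (ruler j + 1)"

lemma visit_le: "visit j \<le> 4 * (j + 1)"
proof -
  have "visit j \<le> (\<Sum>i<Suc j. 2 * (ruler i + 1))" by (simp add: visit_def)
  also have "\<dots> = 2 * (\<Sum>i<Suc j. ruler i) + 2 * Suc j"
    by (simp only: sum.distrib distrib_left sum_distrib_left[symmetric] sum_constant card_lessThan) simp
  finally show ?thesis using sum_ruler_le[of "Suc j"] by simp
qed

lemma ruler_le_visit: "ruler j + 1 \<le> visit j"
  by (simp add: visit_def)

lemma visit_gap:
  assumes "i < j"
  shows "visit i + (ruler i + 1) + (ruler j + 1) \<le> visit j" "visit i + (j - i) \<le> visit j"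
proof -
  have gap: "visit i + (ruler i + 1) + (ruler j + 1) \<le> visit j" if "i < j" for i j
    using sum_mono2[of "{..<j}" "{..<Suc i}" "\<lambda>k. 2 * (ruler k + 1)"] that
    by (simp add: visit_def subset_iff)
  show "visit i + (ruler i + 1) + (ruler j + 1) \<le> visit j" by (rule gap[OF assms])
  show "visit i + (j - i) \<le> visit j"
    using assms
  proof (induction j)
    case (Suc j)
    have "visit j + 1 \<le> visit (Suc j)" using gap[of j "Suc j"] by simp
    then show ?case using Suc by (cases "i = j") auto
  qed simp
qed

lemma visit_ge: "j \<le> visit j"
  using visit_gap(2)[of 0 j] by (cases "j = 0") auto

lemma visit_dist:
  assumes "i \<noteq> j"
  shows "real (ruler i + 1) + real (ruler j + 1) \<le> \<bar>real (visit i) - real (visit j)\<bar>"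
    "\<bar>real i - real j\<bar> \<le> \<bar>real (visit i) - real (visit j)\<bar>"
proof -
  have "real (ruler i + 1) + real (ruler j + 1) \<le> \<bar>real (visit i) - real (visit j)\<bar> \<and>
      \<bar>real i - real j\<bar> \<le> \<bar>real (visit i) - real (visit j)\<bar>" if "i < j" for i j
    using visit_gap[OF that] that by linarith
  from this[of i j] this[of j i] assms
  show "real (ruler i + 1) + real (ruler j + 1) \<le> \<bar>real (visit i) - real (visit j)\<bar>"
    "\<bar>real i - real j\<bar> \<le> \<bar>real (visit i) - real (visit j)\<bar>" by (fastforce simp: neq_iff)+
qed

lemma inj_visit: "inj visit"
  using visit_gap(1) by (intro linorder_injI) fastforce

section \<open>Lower density and weighted sums\<close>

lemma lower_density_pos:
  assumes a: "inj a" "\<And>t. a t \<in> S" and K: "0 < K" "\<And>t. a t \<le> K * (t + 1)"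
  shows "0 < lower_density S"
proof -
  have "\<forall>\<^sub>F N in sequentially. ereal (1 / (4 * real K)) \<le> ereal (real (card (S \<inter> {..N})) / real (N + 1))"
    unfolding eventually_sequentially
  proof (intro exI allI impI)
    \<comment> \<open>For such N the rounding loss K is at most N/4, which leaves room for the
      constant 4.\<close>
    fix N assume N: "4 * K \<le> N"
    have "a ` {..<N div K} \<subseteq> S \<inter> {..N}"
    proof
      fix n assume "n \<in> a ` {..<N div K}"
      then obtain t where t: "t < N div K" "n = a t" by auto
      have "n \<le> K * (t + 1)" using K t by simp
      also have "\<dots> \<le> K * (N div K)" using t by (intro mult_left_mono) auto
      also have "\<dots> \<le> N" by simp
      finally show "n \<in> S \<inter> {..N}" using a t by auto
    qed
    then have "card (a ` {..<N div K}) \<le> card (S \<inter> {..N})" by (intro card_mono) auto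
    then have c: "N div K \<le> card (S \<inter> {..N})"
      using card_image[of a "{..<N div K}"] inj_on_subset[OF a(1)] by simp
    have "N < K * (N div K + 1)"
      using K by (metis Suc_eq_plus1 dividend_less_times_div mult_Suc_right add.commute)
    then have "real N < real K * (real (N div K) + 1)"
      by (metis of_nat_less_iff of_nat_mult of_nat_add of_nat_1)
    also have "\<dots> \<le> real K * (real (card (S \<inter> {..N})) + 1)" using c by (intro mult_left_mono) auto
    finally have "real (N + 1) \<le> 4 * real K * real (card (S \<inter> {..N}))"
      using N K by (simp add: algebra_simps)
    then show "ereal (1 / (4 * real K)) \<le> ereal (real (card (S \<inter> {..N})) / real (N + 1))"
      using K by (simp add: field_simps)
  qed
  then have "ereal (1 / (4 * real K)) \<le> lower_density S"
    unfolding lower_density_def by (rule Liminf_bounded)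
  moreover have "0 < ereal (1 / (4 * real K))" using K by simp
  ultimately show ?thesis by (rule order_less_le_trans[rotated])
qed

text \<open>One power of d pays for the numerator, whose variable part is at most d.\<close>

lemma weight_le:
  fixes M :: real
  assumes "0 \<le> M" "1 \<le> d" "n \<le> d"
  shows "(M + n) / d ^ 4 \<le> (M + 1) / d ^ 3"
proof -
  have "M + n \<le> (M + 1) * d"
    using mult_left_mono[OF assms(2,1)] assms(3) by (simp add: algebra_simps)
  then have "(M + n) / d ^ 4 \<le> ((M + 1) * d) / d ^ 4"
    using assms(2) by (intro divide_right_mono) auto
  then show ?thesis using assms(2) by (simp add: power_numeral_reduce)
qed

lemma summable_inverse_square_shift: "summable (\<lambda>j. 1 / (1 + real j) ^ 2)"
  using inverse_power_summable[of 2, where 'a = real] summable_iff_shift[of "\<lambda>n. inverse (real n ^ 2)" 1]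
  by (simp add: inverse_eq_divide add.commute)

text \<open>W must not depend on i, since it is applied at infinitely many visits; both sides of i
  are compared with the same one-sided series.\<close>

lemma two_sided_sum_bound:
  obtains W where "0 < W"
    "\<And>i. summable (\<lambda>j. 1 / (1 + \<bar>real i - real j\<bar>) ^ 2)"
    "\<And>i. (\<Sum>j. 1 / (1 + \<bar>real i - real j\<bar>) ^ 2) \<le> W"
proof
  let ?q = "\<lambda>j. 1 / (1 + real j) ^ 2"
  let ?w = "\<lambda>i j. 1 / (1 + \<bar>real i - real j\<bar>) ^ 2"
  show "0 < 2 * (\<Sum>j. ?q j)"
    using suminf_pos[OF summable_inverse_square_shift] by (simp add: add_pos_nonneg)
  fix i
  have shift: "?w i (j + i) = ?q j" for j by simp
  show sm: "summable (?w i)"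
    using summable_inverse_square_shift summable_iff_shift[of "?w i" i] by (simp add: shift)
  have "(\<Sum>j. ?w i j) = (\<Sum>j. ?q j) + (\<Sum>j<i. ?w i j)"
    using suminf_split_initial_segment[OF sm, of i] by (simp add: shift)
  also have "(\<Sum>j<i. ?w i j) = (\<Sum>j<i. ?w i (i - Suc j))"
    by (rule sum.nat_diff_reindex[symmetric])
  also have "\<dots> \<le> (\<Sum>j<i. ?q j)"
  proof (rule sum_mono)
    fix j assume "j \<in> {..<i}"
    then have "\<bar>real i - real (i - Suc j)\<bar> = real j + 1" by auto
    then show "?w i (i - Suc j) \<le> ?q j" by (simp only:) (intro divide_left_mono power_mono, auto)
  qed
  also have "\<dots> \<le> (\<Sum>j. ?q j)"
    by (intro sum_le_suminf summable_inverse_square_shift) auto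
  finally show "(\<Sum>j. ?w i j) \<le> 2 * (\<Sum>j. ?q j)" by simp
qed

lemma exists_strict_mono_above:
  fixes h :: "nat \<Rightarrow> real"
  obtains L :: "nat \<Rightarrow> nat" where "strict_mono L" "\<And>m. h m \<le> real (L m)" "\<And>m. m \<le> L m"
proof -
  define L where "L m = m + (\<Sum>i\<le>m. nat \<lceil>h i\<rceil>)" for m
  have "strict_mono L" by (rule strict_monoI_Suc) (simp add: L_def)
  moreover have "h m \<le> real (L m)" for m
  proof -
    have "nat \<lceil>h m\<rceil> \<le> (\<Sum>i\<le>m. nat \<lceil>h i\<rceil>)" by (intro member_le_sum) auto
    then have "nat \<lceil>h m\<rceil> \<le> L m" by (simp add: L_def)
    then show ?thesis using real_nat_ceiling_ge[of "h m"] by linarith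
  qed
  moreover have "m \<le> L m" for m by (simp add: L_def)
  ultimately show ?thesis by (rule that)
qed

section \<open>The topology\<close>

context poly_ideals
begin

lemma translation_translation:
  assumes "a \<in> carr E" "b \<in> carr E"
  shows "shift a (shift b f) = shift (vadd E a b) f"
  using assms by (auto simp: translation_def on_carr_def add_closed add_assoc)

lemma translation_funpow:
  assumes f: "\<And>x. x \<notin> carr E \<Longrightarrow> f x = 0"
  shows "(shift z0 ^^ n) f = shift (vscale E (of_nat n) z0) f"
proof (induction n)
  case 0
  then show ?case using translation_zero[of f] f by (simp add: scale_zero_left z0)
next
  case (Suc n)
  have "vadd E z0 (vscale E (of_nat n) z0) = vscale E (of_nat (Suc n)) z0"
    using scale_add_left[OF z0(1), of 1 "of_nat n"] by (simp add: scale_one z0)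
  then show ?case using Suc by (simp add: translation_translation scale_closed z0)
qed

abbreviation pball :: "('a \<Rightarrow> complex) \<Rightarrow> real \<Rightarrow> real \<Rightarrow> ('a \<Rightarrow> complex) set" where
  "pball f s e \<equiv> {g \<in> Hb. p s (\<lambda>x. g x - f x) < e}"

lemma topspace_HbA: "topspace Hb_top = Hb"
proof -
  have "\<exists>V. (\<exists>g s e. V = pball g s e \<and> g \<in> Hb \<and> 0 < s \<and> 0 < e) \<and> f \<in> V"
    if "f \<in> Hb" for f
    using that
    by (intro exI[of _ "pball f 1 1"] conjI exI[of _ f] exI[of _ 1])
      (simp_all add: p_zero)
  then show ?thesis
    unfolding HbA_topology_def topology_generated_by_topspace by auto
qed

lemma openin_HbA_ball:
  "f \<in> Hb \<Longrightarrow> 0 < s \<Longrightarrow> 0 < e \<Longrightarrow>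
     openin Hb_top (pball f s e)"
  unfolding HbA_topology_def
  by (rule topology_generated_by_Basis, rule CollectI, intro exI conjI) (rule refl | assumption)+

text \<open>The generating balls form a subbasis and are centred elsewhere. Intersections are
  handled by the larger radius, since the seminorms increase with it, and recentring by the triangle
  inequality.\<close>

lemma openin_HbA_ballE:
  assumes "openin Hb_top U" "g \<in> U"
  shows "\<exists>s>0. \<exists>e>0. \<forall>h\<in>Hb. p s (\<lambda>x. h x - g x) < e \<longrightarrow> h \<in> U"
proof -
  have gX: "g \<in> X"
    using assms openin_subset topspace_HbA HbA_X by blast
  have "generate_topology_on {pball f s e | f s e. f \<in> Hb \<and> s > 0 \<and> e > 0} U"
    using assms(1) unfolding HbA_topology_def by (rule openin_topology_generated_by)
  then show ?thesis using assms(2)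
  proof (induction rule: generate_topology_on.induct)
    case (Int U V)
    then obtain s e t d where U: "0 < s" "0 < e" "\<And>h. h \<in> Hb \<Longrightarrow> p s (\<lambda>x. h x - g x) < e \<Longrightarrow> h \<in> U"
      and V: "0 < t" "0 < d" "\<And>h. h \<in> Hb \<Longrightarrow> p t (\<lambda>x. h x - g x) < d \<Longrightarrow> h \<in> V"
      by blast
    have "h \<in> U \<inter> V" if h: "h \<in> Hb" and l: "p (max s t) (\<lambda>x. h x - g x) < min e d" for h
    proof -
      have "p s (\<lambda>x. h x - g x) \<le> p (max s t) (\<lambda>x. h x - g x)" "p t (\<lambda>x. h x - g x) \<le> p (max s t) (\<lambda>x. h x - g x)"
        using U V by (intro p_mono X_diff HbA_X[OF h] gX; simp)+
      then show ?thesis using U(3)[OF h] V(3)[OF h] l by auto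
    qed
    moreover have "0 < max s t" "0 < min e d" using U V by auto
    ultimately show ?case by blast
  next
    case (UN K)
    then show ?case by blast
  next
    case (Basis V)
    then obtain f s e where V: "V = pball f s e" "f \<in> Hb" "0 < s" "0 < e"
      by blast
    have "h \<in> V" if h: "h \<in> Hb" "p s (\<lambda>x. h x - g x) < e - p s (\<lambda>x. g x - f x)" for h
      using p_triangle[OF HbA_X[OF h(1)] gX HbA_X[OF V(2)] V(3)] h V by auto
    moreover have "0 < e - p s (\<lambda>x. g x - f x)" using Basis.prems V by auto
    ultimately show ?case using V(3) by blast
  qed simp
qed

end

section \<open>Existence of slowly growing frequently hypercyclic functions\<close>

context translation_setting
begin

text \<open>An enumeration of the y i with infinite repetition, slowed down by zero entries so that
  the orbit constants of the entry of index l are at most l + 1 up to a summand M independent of l.\<close>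

definition orbit_bound :: "real \<Rightarrow> real \<Rightarrow> (nat \<Rightarrow> 'a \<Rightarrow> complex) \<Rightarrow> bool" where
  "orbit_bound r M x \<longleftrightarrow> (\<forall>l n. \<forall>a\<in>carr E. vnorm E a \<le> r \<longrightarrow> tn n a (x l) \<in> X \<and>
        p r (tn n a (x l)) \<le> (M + real (l + 1)) / wt n)"

definition slow_enum :: "real \<Rightarrow> (nat \<Rightarrow> 'a \<Rightarrow> complex) \<Rightarrow> (nat \<Rightarrow> 'a \<Rightarrow> complex) \<Rightarrow> bool" where
  "slow_enum \<epsilon> y x \<longleftrightarrow>
     (\<forall>r>0. \<exists>M\<ge>0. orbit_bound r M x) \<and>
     (\<forall>l n. \<forall>z\<in>carr E.
        cmod (x l (tr n z)) \<le> real (l + 1) * exp (\<epsilon> * vnorm E z) / wt n) \<and>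
     (\<forall>l z. z \<notin> carr E \<longrightarrow> x l z = 0) \<and> (\<forall>i k. \<exists>l\<ge>k. x l = y i)"

text \<open>Entry m of an enumeration with infinite repetition is placed at an index
  \<open>L m\<close> above its growth constant and its orbit constant for radius m + 1. For a given
  r this covers all m \<ge> r; the finitely many others go into M.\<close>

lemma exists_slow_enum:
  assumes y: "\<And>i::nat. decay \<epsilon> (y i)"
  shows "\<exists>x. slow_enum \<epsilon> y x"
proof -
  obtain B C where BC: "\<And>i. decay_with \<epsilon> (y i) (B i) (C i)"
    using y unfolding decay_def by metis
  define i where "i m = fst (prod_decode m)" for m
  obtain L where L: "strict_mono L" "\<And>m. max (B (i m) (real m + 1)) (C (i m)) \<le> real (L m)" "\<And>m. m \<le> L m"
    using exists_strict_mono_above[of "\<lambda>m. max (B (i m) (real m + 1)) (C (i m))"] by blast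
  define x where "x l = (if l \<in> range L then y (i (inv L l)) else (\<lambda>z. 0))" for l
  have xL: "x (L m) = y (i m)" for m
    using strict_mono_imp_inj_on[OF L(1)] by (simp add: x_def)
  have x_other: "decay_with \<epsilon> (x l) (\<lambda>r. 0) 0" if "l \<notin> range L" for l
    using that decay_zero by (simp add: x_def)
  have "slow_enum \<epsilon> y x"
    unfolding slow_enum_def
  proof (intro conjI allI ballI impI)
    fix r :: real assume r: "0 < r"
    define M where "M = (\<Sum>m<nat \<lceil>r\<rceil>. \<bar>B (i m) r\<bar>)"
    have M: "0 \<le> M" by (auto simp: M_def intro: sum_nonneg)
    have "tn n a (x l) \<in> X \<and>
        p r (tn n a (x l)) \<le> (M + real (l + 1)) / wt n"
      if a: "a \<in> carr E" "vnorm E a \<le> r" for l n a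
    proof (cases "l \<in> range L")
      case True
      then obtain m where l: "l = L m" by auto
      show ?thesis
      proof (cases "m < nat \<lceil>r\<rceil>")
        case True
        have "\<bar>B (i m) r\<bar> \<le> M" unfolding M_def using True by (intro member_le_sum) auto
        then have "B (i m) r / wt n \<le> (M + real (l + 1)) / wt n"
          by (intro divide_right_mono) auto
        then show ?thesis
          using BC[of "i m"] r a unfolding l xL decay_with_def by (meson order_trans)
      next
        case False
        then have rm: "r \<le> real m + 1" by linarith
        have "tn n a (x l) \<in> X"
          and "p (real m + 1) (tn n a (x l)) \<le> B (i m) (real m + 1) / wt n"
        proof -
          have "0 < real m + 1" "vnorm E a \<le> real m + 1" using a rm by linarith+
          then show "tn n a (x l) \<in> X"
            "p (real m + 1) (tn n a (x l)) \<le> B (i m) (real m + 1) / wt n"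
            using BC[of "i m"] a(1) unfolding l xL decay_with_def by blast+
        qed
        moreover have "B (i m) (real m + 1) / wt n \<le> (M + real (l + 1)) / wt n"
          using L(2)[of m] M by (intro divide_right_mono) (auto simp: l)
        ultimately show ?thesis using p_mono[OF _ r rm] by (meson order_trans)
      qed
    next
      case False
      then have "tn n a (x l) \<in> X" "p r (tn n a (x l)) \<le> 0"
        using x_other a r unfolding decay_with_def by auto
      moreover have "0 \<le> (M + real (l + 1)) / wt n" using M by simp
      ultimately show ?thesis by linarith
    qed
    then show "\<exists>M\<ge>0. orbit_bound r M x"
      using M unfolding orbit_bound_def by blast
  next
    fix l n z assume z: "z \<in> carr E"
    show "cmod (x l (tr n z)) \<le> real (l + 1) * exp (\<epsilon> * vnorm E z) / wt n"
    proof (cases "l \<in> range L")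
      case True
      then obtain m where l: "l = L m" by auto
      have "cmod (x l (tr n z)) \<le> C (i m) * exp (\<epsilon> * vnorm E z) / wt n"
        using BC[of "i m"] z by (simp add: l xL decay_with_def)
      also have "\<dots> \<le> real (l + 1) * exp (\<epsilon> * vnorm E z) / wt n"
        using L(2)[of m] by (intro divide_right_mono mult_right_mono) (auto simp: l)
      finally show ?thesis .
    qed (simp add: x_def)
  next
    show "x l z = 0" if "z \<notin> carr E" for l z
      using BC that by (auto simp: x_def decay_with_def)
    show "\<exists>l\<ge>k. x l = y j" for j k
      using L(3)[of "prod_encode (j, k)"] le_prod_encode_2[of k j] xL[of "prod_encode (j, k)"]
      by (intro exI[of _ "L (prod_encode (j, k))"]) (auto simp: i_def)
  qed
  then show ?thesis by blast
qed

text \<open>At time \<open>visit i\<close> the orbit of f is \<open>x l\<close> with l =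
  \<open>ruler i\<close>, plus the interference of the other translates, which is of order 1/(l + 1)
  in any fixed seminorm. So a given g is approximated through a large l, and infinite repetition
  provides such l for every \<open>y i\<close>.\<close>

lemma exists_frequently_hypercyclic:
  assumes ft: "\<And>k. finite_type_dense k"
    and sep: "separable_space (vtopology (dual_space E))" and \<epsilon>: "0 < \<epsilon>"
  shows "\<exists>C>0. \<exists>f \<in> Hb.
               frequently_hypercyclic Hb_top (shift z0) f \<and>
               (\<forall>z \<in> carr E. cmod (f z) \<le> C * exp (\<epsilon> * vnorm E z))"
proof -
  obtain y :: "nat \<Rightarrow> 'a \<Rightarrow> complex" where y: "\<And>i. decay \<epsilon> (y i)"
    and y_dense: "\<And>g s e. g \<in> X \<Longrightarrow> 0 < s \<Longrightarrow> 0 < e \<Longrightarrow> \<exists>i. p s (\<lambda>x. y i x - g x) < e"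
    using countable_dense_decay[OF ft sep \<epsilon>] by blast
  obtain x where x: "slow_enum \<epsilon> y x" using exists_slow_enum[of \<epsilon> y, OF y] by blast
  have x_p: "\<exists>M\<ge>0. orbit_bound r M x"
    if "0 < r" for r
    using x that unfolding slow_enum_def by blast
  have x_le: "cmod (x l (tr n z)) \<le> real (l + 1) * exp (\<epsilon> * vnorm E z) / wt n"
    if "z \<in> carr E" for l n z
    using x that unfolding slow_enum_def by blast
  have x_off: "x l z = 0" if "z \<notin> carr E" for l z
    using x that unfolding slow_enum_def by blast
  have x_y: "\<exists>l\<ge>k. x l = y i" for i k
    using x unfolding slow_enum_def by blast
  let ?n = "\<lambda>j. int (visit j)"
  have x_X: "tn n a (x l) \<in> X" if a: "a \<in> carr E" for n a l
    using x_p[of "vnorm E a + 1"] vnorm_nonneg[OF a] a by (auto simp: orbit_bound_def)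
  \<comment> \<open>\<open>F a\<close> is the translate of f by a, written termwise so that
    membership in \<open>X\<close> can be shown for every a.\<close>
  define F where "F a = (\<lambda>z. \<Sum>j. tn (- ?n j) a (x (ruler j)) z)" for a
  define f where "f = F (vzero E)"
  have f_z: "f z = (\<Sum>j. x (ruler j) (tr (- ?n j) z))" if "z \<in> carr E" for z
    unfolding f_def F_def using that
    by (simp add: translation_def on_carr_def tr_def add_zero scale_closed z0 zero_closed)
  have f_off: "f z = 0" if "z \<notin> carr E" for z
    unfolding f_def F_def using that by (simp add: translation_def on_carr_def)
  have tr_F: "shift a f = F a" if a: "a \<in> carr E" for a
  proof
    fix z
    show "shift a f z = F a z"
      using a by (cases "z \<in> carr E")
        (simp_all add: F_def f_z translation_def on_carr_def add_closed tr_def add_assoc scale_closed z0)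
  qed
  have weight: "(M + real (ruler j + 1)) / (1 + real (visit j)) ^ 4 \<le> (M + 1) * (1 / (1 + real j) ^ 2)"
    if M: "0 \<le> M" for M j
  proof -
    let ?d = "1 + real (visit j)"
    have d: "1 \<le> ?d" "1 + real j \<le> ?d" "real (ruler j + 1) \<le> ?d"
      using visit_ge[of j] ruler_le_visit[of j] by linarith+
    have "(M + real (ruler j + 1)) / ?d ^ 4 \<le> (M + 1) / ?d ^ 3" using M d(1,3) by (rule weight_le)
    also have "\<dots> \<le> (M + 1) / ?d ^ 2"
      using d M by (intro divide_left_mono power_increasing mult_pos_pos zero_less_power) auto
    also have "\<dots> \<le> (M + 1) / (1 + real j) ^ 2"
      using d M by (intro divide_left_mono power_mono mult_pos_pos zero_less_power) auto
    finally show ?thesis by simp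
  qed
  have FX: "F a \<in> X" if a: "a \<in> carr E" for a
    unfolding F_def
  proof (rule p_suminf(1))
    note tX = x_X[OF a]
    show "tn (- ?n j) a (x (ruler j)) \<in> X" for j by (rule tX)
    fix s :: real assume s: "0 < s"
    \<comment> \<open>The radius has to admit both the seminorm s and the vector a.\<close>
    define r where "r = max s (vnorm E a)"
    have r: "0 < r" "s \<le> r" "vnorm E a \<le> r" using s by (auto simp: r_def)
    obtain M where M: "0 \<le> M" "\<And>j. p r (tn (- ?n j) a (x (ruler j)))
        \<le> (M + real (ruler j + 1)) / wt (- ?n j)"
      using x_p[OF r(1)] a r(3) unfolding orbit_bound_def by blast
    show "summable (\<lambda>j. p s (tn (- ?n j) a (x (ruler j))))"
    proof (rule summable_comparison_test'[of "\<lambda>j. (M + 1) * (1 / (1 + real j) ^ 2)" 0])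
      show "summable (\<lambda>j. (M + 1) * (1 / (1 + real j) ^ 2))"
        by (intro summable_mult summable_inverse_square_shift)
      fix j
      have "p s (tn (- ?n j) a (x (ruler j))) \<le> (M + real (ruler j + 1)) / (1 + real (visit j)) ^ 4"
        using order_trans[OF p_mono[OF tX s r(2)] M(2)[of j]] by simp
      then show "norm (p s (tn (- ?n j) a (x (ruler j)))) \<le> (M + 1) * (1 / (1 + real j) ^ 2)"
        using weight[OF M(1), of j] p_nonneg[OF tX s, of "- ?n j" "ruler j"] by simp
    qed
  qed
  have f_HbA: "f \<in> Hb"
    using f_off FX tr_F by (intro HbA_I) auto
  have tr_HbA: "shift a f \<in> Hb" if a: "a \<in> carr E" for a
  proof (rule HbA_I)
    show "shift b (shift a f) \<in> X" if "b \<in> carr E" for b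
      using FX[OF add_closed[OF that a]]
      by (simp only: translation_translation[OF that a] tr_F[OF add_closed[OF that a]])
  qed (simp add: translation_def on_carr_def)
  have fhc: "frequently_hypercyclic Hb_top (shift z0) f"
    unfolding frequently_hypercyclic_def topspace_HbA
  proof (intro conjI allI impI f_HbA)
    fix U assume "openin Hb_top U \<and> U \<noteq> {}"
    then obtain g where U: "openin Hb_top U" and g: "g \<in> U" by blast
    have gX: "g \<in> X" using U g openin_subset topspace_HbA HbA_X by blast
    obtain s e where s: "0 < s" and e: "0 < e"
      and ball: "\<And>h. h \<in> Hb \<Longrightarrow> p s (\<lambda>x. h x - g x) < e \<Longrightarrow> h \<in> U"
      using openin_HbA_ballE[OF U g] by blast
    obtain i0 where i0: "p s (\<lambda>x. y i0 x - g x) < e / 2"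
      using y_dense[OF gX s half_gt_zero[OF e]] by blast
    obtain M where M: "0 \<le> M" "orbit_bound s M x" using x_p[OF s] by blast
    obtain W where W: "0 < W" "\<And>i. summable (\<lambda>j. 1 / (1 + \<bar>real i - real j\<bar>) ^ 2)"
        "\<And>i. (\<Sum>j. 1 / (1 + \<bar>real i - real j\<bar>) ^ 2) \<le> W"
      using two_sided_sum_bound by blast
    \<comment> \<open>Makes the interference (M + 1) W / (l + 1) smaller than e/2 for every l \<ge>
      k.\<close>
    obtain k :: nat where k: "2 * (M + 1) * W / e < real k" using reals_Archimedean2 by blast
    obtain l where l: "k \<le> l" "x l = y i0" using x_y by blast
    have small: "(M + 1) / real (l + 1) * W < e / 2"
    proof -
      have "2 * (M + 1) * W / e < real (l + 1)" using k l by linarith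
      then show ?thesis using e by (simp add: field_simps)
    qed
    have visit_U: "(shift z0 ^^ visit i) f \<in> U" if i: "ruler i = l" for i
    proof -
      let ?a = "vscale E (of_nat (visit i)) z0"
      have a: "?a \<in> carr E" using z0 by (intro scale_closed)
      define d where "d j = tn (?n i - ?n j) (vzero E) (x (ruler j))" for j
      \<comment> \<open>The term j = i is the approximant itself; what remains is the
        interference.\<close>
      define d' where "d' j = (if j = i then (\<lambda>z. 0) else d j)" for j
      have tr_a: "tr (- ?n j) ?a = tr (?n i - ?n j) (vzero E)" for j
        using z0 scale_add_left[OF z0(1), of "of_nat (visit i)" "- of_nat (visit j)"]
        by (simp add: tr_def add_zero add_closed scale_closed)
      have fn: "(shift z0 ^^ visit i) f = F ?a"
        using translation_funpow[of f "visit i"] f_off tr_F[OF a] by simp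
      have Fd: "F ?a z = (\<Sum>j. d j z)" for z by (simp add: F_def d_def tr_a)
      have di: "d i = y i0"
        using translation_zero[of "x l"] x_off zero_closed by (simp add: d_def tr_0 i l(2)[symmetric])
      have d'X: "d' j \<in> X" for j by (simp add: d'_def d_def X_zero x_X zero_closed)
      let ?w = "\<lambda>j. 1 / (1 + \<bar>real i - real j\<bar>) ^ 2"
      have le: "p t (d' j) \<le> (M + 1) / real (l + 1) * ?w j"
        if M: "0 \<le> M" "orbit_bound t M x" and t: "0 < t" for t M j
      proof (cases "j = i")
        case False
        \<comment> \<open>\<open>\<Delta>\<close> dominates \<open>ruler j + 1\<close>, l + 1 and 1
          + |i - j|. The first cancels one of its four powers; the other three are split into one
          for l + 1 and two for 1 + |i - j|.\<close>
        define \<Delta> where "\<Delta> = 1 + \<bar>real (visit i) - real (visit j)\<bar>"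
        have \<Delta>: "1 \<le> \<Delta>" "real (ruler j + 1) \<le> \<Delta>" "real (l + 1) \<le> \<Delta>" "1 + \<bar>real i - real j\<bar> \<le> \<Delta>"
          using visit_dist[of i j] False i by (auto simp: \<Delta>_def)
        have "vnorm E (vzero E) \<le> t" using t vnorm_zero by simp
        then have "p t (tn n (vzero E) (x k)) \<le> (M + real (k + 1)) / wt n" for n k
          using M(2) zero_closed unfolding orbit_bound_def by blast
        from this[of "?n i - ?n j" "ruler j"] have "p t (d' j) \<le> (M + real (ruler j + 1)) / \<Delta> ^ 4"
          using False by (simp add: d'_def d_def \<Delta>_def)
        also have "\<dots> \<le> (M + 1) / \<Delta> ^ 3" using M(1) \<Delta>(1,2) by (rule weight_le)
        also have "\<dots> = (M + 1) / (\<Delta> * \<Delta> ^ 2)" using \<Delta> by (simp add: power_numeral_reduce)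
        also have "\<dots> \<le> (M + 1) / (real (l + 1) * (1 + \<bar>real i - real j\<bar>) ^ 2)"
          using \<Delta> M by (intro divide_left_mono mult_mono power_mono mult_pos_pos zero_less_power) auto
        finally show ?thesis by simp
      qed (use M p_zero in \<open>simp add: d'_def\<close>)
      have sm: "summable (\<lambda>j. (M + 1) / real (l + 1) * ?w j)" for M by (intro summable_mult W)
      have smd: "summable (\<lambda>j. p t (d' j))" if t: "0 < t" for t
      proof -
        obtain M where M: "0 \<le> M" "orbit_bound t M x" using x_p[OF t] by blast
        show ?thesis
          by (rule summable_comparison_test'[OF sm[of M], of 0])
            (use le[OF M t] p_nonneg[OF d'X t] in simp)
      qed
      have eq: "(\<lambda>z. F ?a z - y i0 z) = (\<lambda>z. \<Sum>j. d' j z)"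
      proof
        fix z
        have "summable (\<lambda>j. d' j z)"
          using p_suminf(3)[OF d'X smd] X_off[OF d'X, of z] by (cases "z \<in> carr E") auto
        then have "(\<lambda>j. d' j z + (if j = i then d i z else 0)) sums ((\<Sum>j. d' j z) + d i z)"
          using sums_single[of i "\<lambda>_. d i z"] by (intro sums_add summable_sums)
        moreover have "(\<lambda>j. d' j z + (if j = i then d i z else 0)) = (\<lambda>j. d j z)"
          by (auto simp: d'_def)
        ultimately show "F ?a z - y i0 z = (\<Sum>j. d' j z)"
          using sums_unique[of "\<lambda>j. d j z"] by (simp add: Fd di)
      qed
      have "p s (\<lambda>z. F ?a z - y i0 z) \<le> (\<Sum>j. p s (d' j))"
        unfolding eq by (rule p_suminf(2)[OF d'X smd s])
      also have "\<dots> \<le> (\<Sum>j. (M + 1) / real (l + 1) * ?w j)"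
        by (rule suminf_le[OF le[OF M s] smd[OF s] sm])
      also have "\<dots> = (M + 1) / real (l + 1) * (\<Sum>j. ?w j)"
        by (rule suminf_mult[OF W(2)])
      also have "\<dots> \<le> (M + 1) / real (l + 1) * W" using M by (intro mult_left_mono W) auto
      also have "\<dots> < e / 2" by (rule small)
      finally have "p s (\<lambda>z. F ?a z - g z) < e"
        using p_triangle[OF FX[OF a] decay_X[OF y] gX s, of i0] i0 by simp
      then show ?thesis
        using ball tr_HbA[OF a] by (simp add: fn tr_F[OF a])
    qed
    \<comment> \<open>Visits with ruler value l. By \<open>visit_le\<close> the one with parameter t
      is at most 4 (2^l + 2^(l+1) t), hence the constant 8 * 2^l below.\<close>
    let ?v = "\<lambda>t. visit (2 ^ l - 1 + 2 ^ (l + 1) * t)"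
    show "0 < lower_density {n. (shift z0 ^^ n) f \<in> U}"
    proof (rule lower_density_pos[of ?v _ "8 * 2 ^ l"])
      show "inj ?v"
      proof (rule injI)
        fix t u
        assume "?v t = ?v u"
        then have "2 ^ l - 1 + 2 ^ (l + 1) * t = 2 ^ l - 1 + 2 ^ (l + 1) * u"
          by (rule injD[OF inj_visit])
        then show "t = u" by (simp only: add_left_cancel mult_cancel1) simp
      qed
      show "?v t \<in> {n. (shift z0 ^^ n) f \<in> U}" for t
        using visit_U ruler_progression by simp
      have "1 \<le> (2::nat) ^ l" by simp
      then show "?v t \<le> 8 * 2 ^ l * (t + 1)" for t
        using visit_le[of "2 ^ l - 1 + 2 ^ (l + 1) * t"] by (simp add: algebra_simps)
    qed simp
  qed
  \<comment> \<open>The pointwise bound in \<open>slow_enum\<close> contains no M, so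
    \<open>weight\<close> with M = 0 gives a constant independent of z.\<close>
  define C where "C = (\<Sum>j. 1 / (1 + real j) ^ 2)"
  have C: "0 < C" unfolding C_def using suminf_pos[OF summable_inverse_square_shift] by (simp add: add_pos_nonneg)
  have "cmod (f z) \<le> C * exp (\<epsilon> * vnorm E z)" if z: "z \<in> carr E" for z
  proof -
    let ?e = "exp (\<epsilon> * vnorm E z)"
    have le: "cmod (x (ruler j) (tr (- ?n j) z)) \<le> 1 / (1 + real j) ^ 2 * ?e" for j
    proof -
      have "cmod (x (ruler j) (tr (- ?n j) z)) \<le> ?e * (real (ruler j + 1) / (1 + real (visit j)) ^ 4)"
        using x_le[OF z, of "ruler j" "- ?n j"] by (simp add: mult.commute)
      also have "\<dots> \<le> ?e * (1 / (1 + real j) ^ 2)"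
        using weight[of 0 j] by (intro mult_left_mono) auto
      finally show ?thesis by (simp add: mult.commute)
    qed
    have sm: "summable (\<lambda>j. 1 / (1 + real j) ^ 2 * ?e)"
      by (intro summable_mult2 summable_inverse_square_shift)
    have smn: "summable (\<lambda>j. cmod (x (ruler j) (tr (- ?n j) z)))"
      by (rule summable_comparison_test'[OF sm, of 0]) (use le in simp)
    have "cmod (f z) \<le> (\<Sum>j. cmod (x (ruler j) (tr (- ?n j) z)))"
      unfolding f_z[OF z] by (rule summable_norm[OF smn])
    also have "\<dots> \<le> (\<Sum>j. 1 / (1 + real j) ^ 2 * ?e)" by (rule suminf_le[OF le smn sm])
    also have "\<dots> = C * ?e" unfolding C_def by (rule suminf_mult2[OF summable_inverse_square_shift, symmetric])
    finally show ?thesis .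
  qed
  then show ?thesis using C f_HbA fhc by blast
qed

end

section \<open>Zeros and the lower growth bound\<close>

text \<open>Each zero in the disc of radius rho can be divided out at the cost of a factor 2/3 in the
  maximum modulus principle on the disc of radius 4 rho.\<close>

lemma zeros_maximum_modulus:
  assumes "finite Z" "g holomorphic_on UNIV"
    and "\<And>a. a \<in> Z \<Longrightarrow> g a = 0 \<and> cmod a \<le> \<rho>" and "cmod q \<le> \<rho>" "0 < \<rho>"
    and "\<And>w. cmod w = 4 * \<rho> \<Longrightarrow> cmod (g w) \<le> M"
  shows "cmod (g q) \<le> M * (2 / 3) ^ card Z"
  using assms
proof (induction Z arbitrary: g M rule: finite_induct)
  case empty
  have "cmod (g q) \<le> M"
  proof (rule maximum_modulus_frontier[of g "cball 0 (4 * \<rho>)"])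
    show "g holomorphic_on interior (cball 0 (4 * \<rho>))"
      by (rule holomorphic_on_subset[OF empty.prems(1)]) simp
    show "continuous_on (closure (cball 0 (4 * \<rho>))) g"
      by (rule holomorphic_on_imp_continuous_on[OF holomorphic_on_subset[OF empty.prems(1)]]) simp
    show "cmod (g z) \<le> M" if "z \<in> frontier (cball 0 (4 * \<rho>))" for z
      using that empty.prems(4) by (intro empty.prems(5)) simp
    show "q \<in> cball 0 (4 * \<rho>)" using empty.prems(3,4) by simp
  qed simp
  then show ?case by simp
next
  case (insert a Z)
  define h where "h w = (if w = a then deriv g a else g w / (w - a))" for w
  have a: "g a = 0" "cmod a \<le> \<rho>" using insert.prems(2) by auto
  have gh: "g w = (w - a) * h w" for w using a by (simp add: h_def)
  have "h holomorphic_on UNIV"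
  proof (rule pole_theorem_0[of g _ a])
    show "g w = (w - a) * h w" for w by (rule gh)
  qed (use insert.prems(1) a in \<open>simp_all add: h_def\<close>)
  moreover have "h b = 0 \<and> cmod b \<le> \<rho>" if "b \<in> Z" for b
    using insert.prems(2)[of b] insert.hyps(2) that by (auto simp: h_def)
  moreover have "cmod (h w) \<le> M / (3 * \<rho>)" if w: "cmod w = 4 * \<rho>" for w
  proof -
    \<comment> \<open>On the circle |w - a| \<ge> 4\<rho> - \<rho>, whereas |q - a| \<le> 2\<rho>;
      the quotient is the factor 2/3.\<close>
    have d: "3 * \<rho> \<le> cmod (w - a)" using norm_triangle_ineq2[of w a] w a by simp
    have "3 * \<rho> * cmod (h w) \<le> cmod (w - a) * cmod (h w)" using d by (intro mult_right_mono) auto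
    also have "\<dots> = cmod (g w)" by (simp add: gh[of w] norm_mult)
    also have "\<dots> \<le> M" by (rule insert.prems(5)[OF w])
    finally show ?thesis using insert.prems(4) by (simp add: field_simps)
  qed
  ultimately have "cmod (h q) \<le> M / (3 * \<rho>) * (2 / 3) ^ card Z"
    using insert.prems(3,4) by (intro insert.IH)
  moreover have "cmod (q - a) \<le> 2 * \<rho>" using norm_triangle_ineq4[of q a] insert.prems(3) a by simp
  ultimately have "cmod (q - a) * cmod (h q) \<le> (2 * \<rho>) * (M / (3 * \<rho>) * (2 / 3) ^ card Z)"
    using insert.prems(4) by (intro mult_mono) auto
  also have "\<dots> = M * (2 / 3) ^ card (insert a Z)"
    using insert.hyps insert.prems(4) by (simp add: field_simps)
  finally show ?case by (simp add: gh[of q] norm_mult)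
qed

text \<open>A Rouche argument carried out by the maximum principle for 1/g: without a zero its
  modulus at the centre would be at most 8/3, since |g| \<ge> 1/2 - 1/8 on the circle, but |g(c)| <
  1/8.\<close>

lemma zero_near_linear:
  assumes g: "g holomorphic_on UNIV" and close: "\<And>w. cmod w \<le> 1 / 2 \<Longrightarrow> cmod (g (c + w) - w) < 1 / 8"
  shows "\<exists>a. cmod (a - c) < 1 / 2 \<and> g a = 0"
proof (rule ccontr)
  assume none: "\<not> ?thesis"
  have close': "cmod (g u - (u - c)) < 1 / 8" if "u \<in> cball c (1 / 2)" for u
    using close[of "u - c"] that by (simp add: dist_norm norm_minus_commute)
  have edge: "3 / 8 \<le> cmod (g u)" if "cmod (u - c) = 1 / 2" for u
    using close'[of u] norm_triangle_ineq2[of "u - c" "u - c - g u"] that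
    by (simp add: dist_norm norm_minus_commute)
  have nz: "g u \<noteq> 0" if "u \<in> cball c (1 / 2)" for u
  proof (cases "cmod (u - c) = 1 / 2")
    case True
    then show ?thesis using edge[OF True] by auto
  next
    case False
    then show ?thesis using none that by (auto simp: dist_norm norm_minus_commute)
  qed
  have hol: "(\<lambda>u. inverse (g u)) holomorphic_on cball c (1 / 2)"
    using nz by (intro holomorphic_on_inverse holomorphic_on_subset[OF g]) auto
  have "cmod (inverse (g c)) \<le> 8 / 3"
  proof (rule maximum_modulus_frontier[of "\<lambda>u. inverse (g u)" "cball c (1 / 2)"])
    show "cmod (inverse (g u)) \<le> 8 / 3" if "u \<in> frontier (cball c (1 / 2))" for u
    proof -
      have "cmod (u - c) = 1 / 2" using that by (simp add: dist_norm norm_minus_commute)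
      from le_imp_inverse_le[OF edge[OF this]] show ?thesis by (simp add: norm_inverse)
    qed
  qed (use hol in \<open>auto intro: holomorphic_on_subset holomorphic_on_imp_continuous_on\<close>)
  moreover have "cmod (g c) < 1 / 8" using close'[of c] by simp
  then have "8 < cmod (inverse (g c))"
    using nz[of c] less_imp_inverse_less[of "cmod (g c)" "1 / 8"] by (simp add: norm_inverse)
  ultimately show False by simp
qed

lemma lower_density_posD:
  assumes "0 < lower_density S"
  obtains d N0 where "0 < d" "\<And>N. N0 \<le> N \<Longrightarrow> d * real (N + 1) \<le> real (card (S \<inter> {..N}))"
proof -
  obtain d where d: "0 < ereal d" "ereal d < lower_density S"
    using ereal_dense2[OF assms] by blast
  have "\<forall>\<^sub>F N in sequentially. ereal d < ereal (real (card (S \<inter> {..N})) / real (N + 1))"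
    using d(2) unfolding lower_density_def by (rule less_LiminfD)
  then obtain N0 where "\<And>N. N0 \<le> N \<Longrightarrow> d < real (card (S \<inter> {..N})) / real (N + 1)"
    unfolding eventually_sequentially by auto
  then show ?thesis using d(1)
    by (intro that[of d N0]) (auto simp: pos_less_divide_eq less_imp_le)
qed

context translation_setting
begin

text \<open>With about d \<rho> zeros in the disc of radius \<rho>,
  \<open>zeros_maximum_modulus\<close> bounds the fixed non-zero number |g(q)| by roughly C
  exp(\<epsilon>(r) r) (2/3)^(d \<rho>), where r = 4 \<rho> ||z0||. A single large r with small
  \<epsilon>(r) is contradictory, and the limit inferior provides one.\<close>

lemma not_frequently_hypercyclic:
  fixes \<epsilon> :: "real \<Rightarrow> real"
  assumes \<epsilon>: "Liminf at_top (\<lambda>r. ereal (\<epsilon> r)) = 0" and C: "0 < C"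
    and f: "f \<in> Hb" and fhc: "frequently_hypercyclic Hb_top (shift z0) f"
    and growth: "\<And>z. z \<in> carr E \<Longrightarrow> cmod (f z) \<le> C * exp (\<epsilon> (vnorm E z) * vnorm E z)"
  shows False
proof -
  define s where "s = vnorm E z0"
  have s: "0 < s" using z0_pos by (simp add: s_def)
  \<comment> \<open>As a block, \<open>\<eta>\<close> has translates with the required
    expansions.\<close>
  have \<eta>_eq: "block \<eta> 1 \<eta> (\<lambda>_. 1) = \<eta>"
    by (auto simp: block_def on_carr_def functional_off[OF \<eta>])
  have \<eta>_HbA: "\<eta> \<in> Hb"
  proof (rule HbA_I)
    show "shift a \<eta> \<in> X" if "a \<in> carr E" for a
      using translation_block_X[OF \<eta> H \<eta> H _ that, of "\<lambda>_. 1" 1] unfolding \<eta>_eq by simp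
  qed (rule functional_off[OF \<eta>])
  \<comment> \<open>The seminorm of radius ||z0|| controls the values at w \<open>z0\<close> for |w|
    \<le> 1, and 1/8 is the margin of \<open>zero_near_linear\<close>.\<close>
  define U where "U = pball \<eta> s (1 / 8)"
  define S where "S = {n. (shift z0 ^^ n) f \<in> U}"
  have "openin Hb_top U"
    unfolding U_def using \<eta>_HbA s by (intro openin_HbA_ball) auto
  moreover have "\<eta> \<in> U" using \<eta>_HbA by (simp add: U_def p_zero)
  ultimately have "0 < lower_density S"
    using fhc unfolding frequently_hypercyclic_def S_def by blast
  then obtain d N0 where d: "0 < d" "\<And>N. N0 \<le> N \<Longrightarrow> d * real (N + 1) \<le> real (card (S \<inter> {..N}))"
    using lower_density_posD by blast
  define g where "g w = f (vscale E w z0)" for w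
  have f_ent: "f \<in> entire_funs E" using f by (simp add: HbA_def)
  have g_hol: "g holomorphic_on UNIV"
    unfolding g_def by (rule entire_line_holomorphic[OF f_ent z0(1)])
  have close: "cmod (g (of_nat n + w) - w) < 1 / 8" if n: "n \<in> S" and w: "cmod w \<le> 1" for n w
  proof -
    let ?h = "shift (vscale E (of_nat n) z0) f"
    have "(shift z0 ^^ n) f = ?h"
      using f_ent by (intro translation_funpow) (auto simp: entire_funs_def)
    then have h: "?h \<in> Hb" "p s (\<lambda>x. ?h x - \<eta> x) < 1 / 8"
      using n by (auto simp: S_def U_def)
    have "vnorm E (vscale E w z0) \<le> s"
      using w z0_pos by (simp add: norm_scale z0 s_def mult_left_le_one_le)
    then have "cmod (?h (vscale E w z0) - \<eta> (vscale E w z0)) \<le> p s (\<lambda>x. ?h x - \<eta> x)"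
      using p_eval[OF X_diff[OF HbA_X[OF h(1)] HbA_X[OF \<eta>_HbA]] s scale_closed[OF z0(1)]] by simp
    moreover have "?h (vscale E w z0) = g (of_nat n + w)"
      using scale_add_left[OF z0(1), of w "of_nat n"]
      by (simp add: translation_def on_carr_def scale_closed z0 g_def add.commute)
    moreover have "\<eta> (vscale E w z0) = w"
      by (simp add: functional_scale[OF \<eta> z0(1)] \<eta>_z0)
    ultimately show ?thesis using h(2) by simp
  qed
  have "\<exists>a. cmod (a - of_nat n) < 1 / 2 \<and> g a = 0" if "n \<in> S" for n
    using close[OF that] by (intro zero_near_linear[OF g_hol]) auto
  then obtain a where a: "\<And>n. n \<in> S \<Longrightarrow> cmod (a n - of_nat n) < 1 / 2" "\<And>n. n \<in> S \<Longrightarrow> g (a n) = 0"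
    by metis
  \<comment> \<open>Each zero is closer than 1/2 to its visit time, and distinct visit times differ
    by at least 1.\<close>
  have a_inj: "inj_on a S"
  proof (rule inj_onI)
    fix m n assume mn: "m \<in> S" "n \<in> S" "a m = a n"
    have "cmod (of_nat m - of_nat n) < 1"
      using norm_triangle_ineq4[of "a n - of_nat n" "a m - of_nat m"] a(1)[OF mn(1)] a(1)[OF mn(2)] mn(3)
      by (simp add: algebra_simps)
    then have "\<bar>real m - real n\<bar> < 1"
      by (metis norm_of_real of_real_diff of_real_of_nat_eq real_norm_def)
    then show "m = n" by linarith
  qed
  have "S \<noteq> {}" using d(2)[of N0] d(1) by (auto simp: mult_le_0_iff)
  then obtain n0 where n0: "n0 \<in> S" by blast
  \<comment> \<open>At n0 + 1/2 the function g is within 1/8 of 1/2, hence not zero.\<close>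
  define q where "q = of_nat n0 + (1 / 2 :: complex)"
  have gq: "0 < cmod (g q)"
    using close[OF n0, of "1 / 2"] by (auto simp: q_def norm_divide)
  define l where "l = ln (3 / 2 :: real)"
  have l: "0 < l" by (simp add: l_def)
  \<comment> \<open>Chosen so that \<kappa> r is half of the gain d l \<rho> from the zeros when r =
    4 \<rho> s.\<close>
  define \<kappa> where "\<kappa> = d * l / (8 * s)"
  have \<kappa>: "0 < \<kappa>" using d l s by (simp add: \<kappa>_def)
  \<comment> \<open>The three entries place q in the disc, make N at least N0, and contradict the
    final inequality; the summand 1 makes the last comparison strict.\<close>
  define \<rho>0 where "\<rho>0 = max (max (cmod q) (real N0 + 2)) (2 * (ln C + d * l - ln (cmod (g q))) / (d * l) + 1)"
  have "\<not> (\<forall>\<^sub>F r in at_top. ereal \<kappa> \<le> ereal (\<epsilon> r))"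
  proof
    assume "\<forall>\<^sub>F r in at_top. ereal \<kappa> \<le> ereal (\<epsilon> r)"
    then have "ereal \<kappa> \<le> Liminf at_top (\<lambda>r. ereal (\<epsilon> r))" by (rule Liminf_bounded)
    then show False using \<epsilon> \<kappa> by simp
  qed
  then obtain r where r: "4 * s * \<rho>0 \<le> r" "\<epsilon> r < \<kappa>"
    unfolding eventually_at_top_linorder by (auto simp: not_le)
  define \<rho> where "\<rho> = r / (4 * s)"
  have r_eq: "r = 4 * \<rho> * s" using s by (simp add: \<rho>_def)
  have \<rho>: "\<rho>0 \<le> \<rho>" using r s by (simp add: \<rho>_def field_simps)
  then have \<rho>': "cmod q \<le> \<rho>" "real N0 + 2 \<le> \<rho>" "2 * (ln C + d * l - ln (cmod (g q))) / (d * l) < \<rho>"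
    by (auto simp: \<rho>0_def)
  then have \<rho>_pos: "0 < \<rho>" by linarith
  \<comment> \<open>With N + 1 \<le> \<rho>, the zeros belonging to n \<le> N lie in the disc of
    radius \<rho>.\<close>
  define N where "N = nat \<lfloor>\<rho>\<rfloor> - 1"
  have N: "N0 \<le> N" "real N + 1 \<le> \<rho>" "\<rho> - 1 \<le> real N + 1"
    using \<rho>'(2) unfolding N_def by linarith+
  let ?Z = "a ` (S \<inter> {..N})"
  have "cmod (g q) \<le> (C * exp (\<epsilon> r * r)) * (2 / 3) ^ card ?Z"
  proof (rule zeros_maximum_modulus[OF _ g_hol _ \<rho>'(1) \<rho>_pos])
    show "g b = 0 \<and> cmod b \<le> \<rho>" if b: "b \<in> ?Z" for b
    proof -
      obtain n where n: "n \<in> S" "n \<le> N" "b = a n" using b by auto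
      have "cmod (a n) \<le> cmod (a n - of_nat n) + real n"
        using norm_triangle_ineq[of "a n - of_nat n" "of_nat n"] by simp
      then show ?thesis using a[OF n(1)] n N(2) by (auto simp: n(3))
    qed
    show "cmod (g w) \<le> C * exp (\<epsilon> r * r)" if w: "cmod w = 4 * \<rho>" for w
      using growth[OF scale_closed[OF z0(1)], of w] w by (simp add: g_def norm_scale z0 r_eq s_def)
  qed simp
  then have "ln (cmod (g q)) \<le> ln ((C * exp (\<epsilon> r * r)) * (2 / 3) ^ card ?Z)"
    using gq by (intro ln_mono) auto
  also have "\<dots> = ln C + \<epsilon> r * r - real (card ?Z) * l"
    using C by (simp add: ln_mult ln_realpow l_def ln_div algebra_simps)
  also have "card ?Z = card (S \<inter> {..N})"
    by (intro card_image inj_on_subset[OF a_inj]) auto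
  also have "ln C + \<epsilon> r * r - real (card (S \<inter> {..N})) * l \<le> ln C + \<kappa> * r - d * (\<rho> - 1) * l"
  proof -
    have "\<epsilon> r * r \<le> \<kappa> * r" using r(2) \<rho>_pos s by (intro mult_right_mono) (auto simp: r_eq)
    moreover have "d * (\<rho> - 1) \<le> d * real (N + 1)" using N(3) d(1) by (intro mult_left_mono) auto
    then have "d * (\<rho> - 1) * l \<le> real (card (S \<inter> {..N})) * l"
      using d(2)[OF N(1)] l by (intro mult_right_mono) auto
    ultimately show ?thesis by linarith
  qed
  also have "\<dots> = ln C + d * l - d * l * \<rho> / 2"
    using s by (simp add: \<kappa>_def r_eq field_simps)
  finally have "d * l * \<rho> \<le> 2 * (ln C + d * l - ln (cmod (g q)))" by simp
  moreover have "2 * (ln C + d * l - ln (cmod (g q))) < d * l * \<rho>"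
    using \<rho>'(3) d(1) l by (simp add: pos_divide_less_eq mult.commute)
  ultimately show False by linarith
qed

end

theorem proposition4p5:
  fixes \<AA> :: "nat \<Rightarrow> 'a poly_ideal"
    and E :: "'a cnspace"
    and c :: "nat \<Rightarrow> nat \<Rightarrow> real"
    and z0 :: 'a
  assumes "holomorphy_type \<AA>"
    and "complex_banach E"
    and "separable_space (vtopology (dual_space E))"
    and "\<And>k. vtopology (ideal_space (\<AA> k) E) closure_of finite_type_polys E k
               = carr (ideal_space (\<AA> k) E)"
    and "weakly_differentiable \<AA> E c"
    and "\<And>k l. c k l \<le> real ((k + l) ^ (k + l)) / fact (k + l) * (fact k / real (k ^ k))
                         * (fact l / real (l ^ l))"
    and "z0 \<in> carr E"
    and "z0 \<noteq> vzero E"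
  shows "(\<forall>\<epsilon>::real. \<epsilon> > 0 \<longrightarrow>
            (\<exists>C>0. \<exists>f \<in> HbA \<AA> E.
               frequently_hypercyclic (HbA_topology \<AA> E) (translation E z0) f \<and>
               (\<forall>z \<in> carr E. cmod (f z) \<le> C * exp (\<epsilon> * vnorm E z))))
       \<and> (\<forall>(\<epsilon> :: real \<Rightarrow> real) (C::real).
            (\<forall>r\<ge>0. \<epsilon> r \<ge> 0) \<longrightarrow> Liminf at_top (\<lambda>r. ereal (\<epsilon> r)) = 0 \<longrightarrow> C > 0 \<longrightarrow>
            \<not> (\<exists>f \<in> HbA \<AA> E.
                 frequently_hypercyclic (HbA_topology \<AA> E) (translation E z0) f \<and>
                 (\<forall>z \<in> carr E. cmod (f z) \<le> C * exp (\<epsilon> (vnorm E z) * vnorm E z))))"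
proof -
  interpret poly_ideals E \<AA> z0
    using assms(1,2,7,8)
    by (intro poly_ideals.intro poly_ideals_axioms.intro) (auto simp: holomorphy_type_def)
  obtain \<eta> H where "functional \<eta> H" "0 < H" "\<eta> z0 = 1"
    using exists_functional[OF z0] by blast
  then interpret translation_setting E \<AA> z0 \<eta> H
    by unfold_locales
  show ?thesis
    using exists_frequently_hypercyclic[OF assms(4,3)] not_frequently_hypercyclic by blast
qed

end
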